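(* Let $d$ be a positive integer and let $\beta \in BMO^1_{\alpha}(\mathbb B_n, \mathcal L(\mathbb C^d))$ be such that its Berezin transform $\widetilde\beta$ belongs to $L^\infty(\mathbb B_n, \mathcal L(\mathbb C^d))$. Then the Toeplitz operator $T_\beta$ on $A^2_\alpha(\mathbb B_n,\mathbb C^d)$ belongs to the $d$-dimensional Toeplitz algebra $\mathcal T^d_\alpha$.
   Context: Fix an integer $n\ge 1$ and a real $\alpha>-1$. $\mathbb B_n$ is the open unit ball of $\mathbb C^n$, $\langle z,w\rangle=\sum_k z_k\overline{w_k}$, and $d\nu_\alpha(z)=c_\alpha(1-|z|^2)^\alpha d\nu(z)$, where $\nu$ is Lebesgue measure and $c_\alpha$ is the constant making $\nu_\alpha$ a probability measure on $\mathbb B_n$. For a complex Banach space $E$ and $1\le p<\infty$, $L^p_\alpha(\mathbb B_n,E)$ is the Bochner–Lebesgue space of measurable $f:\mathbb B_n\to E$ with $\|f\|^p=\int_{\mathbb B_n}\|f(z)\|_E^p\,d\nu_\alpha(z)<\infty$; $L^\infty(\mathbb B_n,E)$ is the space of essentially bounded measurable functions; $A^p_\alpha(\mathbb B_n,E)$ is the subspace of holomorphic functions in $L^p_\alpha(\mathbb B_n,E)$; $H^\infty(\mathbb B_n,E)$ is the space of bounded holomorphic functions, which is dense in $A^2_\alpha(\mathbb B_n,E)$. $\mathcal L(E,F)$ denotes bounded linear operators and $\mathcal L(E)=\mathcal L(E,E)$. Kernels: $K^\alpha_z(w)=(1-\langle w,z\rangle)^{-(n+1+\alpha)}$, $k^\alpha_z(w)=(1-|z|^2)^{(n+1+\alpha)/2}(1-\langle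 w,z\rangle)^{-(n+1+\alpha)}$. For $a\in\mathbb B_n\setminus\{0\}$, $\varphi_a(z)=\dfrac{a-P_a(z)-\sqrt{1-|a|^2}\,Q_a(z)}{1-\langle z,a\rangle}$ with $P_a(z)=\frac{\langle z,a\rangle}{|a|^2}a$, $Q_a=I-P_a$; $\varphi_0(z)=-z$. For $b\in L^1_\alpha(\mathbb B_n,E)$ the Berezin transform is $\widetilde b(z)=\int_{\mathbb B_n}|k^\alpha_z(w)|^2b(w)\,d\nu_\alpha(w)$, and $b\in BMO^1_\alpha(\mathbb B_n,E)$ if $\|b\|_{BMO^1_\alpha(\mathbb B_n,E)}:=\sup_{z\in\mathbb B_n}\|b\circ\varphi_z-\widetilde b(z)\|_{L^1_\alpha(\mathbb B_n,E)}<\infty$. For $b\in L^1_\alpha(\mathbb B_n,\mathcal L(E,F))$ the Toeplitz operator $T_b$ is densely defined on $A^2_\alpha(\mathbb B_n,E)$ by $T_bf(z)=\int_{\mathbb B_n}b(w)(f(w))\overline{K^\alpha_z(w)}\,d\nu_\alpha(w)$, $f\in H^\infty(\mathbb B_n,E)$. It is known that if $b\in BMO^1_\alpha(\mathbb B_n,\mathcal L(E,F))$ and $\widetilde b\in L^\infty(\mathbb B_n,\mathcal L(E,F))$, then $T_b$ extends to a bounded operator $A^2_\alpha(\mathbb B_n,E)\to A^2_\alpha(\mathbb B_n,F)$, still denoted $T_b$. The Toeplitz algebra $\mathcal T^d_\alpha$ is the operator-norm closure in $\mathcal L(A^2_\alpha(\mathbb B_n,\mathbb C^d))$ of the set of finite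 sums of finite products of Toeplitz operators with symbols in $L^\infty(\mathbb B_n,\mathcal L(\mathbb C^d))$. *)

theory Defs
  imports "HOL-Analysis.Analysis"
begin

instance blinfun :: (euclidean_space, euclidean_space) second_countable_topology
proof
  have "\<exists>F. finite F \<and> cball (0::'a \<Rightarrow>\<^sub>L 'b) (real k) \<subseteq> (\<Union>x\<in>F. ball x (inverse (real (Suc m))))" for k m
  proof -
    have "compact (cball (0::'a \<Rightarrow>\<^sub>L 'b) (real k))"
      by (simp add: compact_eq_bounded_closed)
    then obtain F where "finite F" "cball (0::'a \<Rightarrow>\<^sub>L 'b) (real k) \<subseteq> (\<Union>x\<in>F. ball x (inverse (real (Suc m))))"
      using compact_eq_totally_bounded[of "cball (0::'a \<Rightarrow>\<^sub>L 'b) (real k)"]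
      by (metis inverse_positive_iff_positive of_nat_0_less_iff zero_less_Suc)
    then show ?thesis by blast
  qed
  then obtain F where fin: "\<And>k m. finite (F k m)"
    and cov: "\<And>k m. cball (0::'a \<Rightarrow>\<^sub>L 'b) (real k) \<subseteq> (\<Union>x\<in>F k m. ball x (inverse (real (Suc m))))"
    by metis
  define B where "B = (\<Union>k. \<Union>m. (\<lambda>x. ball x (inverse (real (Suc m)))) ` F k m)"
  have cB: "countable B"
    unfolding B_def using fin by (simp add: countable_finite)
  have basis: "\<exists>U\<in>B. x \<in> U \<and> U \<subseteq> S" if "open S" "x \<in> S" for S and x :: "'a \<Rightarrow>\<^sub>L 'b"
  proof -
    obtain e where e: "e > 0" "ball x e \<subseteq> S" using \<open>open S\<close> \<open>x \<in> S\<close> openE by blast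
    obtain m where m: "inverse (real (Suc m)) < e / 2" using reals_Archimedean[of "e/2"] e by auto
    obtain k where k: "norm x \<le> real k" using real_arch_simple by blast
    from cov[of k m] k obtain y where y: "y \<in> F k m" "dist y x < inverse (real (Suc m))" by fastforce
    have "ball y (inverse (real (Suc m))) \<subseteq> ball x e"
    proof
      fix u assume "u \<in> ball y (inverse (real (Suc m)))"
      then have "dist y u < e / 2" "dist y x < e / 2" using y m by auto
      then show "u \<in> ball x e" using dist_triangle_half_r by auto
    qed
    then show ?thesis using y e unfolding B_def by fastforce
  qed
  have "topological_basis B"
    by (rule topological_basisI) (use basis in \<open>auto simp: B_def\<close>)
  then show "\<exists>B::('a \<Rightarrow>\<^sub>L 'b) set set. countable B \<and> open = generate_topology B"
    using cB topological_basis_imp_subbasis by blast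
qed

type_synonym 'd endo = "(complex^'d) \<Rightarrow>\<^sub>L (complex^'d)"

text \<open>\<open>'d endo\<close> is the real-linear bounded operators; the subset below is \<open>\<L>(\<complex>\<^sup>d)\<close>.
  The norm of \<open>'d endo\<close> is the operator norm, also for complex-linear operators.\<close>

definition clin_ops :: "'d::finite endo set" where
  "clin_ops = {A. \<forall>c v. blinfun_apply A (c *s v) = c *s blinfun_apply A v}"

definition hinner :: "complex^'n \<Rightarrow> complex^'n \<Rightarrow> complex" where
  "hinner z w = (\<Sum>k\<in>UNIV. z $ k * cnj (w $ k))"

abbreviation unit_ball :: "(complex^'n) set" where
  "unit_ball \<equiv> ball 0 1"

definition c_alpha :: "'n::finite itself \<Rightarrow> real \<Rightarrow> real" where
  "c_alpha _ \<alpha> = inverse (\<integral>z. (1 - (norm z)\<^sup>2) powr \<alpha> \<partial>lebesgue_on (unit_ball :: (complex^'n) set))"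

definition nu :: "real \<Rightarrow> (complex^'n) measure" where
  "nu \<alpha> = density (lebesgue_on unit_ball)
     (\<lambda>z. ennreal (c_alpha TYPE('n) \<alpha> * (1 - (norm z)\<^sup>2) powr \<alpha>))"

text \<open>The principal branch of the power is the usual one, since
  \<open>1 - hinner w z\<close> has positive real part on the ball.\<close>

definition Kern :: "real \<Rightarrow> complex^'n \<Rightarrow> complex^'n \<Rightarrow> complex" where
  "Kern \<alpha> z w = (1 - hinner w z) powr (- of_real (real CARD('n) + 1 + \<alpha>))"

definition kern :: "real \<Rightarrow> complex^'n \<Rightarrow> complex^'n \<Rightarrow> complex" where
  "kern \<alpha> z w = of_real ((1 - (norm z)\<^sup>2) powr ((real CARD('n) + 1 + \<alpha>) / 2)) * Kern \<alpha> z w"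

definition proj :: "complex^'n \<Rightarrow> complex^'n \<Rightarrow> complex^'n" where
  "proj a z = (hinner z a / of_real ((norm a)\<^sup>2)) *s a"

definition phi :: "complex^'n \<Rightarrow> complex^'n \<Rightarrow> complex^'n" where
  "phi a z = (if a = 0 then - z
     else inverse (1 - hinner z a) *s (a - proj a z - sqrt (1 - (norm a)\<^sup>2) *\<^sub>R (z - proj a z)))"

text \<open>In the following function spaces \<open>E\<close> is the space of values: a closed complex subspace of
  the ambient Banach space, such as \<^const>\<open>clin_ops\<close>. Symbols are only relevant on the ball.\<close>

definition L1 :: "real \<Rightarrow> 'e::{banach, second_countable_topology} set \<Rightarrow> (complex^'n \<Rightarrow> 'e) set" where
  "L1 \<alpha> E = {b. b \<in> unit_ball \<rightarrow> E \<and> integrable (nu \<alpha>) b}"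

definition Linf :: "'e::{banach, second_countable_topology} set \<Rightarrow> (complex^'n \<Rightarrow> 'e) set" where
  "Linf E = {b. b \<in> unit_ball \<rightarrow> E \<and> b \<in> borel_measurable (lebesgue_on unit_ball) \<and>
     (\<exists>C. AE z in lebesgue_on unit_ball. norm (b z) \<le> C)}"

definition berezin ::
    "real \<Rightarrow> (complex^'n \<Rightarrow> 'e::{banach, second_countable_topology}) \<Rightarrow> complex^'n \<Rightarrow> 'e" where
  "berezin \<alpha> b z = (\<integral>w. (cmod (kern \<alpha> z w))\<^sup>2 *\<^sub>R b w \<partial>nu \<alpha>)"

definition bmo_norm ::
    "real \<Rightarrow> (complex^'n \<Rightarrow> 'e::{banach, second_countable_topology}) \<Rightarrow> ennreal" where
  "bmo_norm \<alpha> b = (SUP z\<in>unit_ball. \<integral>\<^sup>+w. ennreal (norm (b (phi z w) - berezin \<alpha> b z)) \<partial>nu \<alpha>)"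

definition BMO1 :: "real \<Rightarrow> 'e::{banach, second_countable_topology} set \<Rightarrow> (complex^'n \<Rightarrow> 'e) set" where
  "BMO1 \<alpha> E = {b \<in> L1 \<alpha> E. bmo_norm \<alpha> b < \<infinity>}"

definition holomorphic_vec :: "(complex^'n \<Rightarrow> complex^'d) \<Rightarrow> (complex^'n) set \<Rightarrow> bool" where
  "holomorphic_vec f U \<longleftrightarrow>
     (\<forall>z\<in>U. \<exists>D. (f has_derivative D) (at z) \<and> (\<forall>c v. D (c *s v) = c *s D v))"

text \<open>Functions on the ball are represented by total functions vanishing off the ball, so that
  equality in the function spaces below is equality in HOL.\<close>

definition Hinf :: "(complex^'n \<Rightarrow> complex^'d) set" where
  "Hinf = {f. holomorphic_vec f unit_ball \<and> bounded (f ` unit_ball) \<and> (\<forall>z. z \<notin> unit_ball \<longrightarrow> f z = 0)}"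

definition A2 :: "real \<Rightarrow> (complex^'n \<Rightarrow> complex^'d) set" where
  "A2 \<alpha> = {f. holomorphic_vec f unit_ball \<and> integrable (nu \<alpha>) (\<lambda>z. (norm (f z))\<^sup>2) \<and>
     (\<forall>z. z \<notin> unit_ball \<longrightarrow> f z = 0)}"

definition A2_norm :: "real \<Rightarrow> (complex^'n \<Rightarrow> complex^'d) \<Rightarrow> real" where
  "A2_norm \<alpha> f = sqrt (\<integral>z. (norm (f z))\<^sup>2 \<partial>nu \<alpha>)"

type_synonym ('n, 'd) fun_op = "(complex^'n \<Rightarrow> complex^'d) \<Rightarrow> complex^'n \<Rightarrow> complex^'d"

definition bounded_ops :: "real \<Rightarrow> ('n::finite, 'd::finite) fun_op set" where
  "bounded_ops \<alpha> = {T \<in> A2 \<alpha> \<rightarrow>\<^sub>E A2 \<alpha>.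
     (\<forall>f\<in>A2 \<alpha>. \<forall>g\<in>A2 \<alpha>. T (\<lambda>z. f z + g z) = (\<lambda>z. T f z + T g z)) \<and>
     (\<forall>c. \<forall>f\<in>A2 \<alpha>. T (\<lambda>z. c *s f z) = (\<lambda>z. c *s T f z)) \<and>
     (\<exists>C. \<forall>f\<in>A2 \<alpha>. A2_norm \<alpha> (T f) \<le> C * A2_norm \<alpha> f)}"

definition op_norm :: "real \<Rightarrow> ('n::finite, 'd::finite) fun_op \<Rightarrow> real" where
  "op_norm \<alpha> T = (SUP f\<in>{f \<in> A2 \<alpha>. A2_norm \<alpha> f \<le> 1}. A2_norm \<alpha> (T f))"

definition toeplitz_int :: "real \<Rightarrow> (complex^'n \<Rightarrow> 'd::finite endo) \<Rightarrow> ('n, 'd) fun_op" where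
  "toeplitz_int \<alpha> b f z =
     (if z \<in> unit_ball then \<integral>w. cnj (Kern \<alpha> z w) *s blinfun_apply (b w) (f w) \<partial>nu \<alpha> else 0)"

text \<open>The bounded extension to the Bergman space, unique because \<^const>\<open>Hinf\<close> is dense in it.\<close>

definition toeplitz :: "real \<Rightarrow> (complex^'n \<Rightarrow> 'd::finite endo) \<Rightarrow> ('n, 'd) fun_op" where
  "toeplitz \<alpha> b = (THE T. T \<in> bounded_ops \<alpha> \<and> (\<forall>f\<in>Hinf. T f = toeplitz_int \<alpha> b f))"

inductive_set toeplitz_prods :: "real \<Rightarrow> ('n::finite, 'd::finite) fun_op set" for \<alpha> :: real where
  "b \<in> Linf clin_ops \<Longrightarrow> toeplitz \<alpha> b \<in> toeplitz_prods \<alpha>"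
| "S \<in> toeplitz_prods \<alpha> \<Longrightarrow> T \<in> toeplitz_prods \<alpha> \<Longrightarrow> compose (A2 \<alpha>) S T \<in> toeplitz_prods \<alpha>"

inductive_set toeplitz_sums :: "real \<Rightarrow> ('n::finite, 'd::finite) fun_op set" for \<alpha> :: real where
  "T \<in> toeplitz_prods \<alpha> \<Longrightarrow> T \<in> toeplitz_sums \<alpha>"
| "S \<in> toeplitz_sums \<alpha> \<Longrightarrow> T \<in> toeplitz_sums \<alpha> \<Longrightarrow>
     restrict (\<lambda>f z. S f z + T f z) (A2 \<alpha>) \<in> toeplitz_sums \<alpha>"

definition toeplitz_algebra :: "real \<Rightarrow> ('n::finite, 'd::finite) fun_op set" where
  "toeplitz_algebra \<alpha> = {T \<in> bounded_ops \<alpha>.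
     \<forall>\<epsilon>>0. \<exists>S\<in>toeplitz_sums \<alpha>. op_norm \<alpha> (\<lambda>f z. T f z - S f z) < \<epsilon>}"

end

theory Submission
  imports Defs "HOL-Complex_Analysis.Complex_Analysis"
begin

text \<open>Let \<open>b\<^sub>r v\<close> be the average of \<open>\<beta> w\<close> over the Bergman ball \<open>norm (phi w v) < r\<close>, with the weight
  \<open>(cmod (kern \<alpha> w v))\<^sup>2\<close>. By Fubini the average moves from the symbol to the functions: the form of
  the Toeplitz operator with symbol \<open>b\<^sub>r\<close> integrates over \<open>w\<close> the mean of \<open>hinner (\<beta> w (f v)) (g v)\<close>
  over the \<open>v\<close> in the Bergman ball of radius \<open>r\<close> around \<open>w\<close>. Holomorphic functions oscillate by \<open>O(r)\<close>
  on this ball, relative to their mean square over a ball of fixed radius. Since \<open>\<beta>\<close> has bounded mean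
  oscillation and a bounded Berezin transform, \<open>norm (\<beta> w) d nu\<close> is a Carleson measure, so the forms
  with symbols \<open>\<beta>\<close> and \<open>b\<^sub>r\<close> differ by \<open>O(r)\<close>. As \<open>b\<^sub>r\<close> is bounded, the Toeplitz operator with symbol
  \<open>\<beta>\<close> is a norm limit of Toeplitz operators with bounded symbols.\<close>

section \<open>Change of variables in Euclidean spaces\<close>

text \<open>The weight of the average is the kernel centred at \<open>w\<close>, although
  \<open>w\<close> is the variable integrated out. For fixed \<open>w\<close> the substitution
  \<open>phi w\<close> turns it into the uniform weight of \<open>nu\<close> on
  \<open>ball 0 r\<close>, whose mass does not depend on \<open>w\<close>. The mean that appears
  after Fubini is thus exactly normalised, and comparing it with the value at \<open>w\<close> is a
  question about holomorphic functions near the origin, with constants independent of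
  \<open>w\<close>. The price is that the kernel centred at \<open>w\<close> must be replaced by the
  one centred at \<open>v\<close> before the Carleson bound applies. The bound on
  \<open>b\<^sub>r\<close> degenerates as \<open>r\<close> tends to 0, which is harmless because
  only the form of the difference has to be small. The obstacle is that \<beta> need not be bounded:
  its Toeplitz operator is specified as an extension from \<open>Hinf\<close>, and the projection of
  \<open>\<beta> f\<close> is a priori the projection of a merely integrable function. Boundedness
  is therefore extracted from the sesquilinear form, by testing against functions supported away
  from the sphere, where every integral converges absolutely.\<close>

text \<open>The library proves the change of variables formula on \<open>real ^ 'i\<close> with \<open>'i\<close> a finite wellorder;
  the type of basis vectors makes it available on every Euclidean space, such as \<open>complex ^ 'n\<close>.\<close>

typedef (overloaded) 'a basis_index = "Basis :: 'a::euclidean_space set"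
  by (meson nonempty_Basis ex_in_conv)

lemma inj_to_nat_basis_index: "inj (to_nat_on (Basis :: 'a::euclidean_space set) \<circ> Rep_basis_index)"
  by (rule injI) (metis Rep_basis_index Rep_basis_index_inject comp_apply countable_finite
      finite_Basis inj_on_to_nat_on inj_on_eq_iff)

instance basis_index :: (euclidean_space) finite
proof
  have "(UNIV :: 'a basis_index set) = Abs_basis_index ` Basis"
    by (metis Abs_basis_index_cases UNIV_eq_I imageI)
  then show "finite (UNIV :: 'a basis_index set)"
    by (metis finite_Basis finite_imageI)
qed

text \<open>The order is pulled back from the naturals along an enumeration of the basis; no later
  result depends on the enumeration.\<close>

instantiation basis_index :: (euclidean_space) wellorder
begin

definition less_eq_basis_index :: "'a basis_index \<Rightarrow> 'a basis_index \<Rightarrow> bool" where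
  "i \<le> j \<longleftrightarrow> (to_nat_on (Basis :: 'a set) \<circ> Rep_basis_index) i
     \<le> (to_nat_on (Basis :: 'a set) \<circ> Rep_basis_index) j"

definition less_basis_index :: "'a basis_index \<Rightarrow> 'a basis_index \<Rightarrow> bool" where
  "i < j \<longleftrightarrow> (to_nat_on (Basis :: 'a set) \<circ> Rep_basis_index) i
     < (to_nat_on (Basis :: 'a set) \<circ> Rep_basis_index) j"

instance
proof
  fix P :: "'a basis_index \<Rightarrow> bool" and i :: "'a basis_index"
  assume step: "\<And>i. (\<And>j. j < i \<Longrightarrow> P j) \<Longrightarrow> P i"
  show "P i"
    by (induction i rule: measure_induct_rule[of "to_nat_on (Basis :: 'a set) \<circ> Rep_basis_index"])
      (rule step, simp add: less_basis_index_def)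
next
  fix i j :: "'a basis_index"
  assume "i \<le> j" "j \<le> i"
  then show "i = j"
    using inj_to_nat_basis_index[where 'a='a] unfolding less_eq_basis_index_def inj_def
    by (metis order_antisym)
next
  fix i j k :: "'a basis_index"
  show "i \<le> i" "i \<le> j \<or> j \<le> i"
    by (simp_all only: less_eq_basis_index_def linear order_refl)
  show "i < j \<longleftrightarrow> i \<le> j \<and> \<not> j \<le> i"
    by (simp only: less_basis_index_def less_eq_basis_index_def less_le_not_le)
  assume "i \<le> j" "j \<le> k"
  then show "i \<le> k"
    unfolding less_eq_basis_index_def by (rule order_trans)
qed

end

section \<open>Orthonormal coordinates and Lebesgue measure\<close>

definition coords :: "'a::euclidean_space \<Rightarrow> real ^ 'a basis_index" where
  "coords x = (\<chi> i. x \<bullet> Rep_basis_index i)"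

definition of_coords :: "real ^ 'a basis_index \<Rightarrow> 'a::euclidean_space" where
  "of_coords v = (\<Sum>i\<in>UNIV. (v $ i) *\<^sub>R Rep_basis_index i)"

lemma bij_Rep_basis_index: "bij_betw Rep_basis_index UNIV (Basis :: 'a::euclidean_space set)"
proof (rule bij_betwI')
  fix b :: 'a assume "b \<in> Basis"
  then show "\<exists>i\<in>UNIV. b = Rep_basis_index i"
    by (metis Rep_basis_index_cases UNIV_I)
qed (simp_all add: Rep_basis_index Rep_basis_index_inject)

lemma of_coords_coords [simp]: "of_coords (coords x) = x"
proof -
  have "(\<Sum>i\<in>UNIV. (x \<bullet> Rep_basis_index i) *\<^sub>R Rep_basis_index i) = (\<Sum>b\<in>Basis. (x \<bullet> b) *\<^sub>R b)"
    using sum.reindex_bij_betw[OF bij_Rep_basis_index, of "\<lambda>b. (x \<bullet> b) *\<^sub>R b"] .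
  then show ?thesis
    by (simp add: of_coords_def coords_def euclidean_representation)
qed

lemma inner_Rep_basis_index: "Rep_basis_index i \<bullet> Rep_basis_index j = (if i = j then 1 else 0)"
  using Rep_basis_index[of i] Rep_basis_index[of j]
  by (auto simp: inner_Basis Rep_basis_index_inject)

lemma coords_of_coords [simp]: "coords (of_coords v) = v"
  by (simp add: of_coords_def coords_def vec_eq_iff inner_sum_left inner_Rep_basis_index if_distrib
      sum.delta' cong: if_cong)

lemma linear_coords: "linear coords"
  by (auto intro!: linearI simp: coords_def vec_eq_iff inner_simps)

lemma linear_of_coords: "linear of_coords"
  by (auto intro!: linearI simp: of_coords_def scaleR_add_left sum.distrib scaleR_sum_right)

lemma inner_coords: "coords x \<bullet> coords y = x \<bullet> y"
proof -
  have "coords x \<bullet> coords y = (\<Sum>i\<in>UNIV. (x \<bullet> Rep_basis_index i) * (y \<bullet> Rep_basis_index i))"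
    by (simp add: inner_vec_def coords_def)
  also have "\<dots> = (\<Sum>b\<in>Basis. (x \<bullet> b) * (y \<bullet> b))"
    using sum.reindex_bij_betw[OF bij_Rep_basis_index, of "\<lambda>b. (x \<bullet> b) * (y \<bullet> b)"] .
  finally show ?thesis
    by (subst euclidean_inner[of x y])
qed

lemma norm_coords: "norm (coords x) = norm x"
  by (simp add: norm_eq_sqrt_inner inner_coords)

lemma norm_of_coords: "norm (of_coords v) = norm v"
  by (metis coords_of_coords norm_coords)

lemma continuous_on_coords: "continuous_on S coords"
  by (intro linear_continuous_on linear_conv_bounded_linear[THEN iffD1] linear_coords)

text \<open>Orthonormal coordinates carry boxes to boxes with the same side lengths, and a measure
  that gives every box its volume is Lebesgue measure.\<close>

lemma lborel_coords: "distr lborel borel coords = (lborel :: (real ^ 'a::euclidean_space basis_index) measure)"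
proof (rule lborel_eqI[symmetric])
  fix l u :: "real ^ 'a basis_index"
  assume le: "\<And>b. b \<in> Basis \<Longrightarrow> l \<bullet> b \<le> u \<bullet> b"
  have le': "l $ i \<le> u $ i" for i
    using le[of "axis i 1"] by (simp add: inner_axis)
  have c: "of_coords v \<bullet> b = v $ Abs_basis_index b" if "b \<in> Basis" for v :: "real ^ 'a basis_index" and b
    using arg_cong[OF coords_of_coords[of v], of "\<lambda>v. v $ Abs_basis_index b"] that
    by (simp add: coords_def Abs_basis_index_inverse)
  have "coords -` box l u = (box (of_coords l) (of_coords u) :: 'a set)"
  proof -
    have "(\<forall>i. l $ i < coords x $ i \<and> coords x $ i < u $ i) \<longleftrightarrow>
      (\<forall>b\<in>Basis. l $ Abs_basis_index b < x \<bullet> b \<and> x \<bullet> b < u $ Abs_basis_index b)" for x :: 'a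
      by (auto simp: coords_def) (metis Abs_basis_index_inverse Rep_basis_index Rep_basis_index_inverse)+
    then show ?thesis
      by (auto simp: box_def mem_box_cart(1)[unfolded mem_box] c Basis_vec_def inner_axis)
  qed
  then have "emeasure (distr lborel borel coords) (box l u) = emeasure lborel (box (of_coords l) (of_coords u) :: 'a set)"
    by (subst emeasure_distr) (auto intro!: borel_measurable_continuous_onI continuous_on_coords)
  also have "\<dots> = (\<Prod>b\<in>Basis. (of_coords u - of_coords l) \<bullet> (b::'a))"
    using le' by (subst emeasure_lborel_box) (auto simp: c)
  also have "\<dots> = (\<Prod>i\<in>UNIV. (of_coords u - of_coords l) \<bullet> (Rep_basis_index i :: 'a))"
    using prod.reindex_bij_betw[OF bij_Rep_basis_index, of "\<lambda>b. (of_coords u - of_coords l) \<bullet> b"]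
    by simp
  also have "\<dots> = (\<Prod>i\<in>UNIV. (u - l) $ i)"
    by (simp add: inner_diff_left c Rep_basis_index Rep_basis_index_inverse)
  also have "\<dots> = (\<Prod>b\<in>Basis. (u - l) \<bullet> b)"
  proof -
    have "bij_betw (\<lambda>i. axis i 1) UNIV (Basis :: (real ^ 'a basis_index) set)"
      by (auto simp: bij_betw_def inj_on_def axis_eq_axis Basis_vec_def)
    from prod.reindex_bij_betw[OF this, of "\<lambda>b. (u - l) \<bullet> b"] show ?thesis
      by (simp add: inner_axis)
  qed
  finally show "emeasure (distr lborel borel coords) (box l u) = (\<Prod>b\<in>Basis. (u - l) \<bullet> b)" .
qed simp

lemma DIM_coords: "DIM(real ^ 'a basis_index) = DIM('a::euclidean_space)"
  using bij_betw_same_card[OF bij_Rep_basis_index] by (metis DIM_cart DIM_real mult.right_neutral)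

lemma sets_lebesgue_of_coords_image:
  fixes S :: "(real ^ 'a::euclidean_space basis_index) set"
  assumes "S \<in> sets lebesgue"
  shows "of_coords ` S \<in> sets lebesgue"
proof (rule differentiable_image_in_sets_lebesgue[OF assms])
  show "DIM(real ^ 'a basis_index) \<le> DIM('a)"
    by (simp only: DIM_coords order_refl)
  show "of_coords differentiable_on S"
    by (intro linear_imp_differentiable_on linear_of_coords)
qed

lemma sets_lebesgue_coords_image:
  fixes S :: "'a::euclidean_space set"
  assumes "S \<in> sets lebesgue"
  shows "coords ` S \<in> sets lebesgue"
proof (rule differentiable_image_in_sets_lebesgue[OF assms])
  show "DIM('a) \<le> DIM(real ^ 'a basis_index)"
    by (simp only: DIM_coords order_refl)
  show "coords differentiable_on S"
    by (intro linear_imp_differentiable_on linear_coords)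
qed

lemma coords_vimage: "coords -` S = of_coords ` S"
proof (intro set_eqI iffI)
  fix x assume "x \<in> coords -` S"
  then show "x \<in> of_coords ` S"
    by (intro image_eqI[of _ _ "coords x"]) simp_all
qed auto

lemma measurable_coords_lebesgue [measurable]: "coords \<in> lebesgue \<rightarrow>\<^sub>M lebesgue"
  by (rule measurableI) (simp_all add: coords_vimage sets_lebesgue_of_coords_image)

text \<open>The Borel case passes to completions because the pushforward and \<open>lborel\<close>
  have the same null sets.\<close>

lemma lebesgue_coords:
  "distr lebesgue lebesgue coords = (lebesgue :: (real ^ 'a::euclidean_space basis_index) measure)"
proof -
  have c: "coords \<in> lborel \<rightarrow>\<^sub>M (lborel :: (real ^ 'a basis_index) measure)"
    by (simp add: borel_measurable_continuous_onI continuous_on_coords)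
  have "distr lebesgue lborel coords = distr lborel lborel (coords :: 'a \<Rightarrow> _)"
    by (rule distr_completion[OF c])
  also have "\<dots> = lborel"
    using lborel_coords by (simp cong: distr_cong)
  finally have *: "distr lebesgue lborel (coords :: 'a \<Rightarrow> _) = lborel" .
  have "completion (distr lebesgue lborel (coords :: 'a \<Rightarrow> _)) = distr lebesgue lebesgue coords"
    by (rule completion.completion_distr_eq) (simp_all only: * measurable_completion[OF c])
  then show ?thesis
    by (simp only: *)
qed

text \<open>For linear \<open>L\<close>, the modulus of the real determinant. If \<open>L\<close> is
  complex-linear this is the squared modulus of the complex determinant, which is why squares appear
  in the formulas below.\<close>

definition vol_factor :: "('a::euclidean_space \<Rightarrow> 'a) \<Rightarrow> real" where
  "vol_factor L = \<bar>det (matrix (coords \<circ> L \<circ> of_coords))\<bar>"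

lemma linear_conj_coords: "linear L \<Longrightarrow> linear (coords \<circ> L \<circ> of_coords)"
  by (intro linear_compose linear_coords linear_of_coords)

text \<open>Conjugation with \<open>coords\<close> moves the problem to a space of vectors, where
  the formula gives a gauge integral. The Jacobian is nonnegative, so this is also a Lebesgue
  integral, and the invariance of Lebesgue measure under \<open>coords\<close> brings it
  back.\<close>

theorem emeasure_differentiable_image:
  fixes g :: "'a::euclidean_space \<Rightarrow> 'a"
  assumes S: "S \<in> sets lebesgue"
    and g: "\<And>x. x \<in> S \<Longrightarrow> (g has_derivative g' x) (at x within S)"
    and inj: "inj_on g S"
    and im: "g ` S \<in> lmeasurable"
    and [measurable]: "(\<lambda>x. vol_factor (g' x)) \<in> borel_measurable (lebesgue_on S)"
  shows "emeasure lebesgue (g ` S) = (\<integral>\<^sup>+x. vol_factor (g' x) \<partial>lebesgue_on S)"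
proof -
  define G where "G = coords \<circ> g \<circ> of_coords"
  define G' where "G' v = coords \<circ> g' (of_coords v) \<circ> of_coords" for v
  have S': "coords ` S \<in> sets lebesgue"
    by (rule sets_lebesgue_coords_image[OF S])
  have G: "(G has_derivative G' v) (at v within coords ` S)" if "v \<in> coords ` S" for v
  proof -
    have of: "of_coords ` coords ` S = S"
      by (simp add: image_image)
    have "of_coords v \<in> S"
      using that by auto
    note g[OF this]
    then have 1: "(g has_derivative g' (of_coords v)) (at (of_coords v) within of_coords ` coords ` S)"
      by (simp only: of)
    have 2: "(of_coords has_derivative of_coords) (at v within coords ` S)"
      by (intro linear_imp_has_derivative linear_of_coords)
    have 3: "(coords has_derivative coords) (at (g (of_coords v)) within X)" for X
      by (intro linear_imp_has_derivative linear_coords)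
    show ?thesis
      unfolding G_def G'_def comp_assoc
      by (intro diff_chain_within 2 1 3) (use 3 in \<open>simp add: o_def\<close>)
  qed
  have inj': "inj_on G (coords ` S)"
    using inj by (auto simp: inj_on_def G_def) (metis of_coords_coords)
  have im_eq: "G ` coords ` S = coords ` g ` S"
    by (simp add: G_def image_image)
  have em: "emeasure lebesgue (coords ` X) = emeasure lebesgue X" if "X \<in> sets lebesgue" for X :: "'a set"
  proof -
    have "emeasure lebesgue (coords ` X) = emeasure (distr lebesgue lebesgue coords) (coords ` X)"
      by (simp only: lebesgue_coords)
    also have "\<dots> = emeasure lebesgue (coords -` coords ` X)"
      by (subst emeasure_distr) (simp_all add: sets_lebesgue_coords_image[OF that])
    also have "coords -` coords ` X = X"
      by (simp add: coords_vimage image_image)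
    finally show ?thesis .
  qed
  have "G ` coords ` S \<in> lmeasurable"
    using im em[of "g ` S"] sets_lebesgue_coords_image[of "g ` S"]
    by (auto simp: im_eq fmeasurable_def)
  then have "((\<lambda>v. \<bar>det (matrix (G' v))\<bar>) has_integral measure lebesgue (G ` coords ` S)) (coords ` S)"
    using has_measure_differentiable_image[OF S' G inj'] by blast
  then have hi: "((\<lambda>v. vol_factor (g' (of_coords v))) has_integral measure lebesgue (g ` S)) (coords ` S)"
    using em[of "g ` S"] im unfolding G'_def vol_factor_def im_eq measure_def by simp
  have [measurable]: "(\<lambda>x. indicator S x * vol_factor (g' x)) \<in> borel_measurable lebesgue"
    using borel_measurable_restrict_space_iff[of S lebesgue "\<lambda>x. vol_factor (g' x)"] S
    by (simp add: mult.commute)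
  have ind: "indicator (coords ` S) (coords x) = (indicator S x :: real)" for x :: 'a
    by (auto simp: indicator_def) (metis of_coords_coords)
  have nn: "vol_factor L \<ge> 0" for L :: "'a \<Rightarrow> 'a"
    by (simp add: vol_factor_def)
  have "emeasure lebesgue (g ` S) = ennreal (measure lebesgue (g ` S))"
    by (rule emeasure_eq_measure2[OF im])
  also have "\<dots> = (\<integral>\<^sup>+v. indicator (coords ` S) v * vol_factor (g' (of_coords v)) \<partial>lebesgue)"
    using nn_integral_has_integral_lebesgue[OF nn hi]
    by (simp only: nn_integral_completion)
  also have "\<dots> = (\<integral>\<^sup>+v. indicator (coords ` S) v * vol_factor (g' (of_coords v)) \<partial>distr lebesgue lebesgue coords)"
    by (simp only: lebesgue_coords)
  also have "\<dots> = (\<integral>\<^sup>+x. indicator (coords ` S) (coords x) * vol_factor (g' (of_coords (coords x))) \<partial>lebesgue)"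
  proof (rule nn_integral_distr)
    have "(\<lambda>v. indicator (coords ` S) v *\<^sub>R vol_factor (g' (of_coords v))) \<in> borel_measurable lebesgue"
      using hi by (rule has_integral_implies_lebesgue_measurable)
    then show "(\<lambda>v. ennreal (indicator (coords ` S) v * vol_factor (g' (of_coords v))))
        \<in> borel_measurable (distr lebesgue lebesgue coords)"
      unfolding lebesgue_coords by simp
  qed simp
  also have "\<dots> = (\<integral>\<^sup>+x. indicator S x * vol_factor (g' x) \<partial>lebesgue)"
    by (simp only: ind of_coords_coords)
  also have "\<dots> = (\<integral>\<^sup>+x. vol_factor (g' x) \<partial>lebesgue_on S)"
    using S by (subst nn_integral_restrict_space) (auto simp: mult.commute indicator_def intro!: nn_integral_cong)
  finally show ?thesis .
qed

section \<open>Determinants of the building blocks of the automorphisms\<close>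

lemma vol_factor_nonneg: "vol_factor L \<ge> 0"
  by (simp add: vol_factor_def)

lemma vol_factor_compose:
  assumes "linear L" "linear M"
  shows "vol_factor (L \<circ> M) = vol_factor L * vol_factor M"
proof -
  have eq: "coords \<circ> (L \<circ> M) \<circ> of_coords = (coords \<circ> L \<circ> of_coords) \<circ> (coords \<circ> M \<circ> of_coords)"
    by (simp add: fun_eq_iff)
  show ?thesis
    unfolding vol_factor_def eq
    by (subst matrix_compose) (simp_all add: linear_conj_coords assms det_mul abs_mult)
qed

lemma vol_factor_id: "vol_factor (\<lambda>x::'a::euclidean_space. x) = 1"
proof -
  have "coords \<circ> (\<lambda>x::'a. x) \<circ> of_coords = id"
    by (simp add: fun_eq_iff)
  then show ?thesis
    by (simp only: vol_factor_def matrix_id_mat_1 det_I abs_one)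
qed

lemma vol_factor_isometry:
  assumes "linear L" "\<And>x. norm (L x) = norm x"
  shows "vol_factor L = 1"
proof -
  have "orthogonal_transformation (coords \<circ> L \<circ> of_coords)"
    unfolding orthogonal_transformation
    using assms by (auto simp: linear_conj_coords norm_coords norm_of_coords)
  then have "orthogonal_matrix (matrix (coords \<circ> L \<circ> of_coords))"
    by (simp add: orthogonal_transformation_matrix)
  then show ?thesis
    using det_orthogonal_matrix unfolding vol_factor_def by fastforce
qed

lemma vol_factor_diagonal:
  fixes c :: "'a::euclidean_space \<Rightarrow> real"
  assumes "\<And>x b. b \<in> Basis \<Longrightarrow> L x \<bullet> b = c b * (x \<bullet> b)"
  shows "vol_factor L = (\<Prod>b\<in>Basis. \<bar>c b\<bar>)"
proof -
  have "matrix (coords \<circ> L \<circ> of_coords) $ i $ j = (if i = j then c (Rep_basis_index i) else 0)" for i j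
  proof -
    have "matrix (coords \<circ> L \<circ> of_coords) $ i $ j = c (Rep_basis_index i) * (of_coords (axis j 1) \<bullet> Rep_basis_index i)"
      by (simp add: matrix_def coords_def assms Rep_basis_index)
    also have "of_coords (axis j 1) \<bullet> Rep_basis_index i = coords (of_coords (axis j 1)) $ i"
      by (simp only: coords_def vec_lambda_beta)
    also have "\<dots> = (if i = j then 1 else 0)"
      by (simp add: axis_def)
    finally show ?thesis
      by (simp del: comp_apply cong: if_cong)
  qed
  note m = this
  have "det (matrix (coords \<circ> L \<circ> of_coords)) = (\<Prod>i\<in>UNIV. c (Rep_basis_index i))"
    by (subst det_diagonal) (simp_all add: m)
  also have "\<dots> = (\<Prod>b\<in>Basis. c b)"
    by (rule prod.reindex_bij_betw[OF bij_Rep_basis_index, of c])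
  finally show ?thesis
    by (simp add: vol_factor_def abs_prod)
qed

lemma vol_factor_inverse:
  fixes L M :: "'a::euclidean_space \<Rightarrow> 'a"
  assumes "linear L" "linear M" "\<And>x. L (M x) = x"
  shows "vol_factor L * vol_factor M = 1"
proof -
  have "L \<circ> M = (\<lambda>x. x)"
    using assms by (simp add: fun_eq_iff)
  then show ?thesis
    using vol_factor_compose[OF assms(1,2)] vol_factor_id by metis
qed

text \<open>Similar maps have equal determinants: an injective endomorphism has a nonzero one, which
  cancels.\<close>

lemma vol_factor_intertwine:
  fixes L L' M :: "'a::euclidean_space \<Rightarrow> 'a"
  assumes "linear L" "linear L'" "linear M" "inj M" "\<And>x. M (L x) = L' (M x)"
  shows "vol_factor L = vol_factor L'"
proof -
  obtain M' where "linear M'" "\<And>x. M' (M x) = x"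
    using linear_injective_left_inverse[OF assms(3,4)] by (auto simp: fun_eq_iff)
  then have "vol_factor M \<noteq> 0"
    using vol_factor_inverse[of M' M] assms(3) by auto
  moreover have "M \<circ> L = L' \<circ> M"
    using assms by (simp add: fun_eq_iff)
  then have "vol_factor M * vol_factor L = vol_factor L' * vol_factor M"
    using vol_factor_compose assms by metis
  ultimately show ?thesis
    by simp
qed

definition scale_coord :: "'n \<Rightarrow> complex \<Rightarrow> complex^'n \<Rightarrow> complex^'n" where
  "scale_coord k c x = (\<chi> i. if i = k then c * x $ i else x $ i)"

lemma linear_scale_coord: "linear (scale_coord k c)"
  by (rule linearI) (simp_all add: scale_coord_def vec_eq_iff algebra_simps)

lemma Basis_complex_vec: "b \<in> (Basis :: (complex^'n) set) \<longleftrightarrow> (\<exists>k. b = axis k 1 \<or> b = axis k \<i>)"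
  by (auto simp: Basis_vec_def Basis_complex_def)

lemma norm_vec_cmult: "norm (c *s x :: complex^'n) = cmod c * norm x"
proof -
  have "norm (c *s x) = L2_set (\<lambda>i. cmod c * norm (x $ i)) UNIV"
    by (simp add: norm_vec_def norm_mult)
  also have "\<dots> = cmod c * norm x"
    by (simp add: norm_vec_def L2_set_right_distrib)
  finally show ?thesis .
qed

lemma vol_factor_scale_coord_of_real: "vol_factor (scale_coord (k::'n::finite) (of_real r)) = r\<^sup>2"
proof -
  have "vol_factor (scale_coord k (of_real r))
      = (\<Prod>b\<in>Basis. \<bar>if b = axis k 1 \<or> b = axis k \<i> then r else 1\<bar>)"
  proof (rule vol_factor_diagonal)
    fix x b :: "complex^'n" assume "b \<in> Basis"
    then show "scale_coord k (of_real r) x \<bullet> b = (if b = axis k 1 \<or> b = axis k \<i> then r else 1) * (x \<bullet> b)"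
      by (auto simp: Basis_complex_vec scale_coord_def inner_axis axis_eq_axis inner_complex_def)
  qed
  also have "\<dots> = (\<Prod>b\<in>{axis k 1, axis k \<i> :: complex^'n}. \<bar>r\<bar>)"
    by (rule prod.mono_neutral_cong_right) (auto simp: Basis_complex_vec)
  also have "\<dots> = r\<^sup>2"
    by (simp add: axis_eq_axis complex_eq_iff power2_eq_square)
  finally show ?thesis .
qed

text \<open>Polar decomposition of \<open>c\<close>: the unimodular factor acts isometrically, the
  modulus scales two real directions.\<close>

lemma vol_factor_scale_coord: "vol_factor (scale_coord (k :: 'n::finite) c) = (cmod c)\<^sup>2"
proof (cases "c = 0")
  case False
  have "norm (scale_coord k (sgn c) x) = norm x" for x :: "complex^'n"
    unfolding norm_vec_def
    by (intro L2_set_cong) (use False in \<open>auto simp: scale_coord_def norm_mult norm_sgn\<close>)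
  then have "vol_factor (scale_coord k (sgn c)) = 1"
    by (intro vol_factor_isometry linear_scale_coord)
  moreover have "scale_coord k c = scale_coord k (of_real (cmod c)) \<circ> scale_coord k (sgn c)"
    by (auto simp: fun_eq_iff scale_coord_def vec_eq_iff sgn_eq)
  ultimately show ?thesis
    by (simp add: vol_factor_compose linear_scale_coord vol_factor_scale_coord_of_real)
qed (use vol_factor_scale_coord_of_real[of k 0] in simp)

lemma vol_factor_cmult: "vol_factor (\<lambda>x. c *s x :: complex^'n) = cmod c ^ (2 * CARD('n))"
proof (cases "c = 0")
  case False
  have lin: "linear (\<lambda>x. a *s x :: complex^'n)" for a
    by (rule linearI) (simp_all add: vec_eq_iff algebra_simps)
  have "vol_factor (\<lambda>x. sgn c *s x :: complex^'n) = 1"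
    using False by (intro vol_factor_isometry lin) (simp add: norm_vec_cmult norm_sgn)
  moreover have "vol_factor (\<lambda>x. of_real (cmod c) *s x :: complex^'n) = (\<Prod>b\<in>(Basis :: (complex^'n) set). \<bar>cmod c\<bar>)"
    by (rule vol_factor_diagonal) (auto simp: Basis_complex_vec inner_axis inner_complex_def)
  moreover have "(\<lambda>x. c *s x :: complex^'n) = (\<lambda>x. of_real (cmod c) *s x) \<circ> (\<lambda>x. sgn c *s x)"
    by (auto simp: fun_eq_iff vec_eq_iff sgn_eq)
  ultimately have "vol_factor (\<lambda>x. c *s x :: complex^'n) = (\<Prod>b\<in>(Basis :: (complex^'n) set). \<bar>cmod c\<bar>) * 1"
    using vol_factor_compose[OF lin lin] by metis
  then show ?thesis
    by (simp add: mult.commute)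
next
  case True
  have "vol_factor (\<lambda>x. c *s x :: complex^'n) = (\<Prod>b\<in>(Basis :: (complex^'n) set). \<bar>0\<bar>)"
    by (rule vol_factor_diagonal) (simp add: True)
  then show ?thesis
    by (simp add: True power_0_left)
qed

text \<open>The inverse shear, by \<open>- w\<close>, is conjugate to the shear by \<open>w\<close>
  through the sign change of the \<open>k\<close>-th coordinate. Both have the same factor, and the
  two factors multiply to 1.\<close>

lemma vol_factor_shear:
  fixes w :: "complex^'n"
  assumes "w $ k = 0"
  shows "vol_factor (\<lambda>x. x + x $ k *s w) = 1"
proof -
  define E where "E w = (\<lambda>x. x + x $ k *s w)" for w :: "complex^'n"
  have lin: "linear (E w)" for w
    by (rule linearI) (simp_all add: E_def vec_eq_iff algebra_simps)
  have "vol_factor (E (- w)) * vol_factor (E w) = 1"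
    by (rule vol_factor_inverse[OF lin lin]) (use assms in \<open>auto simp: E_def vec_eq_iff algebra_simps\<close>)
  moreover have "vol_factor (E (- w)) = vol_factor (E w)"
  proof (rule vol_factor_intertwine[where M="scale_coord k (- 1)"])
    show "inj (scale_coord k (- 1))"
      by (rule injI) (auto simp: scale_coord_def vec_eq_iff split: if_splits)
    show "scale_coord k (- 1) (E (- w) x) = E w (scale_coord k (- 1) x)" for x
      using assms by (auto simp: E_def scale_coord_def vec_eq_iff)
  qed (rule lin linear_scale_coord)+
  ultimately have "(vol_factor (E w))\<^sup>2 = 1"
    by (simp add: power2_eq_square)
  then show ?thesis
    using vol_factor_nonneg[of "E w"] by (auto simp: power2_eq_1_iff E_def)
qed

lemma hinner_add_left: "hinner (x + y) z = hinner x z + hinner y z"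
  by (simp add: hinner_def algebra_simps sum.distrib)

lemma hinner_cmult_left: "hinner (c *s x) z = c * hinner x z"
  by (simp add: hinner_def sum_distrib_left algebra_simps)

text \<open>The matrix determinant lemma over the complex numbers, squared because the determinant
  is the real one. In coordinates that contain \<open>hinner x z\<close>, the map multiplies this
  coordinate by \<open>1 + hinner v z\<close> and then adds multiples of it to the others.\<close>

lemma vol_factor_rank_one:
  fixes v z :: "complex^'n"
  assumes nz: "1 + hinner v z \<noteq> 0"
  shows "vol_factor (\<lambda>x. x + hinner x z *s v) = (cmod (1 + hinner v z))\<^sup>2"
proof (cases "z = 0")
  case True
  then show ?thesis
    by (simp add: hinner_def vol_factor_id)
next
  case False
  then obtain k where k: "z $ k \<noteq> 0"
    by (auto simp: vec_eq_iff)
  \<comment> \<open>\<open>M\<close> turns the functional \<open>hinner _ z\<close> into the \<open>k\<close>-th coordinate.\<close>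
  define M where "M x = (\<chi> i. if i = k then hinner x z else x $ i)" for x :: "complex^'n"
  define c where "c = 1 + hinner v z"
  \<comment> \<open>The quotient by \<open>c\<close> compensates that the \<open>k\<close>-th
    coordinate has already been multiplied by \<open>c\<close> when the shear acts.\<close>
  define w where "w = (\<chi> i. if i = k then 0 else v $ i / c)"
  have c0: "c \<noteq> 0" and hv: "hinner v z = c - 1"
    using nz by (simp_all add: c_def)
  have linM: "linear M"
    by (rule linearI) (auto simp: M_def vec_eq_iff hinner_def algebra_simps sum.distrib scaleR_sum_right)
  have injM: "inj M"
    unfolding linear_injective_0[OF linM]
  proof (intro allI impI)
    fix x assume "M x = 0"
    then have eq: "(if i = k then hinner x z else x $ i) = 0" for i
      by (simp add: M_def vec_eq_iff)
    have h: "hinner x z = 0"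
      using eq[of k] by simp
    have x: "x $ i = 0" if "i \<noteq> k" for i
      using eq[of i] that by simp
    have "hinner x z = (\<Sum>i\<in>{k}. x $ i * cnj (z $ i))"
      unfolding hinner_def by (rule sum.mono_neutral_right) (auto simp: x)
    with h k have "x $ k = 0"
      by simp
    with x show "x = 0"
      by (metis vec_eq_iff zero_index)
  qed
  have "vol_factor (\<lambda>x. x + hinner x z *s v) = vol_factor ((\<lambda>x. x + x $ k *s w) \<circ> scale_coord k c)"
  proof (rule vol_factor_intertwine[OF _ _ linM injM])
    show "M (x + hinner x z *s v) = ((\<lambda>x. x + x $ k *s w) \<circ> scale_coord k c) (M x)" for x
      using c0 unfolding M_def w_def scale_coord_def
      by (auto simp: vec_eq_iff hinner_add_left hinner_cmult_left hv algebra_simps)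
  qed (auto intro!: linearI linear_compose linear_scale_coord
      simp: hinner_add_left vec_eq_iff algebra_simps hinner_def scaleR_sum_right sum_distrib_left sum.distrib)
  also have "\<dots> = vol_factor (\<lambda>x. x + x $ k *s w) * vol_factor (scale_coord k c)"
    by (intro vol_factor_compose linear_scale_coord linearI) (auto simp: vec_eq_iff algebra_simps)
  also have "\<dots> = (cmod c)\<^sup>2"
    by (subst vol_factor_shear) (simp_all add: w_def vol_factor_scale_coord)
  finally show ?thesis
    by (simp add: c_def)
qed

section \<open>The automorphisms of the ball\<close>

lemma hinner_diff_left: "hinner (x - y) z = hinner x z - hinner y z"
  by (simp add: hinner_def algebra_simps sum_subtractf)

lemma scaleR_conv_cmult: "r *\<^sub>R x = of_real r *s (x :: complex^'n)"
  by (simp add: vec_eq_iff scaleR_conv_of_real[where 'a=complex])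

lemma hinner_scaleR_left: "hinner (r *\<^sub>R x) z = of_real r * hinner x z"
  by (simp add: scaleR_conv_cmult hinner_cmult_left)

lemma cnj_hinner: "cnj (hinner x y) = hinner y x"
  by (simp add: hinner_def mult.commute)

lemma hinner_add_right: "hinner z (x + y) = hinner z x + hinner z y"
  and hinner_diff_right: "hinner z (x - y) = hinner z x - hinner z y"
  and hinner_cmult_right: "hinner z (c *s x) = cnj c * hinner z x"
  and hinner_scaleR_right: "hinner z (r *\<^sub>R x) = of_real r * hinner z x"
  by (simp_all add: cnj_hinner[symmetric, of z] hinner_add_left hinner_diff_left hinner_cmult_left
      hinner_scaleR_left)

lemma hinner_zero [simp]: "hinner 0 z = 0" "hinner z 0 = 0"
  by (simp_all add: hinner_def)

lemma hinner_self: "hinner x x = of_real ((norm x)\<^sup>2)"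
proof -
  have "(norm x)\<^sup>2 = (\<Sum>i\<in>UNIV. (cmod (x $ i))\<^sup>2)"
    by (simp add: norm_vec_def L2_set_def sum_nonneg)
  then show ?thesis
    by (simp add: hinner_def complex_mult_cnj cmod_power2)
qed

lemma norm_hinner_le: "cmod (hinner x y) \<le> norm x * norm y"
proof -
  have "cmod (hinner x y) \<le> (\<Sum>i\<in>UNIV. \<bar>cmod (x $ i)\<bar> * \<bar>cmod (y $ i)\<bar>)"
    unfolding hinner_def by (rule order_trans[OF norm_sum]) (simp add: norm_mult)
  also have "\<dots> \<le> norm x * norm y"
    unfolding norm_vec_def by (rule L2_set_mult_ineq)
  finally show ?thesis .
qed

lemma linear_hinner_left: "linear (\<lambda>x. hinner x z)"
  by (rule linearI) (simp_all add: hinner_add_left hinner_scaleR_left scaleR_conv_of_real[where 'a=complex])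

lemma bounded_linear_hinner_left: "bounded_linear (\<lambda>x. hinner x z)"
  by (simp add: linear_conv_bounded_linear[symmetric] linear_hinner_left)

lemma norm_hinner_less:
  assumes "norm z < 1" "norm w < 1"
  shows "cmod (hinner z w) < 1"
proof -
  have "norm z * norm w < 1"
    using assms by (metis mult_less_cancel_right1 mult_strict_mono norm_ge_zero mult_1_right less_le_not_le zero_less_one)
  then show ?thesis
    using norm_hinner_le[of z w] by linarith
qed

lemma Re_one_minus_hinner_pos:
  assumes "norm z < 1" "norm w < 1"
  shows "Re (1 - hinner z w) > 0"
  using norm_hinner_less[OF assms] complex_Re_le_cmod[of "hinner z w"] by simp

lemma one_minus_hinner_nz:
  assumes "norm z < 1" "norm w < 1"
  shows "1 - hinner z w \<noteq> 0"
  using Re_one_minus_hinner_pos[OF assms] by force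

lemma one_minus_norm2_pos: "norm z < 1 \<Longrightarrow> 1 - (norm z)\<^sup>2 > 0"
  by (simp add: abs_square_less_1)

text \<open>With \<open>P = proj z\<close>, \<open>Q\<close> the complementary projection and
  \<open>s = sqrt (1 - (norm z)\<^sup>2)\<close> this is \<open>s\<^sup>2 P + s Q\<close>, the
  negative of the derivative of \<open>phi z\<close> at 0. Written as a multiple of a rank one
  perturbation of the identity it is correct at \<open>z = 0\<close> as well, where it is the
  identity, and its determinant is immediate.\<close>

definition phi_lin :: "complex^'n \<Rightarrow> complex^'n \<Rightarrow> complex^'n" where
  "phi_lin z h = of_real (sqrt (1 - (norm z)\<^sup>2)) *s
     (h + hinner h z *s (of_real ((sqrt (1 - (norm z)\<^sup>2) - 1) / (norm z)\<^sup>2) *s z))"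

lemma linear_phi_lin: "linear (phi_lin z)"
proof -
  have "linear (\<lambda>h. a *s (h + hinner h z *s v))" for a and v :: "complex^'a"
    by (rule linearI) (simp_all add: vec_eq_iff hinner_add_left hinner_scaleR_left algebra_simps
        scaleR_conv_of_real[where 'a=complex])
  from this[of "of_real (sqrt (1 - (norm z)\<^sup>2))"] show ?thesis
    unfolding phi_lin_def[abs_def] .
qed

lemma phi_lin_cmult: "phi_lin z (c *s h) = c *s phi_lin z h"
  by (simp add: phi_lin_def vec_eq_iff hinner_cmult_left algebra_simps)

text \<open>The square root and the quotient by \<open>(norm z)\<^sup>2\<close> enter the identities
  below only through polynomial relations between three complex numbers. The relation
  \<open>K * (1 + S) = - 1\<close> arises by cancelling \<open>M\<close>, whence the condition
  \<open>z \<noteq> 0\<close>.\<close>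

lemma phi_lin_coeffs:
  fixes z :: "complex^'n"
  assumes "norm z < 1"
  obtains S K M :: complex where "M = of_real ((norm z)\<^sup>2)" "S * S = 1 - M" "K * M = S - 1"
    "z \<noteq> 0 \<Longrightarrow> K * (1 + S) = - 1" "\<And>h. phi_lin z h = S *s (h + hinner h z *s (K *s z))"
proof -
  define S K M where "S = complex_of_real (sqrt (1 - (norm z)\<^sup>2))"
    and "K = complex_of_real ((sqrt (1 - (norm z)\<^sup>2) - 1) / (norm z)\<^sup>2)"
    and "M = complex_of_real ((norm z)\<^sup>2)"
  have S: "S * S = 1 - M"
    using one_minus_norm2_pos[OF assms] unfolding S_def M_def of_real_mult[symmetric] by simp
  have KM: "K * M = S - 1"
    by (cases "z = 0") (simp_all add: K_def M_def S_def)
  have "K * (1 + S) = - 1" if "z \<noteq> 0"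
  proof -
    have "M \<noteq> 0"
      using that by (simp add: M_def)
    moreover have "M * (K * (1 + S)) = M * (- 1)"
      using S KM by algebra
    ultimately show ?thesis
      by (metis mult_left_cancel)
  qed
  then show ?thesis
    by (rule that[OF M_def S KM]) (simp_all add: phi_lin_def S_def K_def)
qed

lemma hinner_phi_lin:
  assumes "norm z < 1"
  shows "hinner (phi_lin z h) z = of_real (1 - (norm z)\<^sup>2) * hinner h z"
proof -
  obtain S K M where M: "M = of_real ((norm z)\<^sup>2)" and S: "S * S = 1 - M" and K: "K * M = S - 1"
    and p: "\<And>h. phi_lin z h = S *s (h + hinner h z *s (K *s z))"
    using phi_lin_coeffs[OF assms] by metis
  have "hinner (phi_lin z h) z = S * (hinner h z + hinner h z * (K * M))"
    by (simp add: p hinner_add_left hinner_cmult_left hinner_self M algebra_simps)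
  also have "\<dots> = (1 - M) * hinner h z"
    using S K by algebra
  finally show ?thesis
    by (simp add: M)
qed

text \<open>The eigenvalues \<open>s\<^sup>2\<close> on the line of \<open>z\<close> and
  \<open>s\<close> on its complement are squared, which gives
  \<open>s\<^sup>2 (I - (norm z)\<^sup>2 P)\<close>.\<close>

lemma phi_lin_phi_lin:
  assumes "norm z < 1"
  shows "phi_lin z (phi_lin z h) = of_real (1 - (norm z)\<^sup>2) *s (h - hinner h z *s z)"
proof (cases "z = 0")
  case False
  obtain S K M where M: "M = of_real ((norm z)\<^sup>2)" and S: "S * S = 1 - M"
    and K: "z \<noteq> 0 \<Longrightarrow> K * (1 + S) = - 1"
    and p: "\<And>h. phi_lin z h = S *s (h + hinner h z *s (K *s z))"
    using phi_lin_coeffs[OF assms] by metis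
  have "phi_lin z (phi_lin z h) $ i = (of_real (1 - (norm z)\<^sup>2) *s (h - hinner h z *s z)) $ i" for i
  proof -
    have "phi_lin z (phi_lin z h) $ i = S * (phi_lin z h $ i + (1 - M) * hinner h z * (K * z $ i))"
      by (subst p) (simp add: hinner_phi_lin[OF assms] M algebra_simps)
    also have "\<dots> = S * (S * (h $ i + hinner h z * (K * z $ i)) + (1 - M) * hinner h z * (K * z $ i))"
      by (simp add: p algebra_simps)
    also have "\<dots> = (1 - M) * (h $ i - hinner h z * z $ i)"
      using S K[OF False] by algebra
    finally show ?thesis
      by (simp add: M algebra_simps)
  qed
  then show ?thesis
    by (simp add: vec_eq_iff)
qed (simp add: phi_lin_def)

lemma phi_lin_self:
  assumes "norm z < 1"
  shows "phi_lin z z = of_real (1 - (norm z)\<^sup>2) *s z"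
proof -
  obtain S K M where M: "M = of_real ((norm z)\<^sup>2)" and S: "S * S = 1 - M" and K: "K * M = S - 1"
    and p: "\<And>h. phi_lin z h = S *s (h + hinner h z *s (K *s z))"
    using phi_lin_coeffs[OF assms] by metis
  have "S * (z $ i + M * (K * z $ i)) = (1 - M) * z $ i" for i
    using S K by algebra
  then show ?thesis
    by (simp add: vec_eq_iff p hinner_self M algebra_simps)
qed

lemma hinner_phi_lin_adjoint: "hinner (phi_lin z x) y = hinner x (phi_lin z y)"
proof -
  define S K where "S = sqrt (1 - (norm z)\<^sup>2)" and "K = (sqrt (1 - (norm z)\<^sup>2) - 1) / (norm z)\<^sup>2"
  have p: "phi_lin z h = of_real S *s (h + hinner h z *s (of_real K *s z))" for h
    by (simp add: phi_lin_def S_def K_def)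
  have "hinner (phi_lin z x) y = of_real S * (hinner x y + hinner x z * of_real K * hinner z y)"
    by (simp add: p hinner_add_left hinner_cmult_left algebra_simps)
  also have "\<dots> = hinner x (phi_lin z y)"
    by (simp add: p hinner_add_right hinner_cmult_right cnj_hinner algebra_simps)
  finally show ?thesis .
qed

text \<open>\<open>phi_lin z\<close> is self-adjoint, so the norm is read off from its
  square.\<close>

lemma norm_phi_lin:
  assumes "norm z < 1"
  shows "(norm (phi_lin z y))\<^sup>2 = (1 - (norm z)\<^sup>2) * ((norm y)\<^sup>2 - (cmod (hinner y z))\<^sup>2)"
proof -
  have "complex_of_real ((norm (phi_lin z y))\<^sup>2) = hinner (phi_lin z (phi_lin z y)) y"
    by (simp only: hinner_self[symmetric] hinner_phi_lin_adjoint)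
  also have "\<dots> = of_real (1 - (norm z)\<^sup>2) * (of_real ((norm y)\<^sup>2) - hinner y z * hinner z y)"
    by (simp only: phi_lin_phi_lin[OF assms] hinner_cmult_left hinner_diff_left hinner_self)
  also have "hinner y z * hinner z y = of_real ((cmod (hinner y z))\<^sup>2)"
    by (simp only: cnj_hinner[of y z, symmetric] complex_norm_square)
  finally show ?thesis
    by (simp only: of_real_diff[symmetric] of_real_mult[symmetric] of_real_eq_iff)
qed

text \<open>Pulling the value \<open>z\<close> at the origin out of the fraction leaves a fixed
  linear map applied to \<open>u / (1 - hinner u z)\<close>. In this form the case
  \<open>a = 0\<close> of \<open>phi\<close> is no longer special, and the derivative, the Jacobian
  and the involution property follow from \<open>phi_lin\<close>.\<close>

lemma phi_eq:
  assumes "norm z < 1" "norm u < 1"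
  shows "phi z u = z - phi_lin z (inverse (1 - hinner u z) *s u)"
proof (cases "z = 0")
  case False
  define S M where "S = complex_of_real (sqrt (1 - (norm z)\<^sup>2))" and "M = complex_of_real ((norm z)\<^sup>2)"
  define H t where "H = hinner u z" and "t = inverse (1 - H)"
  have t: "t * (1 - H) = 1"
    using one_minus_hinner_nz[OF assms(2,1)] by (simp add: t_def H_def)
  have M: "M \<noteq> 0"
    using False by (simp add: M_def)
  have S: "S * S = 1 - M"
    using one_minus_norm2_pos[OF assms(1)] unfolding S_def M_def of_real_mult[symmetric] by simp
  have "phi z u $ i = (z - phi_lin z (t *s u)) $ i" for i
  proof -
    define q where "q = H / M"
    have q: "q * M = H"
      using M by (simp add: q_def)
    have "phi z u $ i = t * (z $ i - q * z $ i - S * (u $ i - q * z $ i))"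
      using False by (simp add: phi_def proj_def t_def H_def S_def M_def q_def
          scaleR_conv_of_real[where 'a=complex] algebra_simps)
    also have "\<dots> = z $ i - S * (t * u $ i + t * (q * ((S - 1) * z $ i)))"
      using t S q by algebra
    also have "\<dots> = (z - phi_lin z (t *s u)) $ i"
      by (simp add: phi_lin_def hinner_cmult_left S_def M_def H_def q_def algebra_simps diff_divide_distrib add_divide_distrib)
    finally show ?thesis .
  qed
  then show ?thesis
    by (simp add: vec_eq_iff t_def H_def)
qed (simp add: phi_def phi_lin_def)

lemma phi_0 [simp]: "phi z 0 = z"
  by (simp add: phi_def proj_def)

lemma one_minus_hinner_phi:
  assumes "norm z < 1" "norm u < 1"
  shows "1 - hinner (phi z u) z = of_real (1 - (norm z)\<^sup>2) / (1 - hinner u z)"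
proof -
  define t where "t = 1 - hinner u z"
  have t: "t \<noteq> 0"
    using one_minus_hinner_nz[OF assms(2,1)] by (simp add: t_def)
  have h: "hinner u z = 1 - t"
    by (simp add: t_def)
  show ?thesis
    using t by (simp add: phi_eq[OF assms] hinner_diff_left hinner_self hinner_phi_lin[OF assms(1)]
        hinner_cmult_left h field_simps)
qed

text \<open>Write \<open>phi z u = z - phi_lin z y\<close> with \<open>y = u / t\<close>. Expanding
  the norm gives \<open>1 - (norm z)\<^sup>2\<close> times
  \<open>(cmod (1 + q))\<^sup>2 - (norm y)\<^sup>2\<close> for \<open>q = hinner y z\<close>, and
  \<open>1 + q = 1 / t\<close>.\<close>

lemma one_minus_norm_phi:
  assumes "norm z < 1" "norm u < 1"
  shows "1 - (norm (phi z u))\<^sup>2 = (1 - (norm z)\<^sup>2) * (1 - (norm u)\<^sup>2) / (cmod (1 - hinner u z))\<^sup>2"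
proof -
  define t where "t = 1 - hinner u z"
  define y where "y = inverse t *s u"
  have t: "t \<noteq> 0"
    using one_minus_hinner_nz[OF assms(2,1)] by (simp add: t_def)
  have h: "hinner u z = 1 - t"
    by (simp add: t_def)
  have hy: "hinner y z = (1 - t) / t"
    by (simp add: y_def hinner_cmult_left h field_simps)
  have n2: "(norm (x - w))\<^sup>2 = (norm x)\<^sup>2 - 2 * Re (hinner w x) + (norm w)\<^sup>2" for x w :: "complex^'a"
  proof -
    have "complex_of_real ((norm (x - w))\<^sup>2) = hinner x x - (hinner w x + cnj (hinner w x)) + hinner w w"
      unfolding hinner_self[symmetric]
      by (simp add: hinner_diff_left hinner_diff_right cnj_hinner)
    then have "complex_of_real ((norm (x - w))\<^sup>2) = of_real ((norm x)\<^sup>2 - 2 * Re (hinner w x) + (norm w)\<^sup>2)"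
      by (simp add: hinner_self complex_add_cnj)
    then show ?thesis
      by (simp only: of_real_eq_iff)
  qed
  have re: "Re ((1 - t) / t) * (cmod t)\<^sup>2 = Re t - (cmod t)\<^sup>2"
  proof -
    have "(1 - t) / t * of_real ((cmod t)\<^sup>2) = (1 - t) * cnj t"
      using t by (simp only: complex_norm_square) simp
    then have "Re ((1 - t) / t * of_real ((cmod t)\<^sup>2)) = Re ((1 - t) * cnj t)"
      by (rule arg_cong)
    moreover have "Re (x * of_real r) = Re x * r" for x r
      by simp
    ultimately have "Re ((1 - t) / t) * (cmod t)\<^sup>2 = Re ((1 - t) * cnj t)"
      by metis
    also have "\<dots> = Re t - (cmod t)\<^sup>2"
      unfolding cmod_power2 by (simp add: algebra_simps power2_eq_square)
    finally show ?thesis .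
  qed
  have c1: "(cmod ((1 - t) / t))\<^sup>2 * (cmod t)\<^sup>2 = 1 - 2 * Re t + (cmod t)\<^sup>2"
    using t by (simp add: norm_divide power_divide) (simp add: cmod_power2, simp add: power2_eq_square algebra_simps)
  have ny: "(norm y)\<^sup>2 * (cmod t)\<^sup>2 = (norm u)\<^sup>2"
    using t by (simp add: y_def norm_vec_cmult norm_inverse power_mult_distrib power_inverse)
  have "1 - (norm (phi z u))\<^sup>2 = (1 - (norm z)\<^sup>2) * (1 + 2 * Re ((1 - t) / t) - (norm y)\<^sup>2 + (cmod ((1 - t) / t))\<^sup>2)"
  proof -
    define q where "q = (1 - t) / t"
    have re_mult: "Re (of_real r * x) = r * Re x" for r x
      by simp
    have "1 - (norm (phi z u))\<^sup>2 = 1 - ((norm z)\<^sup>2 - 2 * Re (of_real (1 - (norm z)\<^sup>2) * q)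
        + (1 - (norm z)\<^sup>2) * ((norm y)\<^sup>2 - (cmod q)\<^sup>2))"
      by (simp only: phi_eq[OF assms] t_def[symmetric] y_def[symmetric] n2 hinner_phi_lin[OF assms(1)]
          norm_phi_lin[OF assms(1)] hy q_def)
    then show ?thesis
      by (simp only: re_mult q_def[symmetric]) (simp add: algebra_simps)
  qed
  then have "(1 - (norm (phi z u))\<^sup>2) * (cmod t)\<^sup>2 = (1 - (norm z)\<^sup>2) *
      (1 + 2 * Re ((1 - t) / t) - (norm y)\<^sup>2 + (cmod ((1 - t) / t))\<^sup>2) * (cmod t)\<^sup>2"
    by (simp only:)
  also have "\<dots> = (1 - (norm z)\<^sup>2) *
      ((cmod t)\<^sup>2 + 2 * (Re ((1 - t) / t) * (cmod t)\<^sup>2) - (norm y)\<^sup>2 * (cmod t)\<^sup>2 + (cmod ((1 - t) / t))\<^sup>2 * (cmod t)\<^sup>2)"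
    by (simp only: ring_distribs mult_ac mult_1_left mult_1_right)
  also have "\<dots> = (1 - (norm z)\<^sup>2) * (1 - (norm u)\<^sup>2)"
    unfolding re c1 ny by simp
  finally show ?thesis
    using t by (simp add: t_def[symmetric] field_simps)
qed

lemma norm_phi_less:
  assumes "norm z < 1" "norm u < 1"
  shows "norm (phi z u) < 1"
proof -
  have "1 - (norm (phi z u))\<^sup>2 > 0"
    unfolding one_minus_norm_phi[OF assms]
    using one_minus_norm2_pos[OF assms(1)] one_minus_norm2_pos[OF assms(2)] one_minus_hinner_nz[OF assms(2,1)]
    by (intro divide_pos_pos mult_pos_pos zero_less_power) simp_all
  then show ?thesis
    by (simp add: abs_square_less_1)
qed

text \<open>Since \<open>1 - hinner (phi z u) z\<close> is \<open>c / t\<close>, the second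
  application multiplies by \<open>t / c\<close>. As \<open>phi_lin z\<close> multiplies
  \<open>z\<close> by \<open>c\<close> and its square is known, all square roots disappear.\<close>

lemma phi_phi:
  assumes "norm z < 1" "norm u < 1"
  shows "phi z (phi z u) = u"
proof -
  define t where "t = 1 - hinner u z"
  define c where "c = complex_of_real (1 - (norm z)\<^sup>2)"
  have t: "t \<noteq> 0"
    using one_minus_hinner_nz[OF assms(2,1)] by (simp add: t_def)
  have c: "c \<noteq> 0"
    using one_minus_norm2_pos[OF assms(1)] unfolding c_def of_real_eq_0_iff by simp
  have h: "hinner u z = 1 - t"
    by (simp add: t_def)
  have "phi z (phi z u) = z - phi_lin z ((t / c) *s phi z u)"
    by (subst phi_eq[OF assms(1) norm_phi_less[OF assms]])
      (simp add: one_minus_hinner_phi[OF assms] t_def c_def)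
  also have "\<dots> = z - (t / c) *s (phi_lin z z - inverse t *s phi_lin z (phi_lin z u))"
    by (simp add: phi_lin_cmult phi_eq[OF assms] t_def[symmetric] linear_diff[OF linear_phi_lin])
  also have "\<dots> = z - (t / c) *s (c *s z - inverse t *s (c *s (u - (1 - t) *s z)))"
    by (simp only: phi_lin_self[OF assms(1)] phi_lin_phi_lin[OF assms(1)] c_def[symmetric] h)
  also have "\<dots> = u"
    using t c by (simp add: vec_eq_iff field_simps)
  finally show ?thesis .
qed

text \<open>The quotient rule applied to \<open>phi_eq\<close>, factored into
  \<open>phi_lin\<close>, a scalar and a rank one perturbation of the identity so that the
  determinant can be taken factor by factor.\<close>

definition phi_deriv :: "complex^'n \<Rightarrow> complex^'n \<Rightarrow> complex^'n \<Rightarrow> complex^'n" where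
  "phi_deriv z u h = - phi_lin z (inverse (1 - hinner u z) *s
      (h + hinner h z *s (inverse (1 - hinner u z) *s u)))"

lemma phi_deriv_cmult: "phi_deriv z u (c *s h) = c *s phi_deriv z u h"
proof -
  have "inverse (1 - hinner u z) *s (c *s h + hinner (c *s h) z *s (inverse (1 - hinner u z) *s u))
    = c *s (inverse (1 - hinner u z) *s (h + hinner h z *s (inverse (1 - hinner u z) *s u)))"
    by (simp add: vec_eq_iff hinner_cmult_left algebra_simps)
  then show ?thesis
    by (simp only: phi_deriv_def phi_lin_cmult) (simp only: vector_smult_rneg)
qed

lemma has_derivative_phi:
  assumes "norm z < 1" "norm u < 1"
  shows "(phi z has_derivative phi_deriv z u) (at u)"
proof -
  define t where "t = 1 - hinner u z"
  have t: "t \<noteq> 0"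
    using one_minus_hinner_nz[OF assms(2,1)] by (simp add: t_def)
  have hd: "((\<lambda>u. hinner u z) has_derivative (\<lambda>h. hinner h z)) (at u)"
    by (rule bounded_linear_imp_has_derivative[OF bounded_linear_hinner_left])
  have cm: "bounded_bilinear (\<lambda>(c::complex) (x::complex^'a). c *s x)"
    by (intro bilinear_conv_bounded_bilinear[THEN iffD1])
      (auto simp: bilinear_def vec_eq_iff algebra_simps intro!: linearI)
  have 1: "((\<lambda>u. inverse (1 - hinner u z)) has_derivative (\<lambda>h. inverse t * hinner h z * inverse t)) (at u)"
    using Deriv.has_derivative_inverse[OF _ has_derivative_diff[OF has_derivative_const hd], of 1] t
    by (simp add: t_def)
  have 2: "((\<lambda>u. inverse (1 - hinner u z) *s u) has_derivative
      (\<lambda>h. inverse t *s h + (inverse t * hinner h z * inverse t) *s u)) (at u)"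
    using bounded_bilinear.FDERIV[OF cm 1 has_derivative_ident] by (simp add: t_def)
  have "((\<lambda>u. z - phi_lin z (inverse (1 - hinner u z) *s u)) has_derivative
      (\<lambda>h. - phi_lin z (inverse t *s h + (inverse t * hinner h z * inverse t) *s u))) (at u)"
    by (rule derivative_eq_intros refl
        bounded_linear.has_derivative[OF linear_conv_bounded_linear[THEN iffD1, OF linear_phi_lin] 2])+ simp
  also have "(\<lambda>h. - phi_lin z (inverse t *s h + (inverse t * hinner h z * inverse t) *s u)) = phi_deriv z u"
    unfolding phi_deriv_def t_def[symmetric]
    by (intro ext arg_cong[where f="\<lambda>x. - phi_lin z x"]) (simp add: vec_eq_iff algebra_simps)
  finally show ?thesis
    by (rule has_derivative_transform_within_open[OF _ open_ball[of 0 1]]) (use assms in \<open>auto simp: phi_eq\<close>)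
qed

lemma vol_factor_phi_lin:
  fixes z :: "complex^'n"
  assumes "norm z < 1"
  shows "vol_factor (phi_lin z) = (1 - (norm z)\<^sup>2) ^ (CARD('n) + 1)"
proof -
  define s where "s = sqrt (1 - (norm z)\<^sup>2)"
  define v where "v = of_real ((s - 1) / (norm z)\<^sup>2) *s z"
  have s: "s > 0" "s * s = 1 - (norm z)\<^sup>2"
    using one_minus_norm2_pos[OF assms] by (simp_all add: s_def)
  have v: "1 + hinner v z = of_real s"
  proof (cases "z = 0")
    case False
    then show ?thesis
      by (simp add: v_def hinner_cmult_left hinner_self field_simps)
  qed (use s in \<open>auto simp: s_def\<close>)
  have lin: "linear (\<lambda>x. x + hinner x z *s v)"
    by (rule linearI) (simp_all add: hinner_add_left hinner_scaleR_left vec_eq_iff algebra_simps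
        scaleR_conv_of_real[where 'a=complex])
  have lin': "linear (\<lambda>x. of_real s *s x :: complex^'n)"
    by (rule linearI) (simp_all add: vec_eq_iff algebra_simps)
  have "phi_lin z = (\<lambda>x. of_real s *s x) \<circ> (\<lambda>x. x + hinner x z *s v)"
    by (simp add: fun_eq_iff phi_lin_def s_def v_def)
  then have "vol_factor (phi_lin z) = s ^ (2 * CARD('n)) * s\<^sup>2"
    using s by (simp add: vol_factor_compose[OF lin' lin] vol_factor_cmult vol_factor_rank_one v)
  also have "\<dots> = (s * s) ^ (CARD('n) + 1)"
    by (simp add: power_mult power2_eq_square)
  finally show ?thesis
    by (simp only: s)
qed

text \<open>\<open>phi_lin z\<close> gives the power of \<open>1 - (norm z)\<^sup>2\<close>, the
  scalar \<open>1 / t\<close> contributes \<open>2 * CARD('n)\<close> powers of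
  \<open>cmod (1 / t)\<close>, and the rank one perturbation two more.\<close>

lemma vol_factor_phi_deriv:
  fixes z :: "complex^'n"
  assumes "norm z < 1" "norm u < 1"
  shows "vol_factor (phi_deriv z u) = ((1 - (norm z)\<^sup>2) / (cmod (1 - hinner u z))\<^sup>2) ^ (CARD('n) + 1)"
proof -
  define t where "t = 1 - hinner u z"
  have t: "t \<noteq> 0"
    using one_minus_hinner_nz[OF assms(2,1)] by (simp add: t_def)
  define v where "v = inverse t *s u"
  have v: "1 + hinner v z = inverse t"
    using t by (simp add: v_def hinner_cmult_left t_def field_simps)
  have lin: "linear (\<lambda>x. x + hinner x z *s v)"
    by (rule linearI) (simp_all add: hinner_add_left hinner_scaleR_left vec_eq_iff algebra_simps
        scaleR_conv_of_real[where 'a=complex])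
  have lin': "linear (\<lambda>x. c *s x :: complex^'n)" for c
    by (rule linearI) (simp_all add: vec_eq_iff algebra_simps)
  have eq: "phi_deriv z u = (\<lambda>x. (- 1) *s x) \<circ> (phi_lin z \<circ> ((\<lambda>x. inverse t *s x) \<circ> (\<lambda>x. x + hinner x z *s v)))"
    by (auto simp: fun_eq_iff phi_deriv_def t_def v_def vec_eq_iff)
  have "vol_factor (phi_deriv z u) = 1 * ((1 - (norm z)\<^sup>2) ^ (CARD('n) + 1) *
      (cmod (inverse t) ^ (2 * CARD('n)) * (cmod (inverse t))\<^sup>2))"
    unfolding eq
    by (subst vol_factor_compose vol_factor_cmult vol_factor_phi_lin[OF assms(1)] vol_factor_rank_one
        | intro linear_compose lin lin' linear_phi_lin | simp add: v t)+
  also have "\<dots> = (1 - (norm z)\<^sup>2) ^ (CARD('n) + 1) * (cmod (inverse t) ^ 2) ^ (CARD('n) + 1)"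
    by (simp add: power_mult)
  also have "\<dots> = ((1 - (norm z)\<^sup>2) * cmod (inverse t) ^ 2) ^ (CARD('n) + 1)"
    by (simp only: power_mult_distrib)
  also have "\<dots> = ((1 - (norm z)\<^sup>2) / (cmod t)\<^sup>2) ^ (CARD('n) + 1)"
    by (simp only: norm_inverse power_inverse divide_inverse)
  finally show ?thesis
    by (simp add: t_def)
qed

section \<open>The weighted measure under automorphisms\<close>

lemma lebesgue_on_ball_simps [simp]:
  "space (lebesgue_on (ball (0::complex^'n) 1)) = ball 0 1"
  by (simp add: space_restrict_space)

text \<open>Continuity would settle Borel sets only. A preimage under \<open>g\<close> is an image
  under the inverse \<open>h\<close>, and differentiable images of Lebesgue sets are Lebesgue
  sets.\<close>

lemma measurable_ball_diffeo:
  fixes g h :: "complex^'n \<Rightarrow> complex^'n"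
  assumes g: "\<And>x. norm x < 1 \<Longrightarrow> norm (g x) < 1" and h: "\<And>x. norm x < 1 \<Longrightarrow> norm (h x) < 1"
    and gh: "\<And>x. norm x < 1 \<Longrightarrow> g (h x) = x" and hg: "\<And>x. norm x < 1 \<Longrightarrow> h (g x) = x"
    and diff: "h differentiable_on unit_ball"
  shows "g \<in> lebesgue_on unit_ball \<rightarrow>\<^sub>M lebesgue_on unit_ball"
proof (rule measurableI)
  fix E :: "(complex^'n) set" assume "E \<in> sets (lebesgue_on unit_ball)"
  then have E: "E \<in> sets lebesgue" "E \<subseteq> unit_ball"
    by (simp_all add: sets_restrict_space_iff)
  have "g -` E \<inter> unit_ball = h ` E"
  proof (intro set_eqI iffI)
    fix x assume "x \<in> g -` E \<inter> unit_ball"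
    then show "x \<in> h ` E"
      by (intro image_eqI[of _ _ "g x"]) (auto simp: hg)
  next
    fix x assume "x \<in> h ` E"
    then show "x \<in> g -` E \<inter> unit_ball"
      using E(2) by (auto simp: gh subset_iff h)
  qed
  moreover have "h ` E \<in> sets lebesgue"
    by (rule differentiable_image_in_sets_lebesgue[OF E(1) order_refl differentiable_on_subset[OF diff E(2)]])
  moreover have "h ` E \<subseteq> unit_ball"
    using E(2) h by auto
  ultimately show "g -` E \<inter> space (lebesgue_on unit_ball) \<in> sets (lebesgue_on unit_ball)"
    by (simp add: sets_restrict_space_iff)
qed (simp add: g)

text \<open>The change of variables formula for the preimage of each set \<open>E\<close>, read as
  an identity of measures. The self-map is left general because both the automorphisms and the
  rotations are instances.\<close>

lemma distr_ball_diffeo: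
  fixes g h :: "complex^'n \<Rightarrow> complex^'n"
  assumes g: "\<And>x. norm x < 1 \<Longrightarrow> norm (g x) < 1" and h: "\<And>x. norm x < 1 \<Longrightarrow> norm (h x) < 1"
    and gh: "\<And>x. norm x < 1 \<Longrightarrow> g (h x) = x" and hg: "\<And>x. norm x < 1 \<Longrightarrow> h (g x) = x"
    and diff: "h differentiable_on unit_ball"
    and der: "\<And>x. norm x < 1 \<Longrightarrow> (g has_derivative g' x) (at x)"
    and J: "\<And>x. norm x < 1 \<Longrightarrow> vol_factor (g' x) = J x"
    and Jm [measurable]: "J \<in> borel_measurable (lebesgue_on unit_ball)"
  shows "distr (density (lebesgue_on unit_ball) J) (lebesgue_on unit_ball) g = lebesgue_on unit_ball"
    (is "distr ?D ?L _ = _")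
proof (rule measure_eqI)
  have gm [measurable]: "g \<in> ?L \<rightarrow>\<^sub>M ?L"
    by (rule measurable_ball_diffeo[OF g h gh hg diff])
  fix E :: "(complex^'n) set" assume "E \<in> sets (distr ?D ?L (g))"
  then have Em: "E \<in> sets ?L"
    by simp
  then have E: "E \<in> sets lebesgue" "E \<subseteq> unit_ball"
    by (auto simp: sets_restrict_space)
  define Y where "Y = g -` E \<inter> unit_ball"
  have Ym: "Y \<in> sets ?L"
    using measurable_sets[OF gm Em] by (simp add: Y_def)
  then have Y: "Y \<in> sets lebesgue" "Y \<subseteq> unit_ball"
    by (auto simp: sets_restrict_space)
  have im: "g ` Y = E"
  proof (intro set_eqI iffI)
    fix x assume "x \<in> E"
    then show "x \<in> g ` Y"
      using E(2) by (intro image_eqI[of _ _ "h x"]) (auto simp: Y_def gh subset_iff h)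
  qed (auto simp: Y_def)
  have YL: "lebesgue_on Y = restrict_space ?L Y"
    using Y by (simp add: restrict_restrict_space Int_absorb1)
  have vf: "vol_factor (g' x) = J x" if "x \<in> Y" for x
    using that Y(2) by (simp add: J subset_iff)
  have [measurable]: "J \<in> borel_measurable (lebesgue_on Y)"
    unfolding YL by (rule measurable_restrict_space1) measurable
  have "emeasure (distr ?D ?L (g)) E = emeasure ?D Y"
    using Em by (subst emeasure_distr) (simp_all add: Y_def gm)
  also have "\<dots> = (\<integral>\<^sup>+x. ennreal (J x) * indicator Y x \<partial>?L)"
    using Ym by (subst emeasure_density) simp_all
  also have "\<dots> = (\<integral>\<^sup>+x. J x \<partial>lebesgue_on Y)"
    unfolding YL using Ym Y(2) by (subst nn_integral_restrict_space[of Y ?L]) (simp_all add: Int_absorb2)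
  also have "\<dots> = (\<integral>\<^sup>+x. vol_factor (g' x) \<partial>lebesgue_on Y)"
    by (rule nn_integral_cong) (simp add: vf space_restrict_space)
  also have "\<dots> = emeasure lebesgue (g ` Y)"
  proof (rule emeasure_differentiable_image[where g=g and g'=g', symmetric])
    show "(g has_derivative g' x) (at x within Y)" if "x \<in> Y" for x
      using that Y(2) by (intro has_derivative_at_withinI[OF der]) auto
    show "inj_on (g) Y"
      using Y(2) by (intro inj_on_inverseI[of _ h]) (auto simp: hg)
    show "g ` Y \<in> lmeasurable"
      unfolding im using E by (meson bounded_ball bounded_set_imp_lmeasurable bounded_subset)
    show "(\<lambda>x. vol_factor (g' x)) \<in> borel_measurable (lebesgue_on Y)"
      by (subst measurable_cong[of _ _ "J"]) (auto simp: space_restrict_space vf)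
  qed (rule Y(1))
  also have "\<dots> = emeasure ?L E"
    unfolding im using E by (subst emeasure_restrict_space) (auto simp: Int_absorb2)
  finally show "emeasure (distr ?D ?L (g)) E = emeasure ?L E" .
qed simp

lemma differentiable_on_phi: "norm z < 1 \<Longrightarrow> phi z differentiable_on unit_ball"
  unfolding differentiable_on_def differentiable_def
  by (meson has_derivative_phi has_derivative_at_withinI mem_ball_0)

lemma measurable_phi_lebesgue:
  assumes "norm z < 1"
  shows "phi z \<in> lebesgue_on unit_ball \<rightarrow>\<^sub>M lebesgue_on unit_ball"
  using assms by (intro measurable_ball_diffeo[where h="phi z"]) (simp_all add: norm_phi_less phi_phi differentiable_on_phi)

definition phi_jac :: "complex^'n \<Rightarrow> complex^'n \<Rightarrow> real" where
  "phi_jac z u = ((1 - (norm z)\<^sup>2) / (cmod (1 - hinner u z))\<^sup>2) ^ (CARD('n) + 1)"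

lemma continuous_hinner_left: "continuous_on S (\<lambda>u. hinner u z)"
  using bounded_linear_hinner_left by (rule linear_continuous_on)

lemma continuous_on_phi_jac:
  assumes "norm z < 1"
  shows "continuous_on unit_ball (phi_jac z)"
  unfolding phi_jac_def using one_minus_hinner_nz[OF _ assms]
  by (intro continuous_intros continuous_hinner_left) auto

lemma measurable_on_ball:
  "continuous_on (ball (0::complex^'n) 1) f \<Longrightarrow> f \<in> borel_measurable (lebesgue_on unit_ball)"
  by (rule continuous_imp_measurable_on_sets_lebesgue) simp_all

theorem distr_phi_lebesgue:
  fixes z :: "complex^'n"
  assumes z: "norm z < 1"
  shows "distr (density (lebesgue_on unit_ball) (phi_jac z)) (lebesgue_on unit_ball) (phi z) = lebesgue_on unit_ball"
proof (rule distr_ball_diffeo[where h="phi z" and g'="phi_deriv z"])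
  show "phi_jac z \<in> borel_measurable (lebesgue_on unit_ball)"
    by (rule measurable_on_ball[OF continuous_on_phi_jac[OF z]])
qed (simp_all add: norm_phi_less phi_phi differentiable_on_phi has_derivative_phi vol_factor_phi_deriv phi_jac_def z)

lemma distr_rotation_lebesgue:
  assumes c: "cmod c = 1"
  shows "distr (lebesgue_on (unit_ball :: (complex^'n) set)) (lebesgue_on unit_ball) (\<lambda>x. c *s x) = lebesgue_on unit_ball"
    and measurable_rotation_lebesgue:
      "(\<lambda>x. c *s x) \<in> lebesgue_on (unit_ball :: (complex^'n) set) \<rightarrow>\<^sub>M lebesgue_on unit_ball"
proof -
  have lin: "linear (\<lambda>x. a *s x :: complex^'n)" for a
    by (rule linearI) (simp_all add: vec_eq_iff algebra_simps)
  have c0: "c \<noteq> 0" "cmod (inverse c) = 1"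
    using c by (auto simp: norm_inverse)
  have inv: "c *s (inverse c *s x) = x" "inverse c *s (c *s x) = x" for x :: "complex^'n"
    using c0 by (simp_all add: vec_eq_iff)
  have diff: "(\<lambda>x. inverse c *s x :: complex^'n) differentiable_on unit_ball"
    by (rule linear_imp_differentiable_on[OF lin])
  show "(\<lambda>x. c *s x) \<in> lebesgue_on (unit_ball :: (complex^'n) set) \<rightarrow>\<^sub>M lebesgue_on unit_ball"
    by (rule measurable_ball_diffeo[where h="\<lambda>x. inverse c *s x", OF _ _ _ _ diff]) (simp_all only: norm_vec_cmult c c0 inv mult_1_left)
  have "distr (density (lebesgue_on (unit_ball :: (complex^'n) set)) (\<lambda>_. ennreal 1)) (lebesgue_on unit_ball) (\<lambda>x. c *s x) = lebesgue_on unit_ball"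
  proof (rule distr_ball_diffeo[where h="\<lambda>x. inverse c *s x" and g'="\<lambda>_ x. c *s x", OF _ _ _ _ diff])
    show "((\<lambda>x. c *s x) has_derivative (\<lambda>x. c *s x)) (at x)" for x :: "complex^'n"
      by (rule linear_imp_has_derivative[OF lin])
    show "vol_factor (\<lambda>x :: complex^'n. c *s x) = 1"
      by (simp add: vol_factor_cmult c)
  qed (simp_all only: norm_vec_cmult c c0 inv mult_1_left, simp)
  then show "distr (lebesgue_on (unit_ball :: (complex^'n) set)) (lebesgue_on unit_ball) (\<lambda>x. c *s x) = lebesgue_on unit_ball"
    by (simp add: density_1)
qed

section \<open>The weight and the kernel under automorphisms\<close>

definition wt :: "real \<Rightarrow> complex^'n \<Rightarrow> real" where
  "wt \<alpha> z = c_alpha TYPE('n) \<alpha> * (1 - (norm z)\<^sup>2) powr \<alpha>"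

lemma nu_eq: "nu \<alpha> = density (lebesgue_on unit_ball) (\<lambda>z. ennreal (wt \<alpha> z))"
  by (simp add: nu_def wt_def)

lemma space_nu [simp]: "space (nu \<alpha>) = unit_ball"
  by (simp add: nu_eq)

lemma sets_nu: "sets (nu \<alpha>) = sets (lebesgue_on unit_ball)"
  by (simp add: nu_eq)

lemma measurable_wt [measurable]: "wt \<alpha> \<in> borel_measurable (lebesgue_on unit_ball)"
proof (rule measurable_on_ball)
  show "continuous_on unit_ball (wt \<alpha> :: complex^'a \<Rightarrow> real)"
    unfolding wt_def by (intro continuous_intros) (auto simp: abs_square_eq_1)
qed

lemma measurable_nu_continuous: "continuous_on unit_ball f \<Longrightarrow> f \<in> borel_measurable (nu \<alpha>)"
  using measurable_on_ball by (simp add: measurable_cong_sets[OF sets_nu refl])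

lemma measurable_phi_nu: "norm z < 1 \<Longrightarrow> phi z \<in> nu \<alpha> \<rightarrow>\<^sub>M nu \<alpha>"
  using measurable_phi_lebesgue by (simp add: measurable_cong_sets[OF sets_nu sets_nu])

lemma norm_Kern: "cmod (Kern \<alpha> z (w::complex^'n)) = cmod (1 - hinner w z) powr (- (real CARD('n) + 1 + \<alpha>))"
proof -
  have "- of_real (real CARD('n) + 1 + \<alpha>) \<in> (\<real> :: complex set)"
    by (metis Reals_minus Reals_of_real)
  then show ?thesis
    unfolding Kern_def by (subst norm_powr_real_powr') simp_all
qed

lemma norm_kern_squared:
  fixes z u :: "complex^'n"
  assumes z: "norm z < 1" and u: "norm u < 1"
  shows "(cmod (kern \<alpha> z u))\<^sup>2 = ((1 - (norm z)\<^sup>2) / (cmod (1 - hinner u z))\<^sup>2) powr (real CARD('n) + 1 + \<alpha>)"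
proof -
  define l where "l = real CARD('n) + 1 + \<alpha>"
  define t where "t = cmod (1 - hinner u z)"
  define a where "a = 1 - (norm z)\<^sup>2"
  have a: "a > 0" and t: "t > 0"
    using one_minus_norm2_pos[OF z] one_minus_hinner_nz[OF u z] by (simp_all add: a_def t_def)
  have "cmod (kern \<alpha> z u) = a powr (l / 2) * t powr (- l)"
    by (simp add: kern_def norm_mult norm_Kern a_def t_def l_def)
  then have "(cmod (kern \<alpha> z u))\<^sup>2 = a powr l * (t powr (- l) * t powr (- l))"
    by (simp add: power2_eq_square mult_ac powr_add[symmetric])
  also have "\<dots> = (a / t\<^sup>2) powr l"
    using a t by (simp add: powr_divide powr_minus_divide power2_eq_square powr_mult)
  finally show ?thesis
    by (simp add: a_def t_def l_def)
qed

text \<open>By \<open>one_minus_norm_phi\<close> the weight at \<open>phi z u\<close> brings the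
  exponent \<alpha>, and the Jacobian the exponent \<open>CARD('n) + 1\<close>, of one and the same
  quotient. Together they form the exponent of the kernel, so
  \<open>(cmod (kern \<alpha> z u))\<^sup>2\<close> is the density by which \<open>nu\<close>
  transforms.\<close>

lemma wt_phi:
  fixes z u :: "complex^'n"
  assumes z: "norm z < 1" and u: "norm u < 1"
  shows "wt \<alpha> (phi z u) * phi_jac z u = wt \<alpha> u * (cmod (kern \<alpha> z u))\<^sup>2"
proof -
  define t where "t = (cmod (1 - hinner u z))\<^sup>2"
  define a where "a = 1 - (norm z)\<^sup>2"
  define b where "b = 1 - (norm u)\<^sup>2"
  have pos: "a > 0" "b > 0" "t > 0"
    using one_minus_norm2_pos[OF z] one_minus_norm2_pos[OF u] one_minus_hinner_nz[OF u z]
    by (simp_all add: a_def b_def t_def)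
  have "wt \<alpha> (phi z u) * phi_jac z u = c_alpha TYPE('n) \<alpha> * ((a * b / t) powr \<alpha> * (a / t) powr real (CARD('n) + 1))"
    unfolding wt_def one_minus_norm_phi[OF z u] phi_jac_def a_def[symmetric] b_def[symmetric] t_def[symmetric]
    using pos by (subst powr_realpow) simp_all
  also have "(a * b / t) powr \<alpha> = b powr \<alpha> * (a / t) powr \<alpha>"
    using pos by (subst powr_mult[symmetric]) (simp_all add: mult_ac)
  also have "c_alpha TYPE('n) \<alpha> * (b powr \<alpha> * (a / t) powr \<alpha> * (a / t) powr real (CARD('n) + 1))
    = wt \<alpha> u * ((a / t) powr (\<alpha> + real (CARD('n) + 1)))"
    by (simp only: wt_def b_def powr_add mult_ac)
  finally show ?thesis
    by (simp add: norm_kern_squared[OF z u] a_def t_def add_ac)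
qed

lemma c_alpha_nonneg: "c_alpha TYPE('n::finite) \<alpha> \<ge> 0"
  by (simp add: c_alpha_def)

lemma wt_nonneg: "wt \<alpha> z \<ge> 0"
  by (simp add: wt_def c_alpha_nonneg)

lemma measurable_nu_iff: "f \<in> borel_measurable (nu \<alpha>) \<longleftrightarrow> f \<in> borel_measurable (lebesgue_on unit_ball)"
  by (simp only: measurable_cong_sets[OF sets_nu refl])

lemma nn_integral_nu:
  fixes f :: "complex^'n \<Rightarrow> ennreal"
  assumes "f \<in> borel_measurable (nu \<alpha>)"
  shows "(\<integral>\<^sup>+z. f z \<partial>nu \<alpha>) = (\<integral>\<^sup>+z. wt \<alpha> z * f z \<partial>lebesgue_on unit_ball)"
proof -
  have [measurable]: "f \<in> borel_measurable (lebesgue_on unit_ball)"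
    using assms by (simp only: measurable_nu_iff)
  show ?thesis
    unfolding nu_eq by (rule nn_integral_density) measurable
qed

lemma one_minus_hinner_not_nonpos:
  assumes "norm z < 1" "norm w < 1"
  shows "1 - hinner z w \<notin> \<real>\<^sub>\<le>\<^sub>0"
  using Re_one_minus_hinner_pos[OF assms] by (simp only: complex_nonpos_Reals_iff not_le de_Morgan_conj simp_thms)

lemma continuous_on_Kern:
  assumes z: "norm z < 1"
  shows "continuous_on unit_ball (Kern \<alpha> z)"
  unfolding Kern_def
proof (intro continuous_on_powr_complex continuous_intros continuous_hinner_left)
  show "unit_ball \<subseteq> {w. 0 \<le> Re (1 - hinner w z) \<or> Im (1 - hinner w z) \<noteq> 0}"
    using Re_one_minus_hinner_pos[OF _ z] by (force intro: less_imp_le)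
  show "0 < Re (- of_real (real CARD('a) + 1 + \<alpha>))" if "w \<in> unit_ball" "1 - hinner w z = 0" for w
    using one_minus_hinner_nz[OF _ z] that by simp
qed

lemma measurable_norm_kern:
  assumes z: "norm z < 1"
  shows "(\<lambda>u. (cmod (kern \<alpha> z u))\<^sup>2) \<in> borel_measurable (nu \<alpha>)"
  unfolding kern_def
  by (intro measurable_nu_continuous continuous_intros continuous_on_Kern z)

theorem nn_integral_nu_phi:
  fixes z :: "complex^'n" and f :: "complex^'n \<Rightarrow> ennreal"
  assumes z: "norm z < 1" and f: "f \<in> borel_measurable (nu \<alpha>)"
  shows "(\<integral>\<^sup>+u. f (phi z u) * ennreal ((cmod (kern \<alpha> z u))\<^sup>2) \<partial>nu \<alpha>) = (\<integral>\<^sup>+w. f w \<partial>nu \<alpha>)"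
proof -
  have [measurable]: "f \<in> borel_measurable (lebesgue_on unit_ball)"
    using f by (simp add: measurable_cong_sets[OF sets_nu refl])
  note [measurable] = measurable_phi_lebesgue[OF z] measurable_on_ball[OF continuous_on_phi_jac[OF z]]
  have "(\<integral>\<^sup>+w. f w \<partial>nu \<alpha>) = (\<integral>\<^sup>+w. wt \<alpha> w * f w \<partial>lebesgue_on unit_ball)"
    by (rule nn_integral_nu[OF f])
  also have "\<dots> = (\<integral>\<^sup>+w. wt \<alpha> w * f w \<partial>distr (density (lebesgue_on unit_ball) (phi_jac z)) (lebesgue_on unit_ball) (phi z))"
    by (simp only: distr_phi_lebesgue[OF z])
  also have "\<dots> = (\<integral>\<^sup>+u. wt \<alpha> (phi z u) * f (phi z u) \<partial>density (lebesgue_on unit_ball) (phi_jac z))"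
    by (subst nn_integral_distr) (auto simp: measurable_phi_lebesgue[OF z])
  also have "\<dots> = (\<integral>\<^sup>+u. phi_jac z u * (wt \<alpha> (phi z u) * f (phi z u)) \<partial>lebesgue_on unit_ball)"
    by (subst nn_integral_density) auto
  also have "\<dots> = (\<integral>\<^sup>+u. wt \<alpha> u * (f (phi z u) * ennreal ((cmod (kern \<alpha> z u))\<^sup>2)) \<partial>lebesgue_on unit_ball)"
  proof (rule nn_integral_cong)
    fix u :: "complex^'n" assume "u \<in> space (lebesgue_on unit_ball)"
    then have u: "norm u < 1"
      by simp
    have j: "phi_jac z u \<ge> 0"
      using one_minus_norm2_pos[OF z] by (simp add: phi_jac_def)
    have "ennreal (phi_jac z u) * ennreal (wt \<alpha> (phi z u)) = ennreal (wt \<alpha> u) * ennreal ((cmod (kern \<alpha> z u))\<^sup>2)"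
      using wt_phi[OF z u, of \<alpha>] j by (simp add: ennreal_mult'[symmetric] wt_nonneg mult.commute)
    then show "phi_jac z u * (wt \<alpha> (phi z u) * f (phi z u)) = wt \<alpha> u * (f (phi z u) * ennreal ((cmod (kern \<alpha> z u))\<^sup>2))"
      by (metis mult.assoc mult.commute)
  qed
  also have "\<dots> = (\<integral>\<^sup>+u. f (phi z u) * ennreal ((cmod (kern \<alpha> z u))\<^sup>2) \<partial>nu \<alpha>)"
    by (intro nn_integral_nu[symmetric] borel_measurable_times_ennreal
        measurable_compose[OF measurable_phi_nu[OF z] f] measurable_compose_rev[OF measurable_ennreal]
        measurable_norm_kern z)
  finally show ?thesis
    by simp
qed

text \<open>The quotients that are raised to the power are reciprocal at \<open>u\<close> and at
  \<open>phi z u\<close>, by \<open>one_minus_hinner_phi\<close>.\<close>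

lemma norm_kern_phi:
  fixes z u :: "complex^'n"
  assumes z: "norm z < 1" and u: "norm u < 1"
  shows "(cmod (kern \<alpha> z (phi z u)))\<^sup>2 * (cmod (kern \<alpha> z u))\<^sup>2 = 1"
proof -
  have "(1 - (norm z)\<^sup>2) / (cmod (1 - hinner (phi z u) z))\<^sup>2 * ((1 - (norm z)\<^sup>2) / (cmod (1 - hinner u z))\<^sup>2) = 1"
  proof -
    define a t where "a = 1 - (norm z)\<^sup>2" and "t = cmod (1 - hinner u z)"
    have "a > 0" "t > 0"
      using one_minus_norm2_pos[OF z] one_minus_hinner_nz[OF u z] by (simp_all add: a_def t_def)
    moreover have "cmod (1 - hinner (phi z u) z) = a / t"
      using \<open>a > 0\<close> unfolding one_minus_hinner_phi[OF z u] norm_divide t_def[symmetric] norm_of_real a_def[symmetric]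
      by simp
    ultimately show ?thesis
      unfolding a_def[symmetric] t_def[symmetric] by (simp add: power2_eq_square)
  qed
  moreover have "(1 - (norm z)\<^sup>2) / (cmod (1 - hinner (phi z u) z))\<^sup>2 \<ge> 0"
    using one_minus_norm2_pos[OF z] by simp
  ultimately show ?thesis
    unfolding norm_kern_squared[OF z norm_phi_less[OF z u]] norm_kern_squared[OF z u]
    using one_minus_norm2_pos[OF z] by (subst powr_mult[symmetric]) simp_all
qed

text \<open>The preceding substitution for \<open>f\<close> times the squared kernel; the two kernel
  factors cancel by \<open>norm_kern_phi\<close>.\<close>

lemma nn_integral_nu_phi':
  fixes z :: "complex^'n" and f :: "complex^'n \<Rightarrow> ennreal"
  assumes z: "norm z < 1" and f: "f \<in> borel_measurable (nu \<alpha>)"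
  shows "(\<integral>\<^sup>+u. f (phi z u) \<partial>nu \<alpha>) = (\<integral>\<^sup>+w. f w * ennreal ((cmod (kern \<alpha> z w))\<^sup>2) \<partial>nu \<alpha>)"
proof -
  have m: "(\<lambda>w. f w * ennreal ((cmod (kern \<alpha> z w))\<^sup>2)) \<in> borel_measurable (nu \<alpha>)"
    by (intro borel_measurable_times_ennreal f measurable_compose_rev[OF measurable_ennreal] measurable_norm_kern z)
  have "(\<integral>\<^sup>+w. f w * ennreal ((cmod (kern \<alpha> z w))\<^sup>2) \<partial>nu \<alpha>)
    = (\<integral>\<^sup>+u. (f (phi z u) * ennreal ((cmod (kern \<alpha> z (phi z u)))\<^sup>2)) * ennreal ((cmod (kern \<alpha> z u))\<^sup>2) \<partial>nu \<alpha>)"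
    by (rule nn_integral_nu_phi[OF z m, symmetric])
  also have "\<dots> = (\<integral>\<^sup>+u. f (phi z u) \<partial>nu \<alpha>)"
  proof (rule nn_integral_cong)
    fix u :: "complex^'n" assume "u \<in> space (nu \<alpha>)"
    then have u: "norm u < 1"
      by simp
    have "ennreal ((cmod (kern \<alpha> z (phi z u)))\<^sup>2) * ennreal ((cmod (kern \<alpha> z u))\<^sup>2) = 1"
      using norm_kern_phi[OF z u, of \<alpha>] by (simp add: ennreal_mult'[symmetric])
    then show "f (phi z u) * ennreal ((cmod (kern \<alpha> z (phi z u)))\<^sup>2) * ennreal ((cmod (kern \<alpha> z u))\<^sup>2) = f (phi z u)"
      by (simp only: mult.assoc mult_1_right)
  qed
  finally show ?thesis
    by (rule sym)
qed

section \<open>Finiteness and positivity of the weight integral\<close>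

text \<open>The shell is the unit ball without the ball of radius \<open>sqrt (1 - d)\<close>, whose
  relative volume is \<open>(1 - d) ^ CARD('n)\<close> because the real dimension is
  \<open>2 * CARD('n)\<close>. Bernoulli's inequality makes the difference linear in
  \<open>d\<close>.\<close>

lemma measure_shell_le:
  assumes "0 \<le> d" "d \<le> 1"
  shows "emeasure lebesgue {z :: complex^'n. norm z < 1 \<and> 1 - (norm z)\<^sup>2 \<le> d}
    \<le> ennreal (measure lebesgue (unit_ball :: (complex^'n) set) * (real CARD('n) * d))"
proof -
  define r where "r = sqrt (1 - d)"
  have r: "r \<ge> 0" "r\<^sup>2 = 1 - d" "r \<le> 1"
    using assms by (simp_all add: r_def real_le_lsqrt)
  have eq: "{z :: complex^'n. norm z < 1 \<and> 1 - (norm z)\<^sup>2 \<le> d} = unit_ball - ball 0 r"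
  proof -
    have "1 - x\<^sup>2 \<le> d \<longleftrightarrow> \<not> x < r" if "x \<ge> 0" for x
    proof -
      have "x < r \<longleftrightarrow> x\<^sup>2 < r\<^sup>2"
        using that r(1) by (metis power2_less_imp_less power_strict_mono pos2)
      then show ?thesis
        using r(2) by auto
    qed
    then show ?thesis
      by auto
  qed
  have "measure lebesgue (unit_ball - ball 0 r :: (complex^'n) set)
     = measure lebesgue (unit_ball :: (complex^'n) set) - measure lebesgue (ball 0 r :: (complex^'n) set)"
    using r emeasure_lborel_ball_finite[of "0 :: complex^'n" 1] by (intro measure_Diff) (auto simp: less_top)
  also have "measure lebesgue (ball 0 r :: (complex^'n) set) = r ^ (2 * CARD('n)) * measure lebesgue (unit_ball :: (complex^'n) set)"
    using content_ball_conv_unit_ball[OF r(1), of "0 :: complex^'n"] by (simp add: mult.commute)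
  also have "r ^ (2 * CARD('n)) = (1 - d) ^ CARD('n)"
    by (simp add: power_mult r)
  also have "measure lebesgue (unit_ball :: (complex^'n) set) - (1 - d) ^ CARD('n) * measure lebesgue (unit_ball :: (complex^'n) set)
    \<le> measure lebesgue (unit_ball :: (complex^'n) set) * (real CARD('n) * d)"
  proof -
    have "1 - real CARD('n) * d \<le> (1 - d) ^ CARD('n)"
      using Bernoulli_inequality[of "- d" "CARD('n)"] assms by simp
    then have "measure lebesgue (unit_ball :: (complex^'n) set) * (1 - (1 - d) ^ CARD('n))
        \<le> measure lebesgue (unit_ball :: (complex^'n) set) * (real CARD('n) * d)"
      by (intro mult_left_mono) auto
    then show ?thesis
      by (simp add: algebra_simps)
  qed
  finally have "measure lebesgue (unit_ball - ball 0 r :: (complex^'n) set)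
    \<le> measure lebesgue (unit_ball :: (complex^'n) set) * (real CARD('n) * d)" .
  moreover have "unit_ball - ball 0 r \<in> (lmeasurable :: (complex^'n) set set)"
    by (intro fmeasurable_Diff) auto
  ultimately show ?thesis
    unfolding eq by (subst emeasure_eq_measure2) (auto intro: ennreal_leI)
qed

text \<open>\<open>k\<close> is the dyadic scale with \<open>x\<close> between
  \<open>(1/2) ^ Suc k\<close> and \<open>(1/2) ^ k\<close>. For a nonpositive exponent the power is
  largest at the lower end, hence the \<open>Suc k\<close> in the second bound.\<close>

lemma powr_dyadic_bound:
  fixes x a :: real
  assumes "0 < x" "x \<le> 1" "a \<le> 0"
  obtains k where "x \<le> (1/2) ^ k" "x powr a \<le> (1/2) powr (a * real (Suc k))"
proof -
  define k where "k = nat \<lfloor>log (1/2) x\<rfloor>"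
  have l0: "log (1/2) x \<ge> 0"
    using assms by (simp add: log_def divide_nonpos_neg)
  have "real k \<le> log (1/2) x" "log (1/2) x \<le> real (Suc k)"
    using l0 by (auto simp: k_def) linarith
  moreover have x: "(1/2) powr log (1/2) x = x"
    using assms by (subst powr_log_cancel) auto
  ultimately have "x \<le> (1/2) powr real k" "x \<ge> (1/2) powr real (Suc k)"
    using powr_mono'[of "real k" "log (1/2) x" "1/2"] powr_mono'[of "log (1/2) x" "real (Suc k)" "1/2"] by auto
  moreover from this(2) have "x powr a \<le> ((1/2) powr real (Suc k)) powr a"
    using assms by (intro powr_mono2') auto
  ultimately show ?thesis
    by (intro that[of k]) (simp_all add: powr_realpow powr_powr mult.commute)
qed

text \<open>For \<alpha> \<ge> 0 the weight is at most 1. Otherwise it is dominated by a sum of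
  constants on the shells \<open>S k\<close>; these are nested, but a single one at the scale of the
  point already suffices for the bound, and each has volume proportional to at most
  \<open>(1/2) ^ k\<close>.\<close>

lemma nn_integral_weight_finite:
  assumes "\<alpha> > - 1"
  shows "(\<integral>\<^sup>+z. ennreal ((1 - (norm z)\<^sup>2) powr \<alpha>) \<partial>lebesgue_on (unit_ball :: (complex^'n) set)) < \<infinity>"
proof (cases "\<alpha> \<ge> 0")
  case True
  have "(\<integral>\<^sup>+z. ennreal ((1 - (norm z)\<^sup>2) powr \<alpha>) \<partial>lebesgue_on (unit_ball :: (complex^'n) set))
    \<le> (\<integral>\<^sup>+z. 1 \<partial>lebesgue_on (unit_ball :: (complex^'n) set))"
  proof (rule nn_integral_mono)
    fix z :: "complex^'n" assume "z \<in> space (lebesgue_on unit_ball)"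
    then have "0 \<le> 1 - (norm z)\<^sup>2" "1 - (norm z)\<^sup>2 \<le> 1"
      using one_minus_norm2_pos[of z] by auto
    then show "ennreal ((1 - (norm z)\<^sup>2) powr \<alpha>) \<le> 1"
      using True by (simp add: powr_le1)
  qed
  also have "\<dots> < \<infinity>"
    using emeasure_lborel_ball_finite[of "0 :: complex^'n" 1] by (simp add: emeasure_restrict_space)
  finally show ?thesis .
next
  case False
  define S where "S k = {z :: complex^'n. norm z < 1 \<and> 1 - (norm z)\<^sup>2 \<le> (1/2) ^ k}" for k :: nat
  define A where "A = measure lebesgue (unit_ball :: (complex^'n) set) * real CARD('n)"
  have S: "S k \<in> sets (lebesgue_on unit_ball)" for k
  proof -
    have "S k = unit_ball \<inter> {z. 1 - (norm z)\<^sup>2 \<le> (1/2) ^ k}"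
      by (auto simp: S_def)
    moreover have "closed {z :: complex^'n. 1 - (norm z)\<^sup>2 \<le> (1/2) ^ k}"
      by (intro closed_Collect_le continuous_intros)
    ultimately have "S k \<in> sets lebesgue"
      by (metis borel_closed fmeasurableD lmeasurable_ball sets.Int sets_completionI_sets sets_lborel)
    moreover have "S k \<subseteq> unit_ball"
      by (auto simp: S_def)
    ultimately show ?thesis
      by (simp add: sets_restrict_space_iff)
  qed
  have "(\<integral>\<^sup>+z. ennreal ((1 - (norm z)\<^sup>2) powr \<alpha>) \<partial>lebesgue_on (unit_ball :: (complex^'n) set))
    \<le> (\<integral>\<^sup>+z. (\<Sum>k. ennreal ((1/2) powr (\<alpha> * real (Suc k))) * indicator (S k) z) \<partial>lebesgue_on (unit_ball :: (complex^'n) set))"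
  proof (rule nn_integral_mono)
    fix z :: "complex^'n" assume "z \<in> space (lebesgue_on unit_ball)"
    then have z: "norm z < 1" "0 < 1 - (norm z)\<^sup>2"
      using one_minus_norm2_pos[of z] by auto
    obtain k where k: "1 - (norm z)\<^sup>2 \<le> (1/2) ^ k" "(1 - (norm z)\<^sup>2) powr \<alpha> \<le> (1/2) powr (\<alpha> * real (Suc k))"
      using powr_dyadic_bound[of "1 - (norm z)\<^sup>2" \<alpha>] z False by auto
    have "ennreal ((1 - (norm z)\<^sup>2) powr \<alpha>) \<le> ennreal ((1/2) powr (\<alpha> * real (Suc k))) * indicator (S k) z"
      using k z by (simp add: S_def ennreal_leI)
    also have "\<dots> \<le> (\<Sum>k. ennreal ((1/2) powr (\<alpha> * real (Suc k))) * indicator (S k) z)"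
    proof -
      have "f k \<le> suminf f" for f :: "nat \<Rightarrow> ennreal"
        using sum_le_suminf[OF summableI, of "{k}" f] by simp
      then show ?thesis .
    qed
    finally show "ennreal ((1 - (norm z)\<^sup>2) powr \<alpha>) \<le> (\<Sum>k. ennreal ((1/2) powr (\<alpha> * real (Suc k))) * indicator (S k) z)" .
  qed
  also have "\<dots> = (\<Sum>k. ennreal ((1/2) powr (\<alpha> * real (Suc k))) * emeasure (lebesgue_on unit_ball) (S k))"
    using S by (subst nn_integral_suminf) (auto simp: nn_integral_cmult_indicator)
  also have "\<dots> \<le> (\<Sum>k. ennreal (A * (1/2) powr \<alpha> * ((1/2) powr (\<alpha> + 1)) ^ k))"
  proof (intro suminf_le summableI)
    fix k
    have "S k \<in> sets lebesgue" "S k \<subseteq> unit_ball"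
      using S[of k] by (simp_all add: sets_restrict_space_iff)
    then have "emeasure (lebesgue_on unit_ball) (S k) = emeasure lebesgue (S k)"
      by (subst emeasure_restrict_space) (auto simp: Int_absorb2)
    also have "\<dots> \<le> ennreal (A * (1/2) ^ k)"
      using measure_shell_le[of "(1/2) ^ k", where 'n='n] by (simp add: S_def A_def power_le_one mult.assoc)
    finally have "ennreal ((1/2) powr (\<alpha> * real (Suc k))) * emeasure (lebesgue_on unit_ball) (S k)
        \<le> ennreal ((1/2) powr (\<alpha> * real (Suc k))) * ennreal (A * (1/2) ^ k)"
      by (rule mult_left_mono) simp
    also have "\<dots> = ennreal ((1/2) powr (\<alpha> * real (Suc k)) * (A * (1/2) ^ k))"
      by (simp add: ennreal_mult A_def)
    also have "(1/2) powr (\<alpha> * real (Suc k)) * (A * (1/2) ^ k) = A * (1/2) powr \<alpha> * ((1/2) powr (\<alpha> + 1)) ^ k"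
    proof -
      have "((1/2::real) powr (\<alpha> + 1)) ^ k = (1/2) powr (\<alpha> * real k) * (1/2) ^ k"
        by (simp add: powr_add power_divide powr_power mult.commute)
      moreover have "(1/2::real) powr (\<alpha> * real (Suc k)) = (1/2) powr \<alpha> * (1/2) powr (\<alpha> * real k)"
        by (simp add: powr_add[symmetric] algebra_simps)
      ultimately show ?thesis
        by simp
    qed
    finally show "ennreal ((1/2) powr (\<alpha> * real (Suc k))) * emeasure (lebesgue_on unit_ball) (S k)
      \<le> ennreal (A * (1/2) powr \<alpha> * ((1/2) powr (\<alpha> + 1)) ^ k)" .
  qed
  also have "\<dots> < \<infinity>"
  proof -
    \<comment> \<open>The growth \<open>(1/2) powr (\<alpha> * k)\<close> of the weight against the
      decay of the volume: the ratio is below 1 precisely when \<alpha> > - 1.\<close>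
    have "(1/2::real) powr (\<alpha> + 1) < 1"
      using assms by (simp add: powr_def mult_pos_neg ln_less_zero)
    then have "summable (\<lambda>k. A * (1/2) powr \<alpha> * ((1/2) powr (\<alpha> + 1)) ^ k)"
      by (intro summable_mult summable_geometric) simp
    moreover have "0 \<le> A * (1/2) powr \<alpha> * ((1/2) powr (\<alpha> + 1)) ^ k" for k
      by (simp add: A_def)
    ultimately show ?thesis
      unfolding infinity_ennreal_def less_top[symmetric] by (rule ennreal_suminf_neq_top)
  qed
  finally show ?thesis .
qed

lemma measurable_weight:
  "(\<lambda>z. (1 - (norm z)\<^sup>2) powr \<alpha>) \<in> borel_measurable (lebesgue_on (unit_ball :: (complex^'n) set))"
  by (intro measurable_on_ball continuous_intros) (auto simp: abs_square_eq_1)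

lemma integrable_weight:
  assumes "\<alpha> > - 1"
  shows "integrable (lebesgue_on (unit_ball :: (complex^'n) set)) (\<lambda>z. (1 - (norm z)\<^sup>2) powr \<alpha>)"
  using nn_integral_weight_finite[OF assms, where 'n='n] by (intro integrableI_nonneg measurable_weight) auto

text \<open>The weight is positive on a set of positive volume. This excludes that
  \<open>c_alpha\<close>, an inverse, takes the default value 0.\<close>

lemma integral_weight_pos:
  assumes "\<alpha> > - 1"
  shows "(\<integral>z. (1 - (norm z)\<^sup>2) powr \<alpha> \<partial>lebesgue_on (unit_ball :: (complex^'n) set)) > 0"
proof -
  have "(\<integral>z. (1 - (norm z)\<^sup>2) powr \<alpha> \<partial>lebesgue_on (unit_ball :: (complex^'n) set)) \<noteq> 0"
  proof
    assume "(\<integral>z. (1 - (norm z)\<^sup>2) powr \<alpha> \<partial>lebesgue_on (unit_ball :: (complex^'n) set)) = 0"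
    then have "AE z in lebesgue_on (unit_ball :: (complex^'n) set). (1 - (norm z)\<^sup>2) powr \<alpha> = 0"
      using integral_nonneg_eq_0_iff_AE[OF integrable_weight[OF assms]] by (metis (mono_tags, lifting) AE_I2 powr_ge_zero)
    moreover have "AE z in lebesgue_on (unit_ball :: (complex^'n) set). (1 - (norm z)\<^sup>2) powr \<alpha> \<noteq> 0"
    proof (rule AE_I2)
      fix z :: "complex^'n" assume "z \<in> space (lebesgue_on unit_ball)"
      then show "(1 - (norm z)\<^sup>2) powr \<alpha> \<noteq> 0"
        using one_minus_norm2_pos[of z] by simp
    qed
    ultimately have "AE z in lebesgue_on (unit_ball :: (complex^'n) set). False"
      by eventually_elim simp
    then have "emeasure (lebesgue_on unit_ball) (unit_ball :: (complex^'n) set) = 0"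
      by (metis ae_filter_eq_bot_iff trivial_limit_def lebesgue_on_ball_simps)
    then have "emeasure lebesgue (unit_ball :: (complex^'n) set) = 0"
      by (simp add: emeasure_restrict_space)
    then have "measure lebesgue (unit_ball :: (complex^'n) set) = 0"
      by (simp add: measure_def)
    then show False
      using content_ball_gt_0_iff[of "0::complex^'n" 1] by simp
  qed
  moreover have "(\<integral>z. (1 - (norm z)\<^sup>2) powr \<alpha> \<partial>lebesgue_on (unit_ball :: (complex^'n) set)) \<ge> 0"
    by simp
  ultimately show ?thesis
    by linarith
qed

lemma c_alpha_pos: "\<alpha> > - 1 \<Longrightarrow> c_alpha TYPE('n::finite) \<alpha> > 0"
  using integral_weight_pos[of \<alpha>, where 'n='n] by (simp add: c_alpha_def)

lemma wt_pos: "\<alpha> > - 1 \<Longrightarrow> norm z < 1 \<Longrightarrow> wt \<alpha> z > 0"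
  using one_minus_norm2_pos[of z] by (simp add: wt_def c_alpha_pos)

lemma emeasure_nu_space:
  assumes "\<alpha> > - 1"
  shows "emeasure (nu \<alpha>) (unit_ball :: (complex^'n) set) = 1"
proof -
  have "emeasure (nu \<alpha>) (unit_ball :: (complex^'n) set) = emeasure (nu \<alpha>) (space (nu \<alpha> :: (complex^'n) measure))"
    by simp
  also have "\<dots> = (\<integral>\<^sup>+z. 1 \<partial>(nu \<alpha> :: (complex^'n) measure))"
    by (simp only: nn_integral_const mult_1_left)
  also have "\<dots> = (\<integral>\<^sup>+z. wt \<alpha> z \<partial>lebesgue_on (unit_ball :: (complex^'n) set))"
    by (subst nn_integral_nu) simp_all
  also have "\<dots> = ennreal (\<integral>z. wt \<alpha> z \<partial>lebesgue_on (unit_ball :: (complex^'n) set))"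
    unfolding wt_def by (intro nn_integral_eq_integral integrable_mult_right integrable_weight assms)
      (simp add: c_alpha_nonneg)
  also have "(\<integral>z. wt \<alpha> z \<partial>lebesgue_on (unit_ball :: (complex^'n) set)) = 1"
    unfolding wt_def using integral_weight_pos[OF assms, where 'n='n] by (simp add: c_alpha_def)
  finally show ?thesis
    by simp
qed

lemma finite_measure_nu: "\<alpha> > - 1 \<Longrightarrow> finite_measure (nu \<alpha> :: (complex^'n) measure)"
  by (rule finite_measureI) (simp add: emeasure_nu_space)

lemma measure_nu_space: "\<alpha> > - 1 \<Longrightarrow> measure (nu \<alpha>) (unit_ball :: (complex^'n) set) = 1"
  by (simp add: measure_def emeasure_nu_space)

section \<open>Invariance of the normalised measure\<close>

lemma distr_rotation_nu:
  fixes c :: complex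
  assumes c: "cmod c = 1"
  shows "distr (nu \<alpha> :: (complex^'n) measure) (nu \<alpha>) (\<lambda>x. c *s x) = nu \<alpha>"
proof -
  have m: "(\<lambda>x. c *s x) \<in> lebesgue_on (unit_ball :: (complex^'n) set) \<rightarrow>\<^sub>M lebesgue_on unit_ball"
    by (rule measurable_rotation_lebesgue[OF c])
  have wt: "wt \<alpha> (c *s x) = wt \<alpha> x" for x :: "complex^'n"
    by (simp add: wt_def norm_vec_cmult c)
  have "nu \<alpha> = density (distr (lebesgue_on (unit_ball :: (complex^'n) set)) (lebesgue_on unit_ball) (\<lambda>x. c *s x)) (\<lambda>z. ennreal (wt \<alpha> z))"
    by (simp only: distr_rotation_lebesgue[OF c] nu_eq)
  also have "\<dots> = distr (density (lebesgue_on (unit_ball :: (complex^'n) set)) (\<lambda>x. ennreal (wt \<alpha> (c *s x)))) (lebesgue_on unit_ball) (\<lambda>x. c *s x)"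
    by (rule density_distr[OF _ m]) simp
  also have "\<dots> = distr (nu \<alpha>) (nu \<alpha>) (\<lambda>x. c *s x)"
    unfolding wt nu_eq[symmetric] by (rule distr_cong) (simp_all add: sets_nu)
  finally show ?thesis ..
qed

lemma measurable_rotation_nu: "cmod c = 1 \<Longrightarrow> (\<lambda>x. c *s x) \<in> (nu \<alpha> :: (complex^'n) measure) \<rightarrow>\<^sub>M nu \<alpha>"
  using measurable_rotation_lebesgue by (simp add: measurable_cong_sets[OF sets_nu sets_nu])

text \<open>As an equality of measures the substitution also serves Banach-valued integrals and the
  transfer of integrability.\<close>

theorem distr_phi_nu:
  fixes z :: "complex^'n"
  assumes z: "norm z < 1"
  shows "distr (density (nu \<alpha>) (\<lambda>u. ennreal ((cmod (kern \<alpha> z u))\<^sup>2))) (nu \<alpha>) (phi z) = nu \<alpha>"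
proof (rule measure_eqI)
  note [measurable] = measurable_phi_nu[OF z] measurable_norm_kern[OF z]
  fix E assume "E \<in> sets (distr (density (nu \<alpha>) (\<lambda>u. ennreal ((cmod (kern \<alpha> z u))\<^sup>2))) (nu \<alpha>) (phi z))"
  then have E [measurable]: "E \<in> sets (nu \<alpha>)"
    by simp
  have "emeasure (distr (density (nu \<alpha>) (\<lambda>u. ennreal ((cmod (kern \<alpha> z u))\<^sup>2))) (nu \<alpha>) (phi z)) E
    = (\<integral>\<^sup>+w. indicator E w \<partial>distr (density (nu \<alpha>) (\<lambda>u. ennreal ((cmod (kern \<alpha> z u))\<^sup>2))) (nu \<alpha>) (phi z))"
    by simp
  also have "\<dots> = (\<integral>\<^sup>+u. ennreal ((cmod (kern \<alpha> z u))\<^sup>2) * indicator E (phi z u) \<partial>nu \<alpha>)"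
    by (subst nn_integral_distr, simp_all add: measurable_phi_nu[OF z], subst nn_integral_density, simp_all)
  also have "\<dots> = (\<integral>\<^sup>+w. indicator E w \<partial>nu \<alpha>)"
    by (subst mult.commute) (rule nn_integral_nu_phi[OF z], simp)
  finally show "emeasure (distr (density (nu \<alpha>) (\<lambda>u. ennreal ((cmod (kern \<alpha> z u))\<^sup>2))) (nu \<alpha>) (phi z)) E = emeasure (nu \<alpha>) E"
    by simp
qed simp

lemma integral_nu_phi:
  fixes f :: "complex^'n \<Rightarrow> 'b::{banach, second_countable_topology}"
  assumes z: "norm z < 1" and f: "f \<in> borel_measurable (nu \<alpha>)"
  shows "(\<integral>u. (cmod (kern \<alpha> z u))\<^sup>2 *\<^sub>R f (phi z u) \<partial>nu \<alpha>) = (\<integral>w. f w \<partial>nu \<alpha>)" (is "?I1 = ?I2")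
    and "integrable (nu \<alpha>) (\<lambda>u. (cmod (kern \<alpha> z u))\<^sup>2 *\<^sub>R f (phi z u)) \<longleftrightarrow> integrable (nu \<alpha>) f" (is "?P1 \<longleftrightarrow> ?P2")
proof -
  let ?D = "density (nu \<alpha>) (\<lambda>u. ennreal ((cmod (kern \<alpha> z u))\<^sup>2))"
  have pm: "phi z \<in> ?D \<rightarrow>\<^sub>M nu \<alpha>"
    using measurable_phi_nu[OF z, of \<alpha>] by simp
  have fm: "(\<lambda>u. f (phi z u)) \<in> borel_measurable (nu \<alpha>)"
    by (rule measurable_compose[OF measurable_phi_nu[OF z] f])
  have "?I2 = (\<integral>w. f w \<partial>distr ?D (nu \<alpha>) (phi z))"
    by (simp only: distr_phi_nu[OF z])
  also have "\<dots> = (\<integral>u. f (phi z u) \<partial>?D)"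
    by (rule integral_distr[OF pm f])
  also have "\<dots> = ?I1"
    by (rule integral_density[OF fm measurable_norm_kern[OF z]]) simp
  finally show "?I1 = ?I2" ..
  have "?P2 \<longleftrightarrow> integrable (distr ?D (nu \<alpha>) (phi z)) f"
    by (simp only: distr_phi_nu[OF z])
  also have "\<dots> \<longleftrightarrow> integrable ?D (\<lambda>u. f (phi z u))"
    by (rule integrable_distr_eq[OF pm f])
  also have "\<dots> \<longleftrightarrow> ?P1"
    by (rule integrable_density[OF fm measurable_norm_kern[OF z]]) simp
  finally show "?P1 \<longleftrightarrow> ?P2" ..
qed

section \<open>Mean values and local bounds of holomorphic functions\<close>

text \<open>The scalar counterpart of \<open>holomorphic_vec\<close>; by
  \<open>holomorphic_vec_iff\<close> vector-valued functions are treated through their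
  components.\<close>

definition holomorphic_ball :: "(complex^'n \<Rightarrow> complex) \<Rightarrow> bool" where
  "holomorphic_ball F \<longleftrightarrow>
     (\<forall>z\<in>unit_ball. \<exists>D. (F has_derivative D) (at z) \<and> (\<forall>c v. D (c *s v) = c * D v))"

lemma holomorphic_ballE:
  assumes "holomorphic_ball F" "norm z < 1"
  obtains D where "(F has_derivative D) (at z)" "\<And>c v. D (c *s v) = c * D v"
proof -
  have "\<exists>D. (F has_derivative D) (at z) \<and> (\<forall>c v. D (c *s v) = c * D v)"
    using assms by (simp add: holomorphic_ball_def)
  then obtain D where "(F has_derivative D) (at z)" "\<forall>c v. D (c *s v) = c * D v"
    by blast
  then show ?thesis
    by (intro that[of D]) simp_all
qed

lemma holomorphic_ball_cong:
  assumes "holomorphic_ball F" "\<And>z. norm z < 1 \<Longrightarrow> F z = G z"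
  shows "holomorphic_ball G"
  unfolding holomorphic_ball_def
proof
  fix z :: "complex^'a" assume z: "z \<in> unit_ball"
  then obtain D where D: "(F has_derivative D) (at z)" "\<And>c v. D (c *s v) = c * D v"
    using holomorphic_ballE[OF assms(1)] by (metis mem_ball_0)
  have "(G has_derivative D) (at z)"
    by (rule has_derivative_transform_within_open[OF D(1) open_ball z]) (simp add: assms(2))
  with D(2) show "\<exists>D. (G has_derivative D) (at z) \<and> (\<forall>c v. D (c *s v) = c * D v)"
    by blast
qed

lemma continuous_on_holomorphic_ball: "holomorphic_ball F \<Longrightarrow> continuous_on unit_ball F"
  by (auto intro!: continuous_at_imp_continuous_on dest: has_derivative_continuous elim!: holomorphic_ballE)

lemma holomorphic_ball_mult:
  assumes "holomorphic_ball F" "holomorphic_ball G"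
  shows "holomorphic_ball (\<lambda>z. F z * G z)"
  unfolding holomorphic_ball_def
proof
  fix z :: "complex^'a" assume "z \<in> unit_ball"
  then obtain D E where D: "(F has_derivative D) (at z)" "\<And>c v. D (c *s v) = c * D v"
    and E: "(G has_derivative E) (at z)" "\<And>c v. E (c *s v) = c * E v"
    using holomorphic_ballE[OF assms(1)] holomorphic_ballE[OF assms(2)] by (metis mem_ball_0)
  show "\<exists>D. ((\<lambda>z. F z * G z) has_derivative D) (at z) \<and> (\<forall>c v. D (c *s v) = c * D v)"
    using has_derivative_mult[OF D(1) E(1)] by (auto simp: D E algebra_simps)
qed

lemma holomorphic_ball_comp_phi:
  fixes z :: "complex^'n"
  assumes F: "holomorphic_ball F" and z: "norm z < 1"
  shows "holomorphic_ball (\<lambda>u. F (phi z u))"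
  unfolding holomorphic_ball_def
proof
  fix u :: "complex^'n" assume "u \<in> unit_ball"
  then have u: "norm u < 1"
    by simp
  obtain D where D: "(F has_derivative D) (at (phi z u))" "\<And>c v. D (c *s v) = c * D v"
    using holomorphic_ballE[OF F norm_phi_less[OF z u]] by metis
  show "\<exists>D. ((\<lambda>u. F (phi z u)) has_derivative D) (at u) \<and> (\<forall>c v. D (c *s v) = c * D v)"
    using has_derivative_compose[OF has_derivative_phi[OF z u] D(1)] by (auto simp: D phi_deriv_cmult)
qed

lemma holomorphic_ball_powr:
  fixes z :: "complex^'n"
  assumes z: "norm z < 1"
  shows "holomorphic_ball (\<lambda>u. (1 - hinner u z) powr a)"
  unfolding holomorphic_ball_def
proof
  fix u :: "complex^'n" assume "u \<in> unit_ball"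
  then have u: "norm u < 1"
    by simp
  have 1: "((\<lambda>u. 1 - hinner u z) has_derivative (\<lambda>h. - hinner h z)) (at u)"
    using has_derivative_diff[OF has_derivative_const bounded_linear_imp_has_derivative[OF bounded_linear_hinner_left], of 1 z]
    by simp
  have 2: "((\<lambda>t. t powr a) has_derivative (*) (a * (1 - hinner u z) powr (a - 1))) (at (1 - hinner u z))"
    using has_field_derivative_powr[OF one_minus_hinner_not_nonpos[OF u z]] by (simp add: has_field_derivative_def)
  show "\<exists>D. ((\<lambda>u. (1 - hinner u z) powr a) has_derivative D) (at u) \<and> (\<forall>c v. D (c *s v) = c * D v)"
    using has_derivative_compose[OF 1 2] by (auto simp: hinner_cmult_left mult_ac)
qed

lemma has_derivative_vec_nth_iff:
  fixes f :: "'a::real_normed_vector \<Rightarrow> complex^'d"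
  shows "(f has_derivative D) (at z) \<longleftrightarrow> (\<forall>i. ((\<lambda>z. f z $ i) has_derivative (\<lambda>h. D h $ i)) (at z))"
proof
  assume "(f has_derivative D) (at z)"
  then show "\<forall>i. ((\<lambda>z. f z $ i) has_derivative (\<lambda>h. D h $ i)) (at z)"
    by (auto intro: bounded_linear.has_derivative[OF bounded_linear_vec_nth])
next
  assume *: "\<forall>i. ((\<lambda>z. f z $ i) has_derivative (\<lambda>h. D h $ i)) (at z)"
  have bl: "bounded_linear (\<lambda>x :: complex. (axis i x :: complex^'d))" for i
    by (intro linear_conv_bounded_linear[THEN iffD1] linearI) (simp_all add: vec_eq_iff axis_def)
  have "((\<lambda>z. \<Sum>i\<in>UNIV. axis i (f z $ i)) has_derivative (\<lambda>h. \<Sum>i\<in>UNIV. axis i (D h $ i))) (at z)"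
    using * by (intro has_derivative_sum bounded_linear.has_derivative[OF bl]) auto
  moreover have "(\<Sum>i\<in>UNIV. axis i (v $ i)) = v" for v :: "complex^'d"
    by (simp add: vec_eq_iff axis_def)
  ultimately show "(f has_derivative D) (at z)"
    by simp
qed

lemma holomorphic_vec_iff:
  fixes f :: "complex^'n \<Rightarrow> complex^'d"
  shows "holomorphic_vec f unit_ball \<longleftrightarrow> (\<forall>i. holomorphic_ball (\<lambda>z. f z $ i))"
proof
  assume f: "holomorphic_vec f unit_ball"
  show "\<forall>i. holomorphic_ball (\<lambda>z. f z $ i)"
    unfolding holomorphic_ball_def
  proof (intro allI ballI)
    fix i and z :: "complex^'n" assume "z \<in> unit_ball"
    with f obtain D where "(f has_derivative D) (at z)" "\<forall>c v. D (c *s v) = c *s D v"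
      unfolding holomorphic_vec_def by blast
    then show "\<exists>D. ((\<lambda>z. f z $ i) has_derivative D) (at z) \<and> (\<forall>c v. D (c *s v) = c * D v)"
      by (intro exI[of _ "\<lambda>h. D h $ i"]) (simp add: has_derivative_vec_nth_iff)
  qed
next
  assume *: "\<forall>i. holomorphic_ball (\<lambda>z. f z $ i)"
  show "holomorphic_vec f unit_ball"
    unfolding holomorphic_vec_def
  proof
    fix z :: "complex^'n" assume "z \<in> unit_ball"
    then have "\<forall>i. \<exists>D. ((\<lambda>z. f z $ i) has_derivative D) (at z) \<and> (\<forall>c v. D (c *s v) = c * D v)"
      using * by (simp add: holomorphic_ball_def)
    then obtain D where D: "\<And>i. ((\<lambda>z. f z $ i) has_derivative D i) (at z)" "\<And>i c v. D i (c *s v) = c * D i v"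
      by metis
    show "\<exists>D. (f has_derivative D) (at z) \<and> (\<forall>c v. D (c *s v) = c *s D v)"
      by (rule exI[of _ "\<lambda>h. \<chi> i. D i h"]) (simp add: has_derivative_vec_nth_iff D vec_eq_iff)
  qed
qed

text \<open>The complex line through the origin and \<open>w\<close> is the bridge to one variable:
  Cauchy's formula and Schwarz's lemma are applied on such slices.\<close>

lemma holomorphic_on_slice:
  fixes w :: "complex^'n"
  assumes F: "holomorphic_ball F" and S: "\<And>t. t \<in> S \<Longrightarrow> norm (t *s w) < 1"
  shows "(\<lambda>t. F (t *s w)) holomorphic_on S"
  unfolding holomorphic_on_def
proof
  fix t assume "t \<in> S"
  obtain D where D: "(F has_derivative D) (at (t *s w))" "\<And>c v. D (c *s v) = c * D v"
    using holomorphic_ballE[OF F S[OF \<open>t \<in> S\<close>]] by metis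
  have "bounded_linear (\<lambda>t. t *s w)"
    by (intro linear_conv_bounded_linear[THEN iffD1] linearI) (simp_all add: vec_eq_iff algebra_simps)
  then have "((\<lambda>t. t *s w) has_derivative (\<lambda>h. h *s w)) (at t)"
    by (rule bounded_linear_imp_has_derivative)
  from has_derivative_compose[OF this D(1)] have "((\<lambda>t. F (t *s w)) has_derivative (\<lambda>h. h * D w)) (at t)"
    by (simp add: D)
  moreover have "(\<lambda>h. h * D w) = (*) (D w)"
    by (simp add: fun_eq_iff mult.commute)
  ultimately have "((\<lambda>t. F (t *s w)) has_field_derivative D w) (at t)"
    by (simp add: has_field_derivative_def)
  then show "(\<lambda>t. F (t *s w)) field_differentiable at t within S"
    by (auto simp: field_differentiable_def intro: has_field_derivative_at_within)
qed

text \<open>Cauchy's formula at the centre of the unit circle. Continuity of the integrand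
  identifies the gauge integral with the Lebesgue integral that Fubini requires.\<close>

lemma circle_mean_value:
  fixes g :: "complex \<Rightarrow> complex"
  assumes g: "g holomorphic_on cball 0 1"
  shows "(\<integral>t. g (cis t) \<partial>lebesgue_on {0..2*pi}) = 2 * pi * g 0"
proof -
  have "((\<lambda>u. g u / (u - 0)) has_contour_integral (2 * of_real pi * \<i> * g 0)) (circlepath 0 1)"
    using g by (intro Cauchy_integral_circlepath_simple) simp_all
  then have "((\<lambda>t. g (cis t) / cis t * \<i> * cis t) has_integral (2 * of_real pi * \<i> * g 0)) {0..2*pi}"
    unfolding circlepath_def by (subst (asm) has_contour_integral_part_circlepath_iff) simp_all
  then have "((\<lambda>t. (g (cis t) * \<i>) * (- \<i>)) has_integral (2 * of_real pi * \<i> * g 0) * (- \<i>)) {0..2*pi}"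
    by (intro has_integral_mult_left) (simp add: mult_ac)
  then have hi: "((\<lambda>t. g (cis t)) has_integral (2 * pi * g 0)) {0..2*pi}"
    by (simp add: algebra_simps)
  have "continuous_on {0..2*pi} (\<lambda>t. g (cis t))"
    by (intro continuous_on_compose2[OF holomorphic_on_imp_continuous_on[OF g]] continuous_intros) auto
  then have "integrable (lebesgue_on {0..2*pi}) (\<lambda>t. g (cis t))"
    by (rule continuous_imp_integrable[of 0 "2*pi" "\<lambda>t. g (cis t)", unfolded cbox_interval])
  then show ?thesis
    using hi lebesgue_integral_eq_integral[of "{0..2*pi}" "\<lambda>t. g (cis t)"] by (simp add: integral_unique)
qed

text \<open>The rotation invariance of \<open>nu\<close> turns the integral into an average over circles.\<close>

lemma mean_value_nu:
  fixes F :: "complex^'n \<Rightarrow> complex"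
  assumes \<alpha>: "\<alpha> > - 1" and F: "holomorphic_ball F"
    and int: "integrable (nu \<alpha>) (\<lambda>w. indicator (ball 0 r) w *\<^sub>R F w)"
  shows "(\<integral>w. indicator (ball 0 r) w *\<^sub>R F w \<partial>nu \<alpha>) = measure (nu \<alpha>) (ball 0 r \<inter> unit_ball :: (complex^'n) set) *\<^sub>R F 0"
proof -
  let ?N = "nu \<alpha> :: (complex^'n) measure"
  let ?L = "lebesgue_on {0..2*pi}"
  interpret N: finite_measure ?N
    by (rule finite_measure_nu[OF \<alpha>])
  interpret L: finite_measure ?L
    by (rule finite_measureI) (simp add: emeasure_restrict_space)
  interpret P: pair_sigma_finite ?L ?N ..
  \<comment> \<open>The extension by 0 is Borel on the whole space. Joint measurability in
    \<open>(t, w)\<close> of the rotated function is then a matter of Borel maps, although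
    \<open>nu\<close> lives on Lebesgue sets.\<close>
  define G where "G w = (if w \<in> unit_ball \<inter> ball 0 r then F w else 0)" for w
  have G [measurable]: "G \<in> borel_measurable borel"
    unfolding G_def
    by (intro borel_measurable_continuous_on_if continuous_on_subset[OF continuous_on_holomorphic_ball[OF F]]
        continuous_on_const) auto
  have GF: "G w = indicator (ball 0 r) w *\<^sub>R F w" if "w \<in> space ?N" for w
    using that by (simp add: G_def)
  have Gint: "integrable ?N G"
    using int by (rule Bochner_Integration.integrable_cong[THEN iffD1, rotated 2]) (simp_all add: GF)
  have rot: "(\<lambda>w. cis t *s w) \<in> ?N \<rightarrow>\<^sub>M ?N" for t
    by (rule measurable_rotation_nu) simp
  have GN: "f \<in> borel_measurable ?N" if "f \<in> borel_measurable borel" for f :: "complex^'n \<Rightarrow> 'z::topological_space"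
    unfolding measurable_nu_iff by (rule measurable_restrict_space1, rule measurable_completion) (use that in simp)
  have rotG: "integrable ?N (\<lambda>w. f (cis t *s w))" "(\<integral>w. f (cis t *s w) \<partial>?N) = (\<integral>w. f w \<partial>?N)"
    if "integrable ?N f" for t and f :: "complex^'n \<Rightarrow> 'z::{banach, second_countable_topology}"
  proof -
    have "f \<in> borel_measurable ?N"
      using that by simp
    then show "integrable ?N (\<lambda>w. f (cis t *s w))" "(\<integral>w. f (cis t *s w) \<partial>?N) = (\<integral>w. f w \<partial>?N)"
      using that integrable_distr_eq[OF rot[of t], of f] integral_distr[OF rot[of t], of f]
      by (simp_all add: distr_rotation_nu)
  qed
  have m: "(\<lambda>(t, w). G (cis t *s w)) \<in> borel_measurable (?L \<Otimes>\<^sub>M ?N)"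
  proof -
    have f: "(\<lambda>x. fst x) \<in> ?L \<Otimes>\<^sub>M ?N \<rightarrow>\<^sub>M (borel :: real measure)"
      by (rule measurable_compose[OF measurable_fst]) (rule measurable_restrict_space1, rule measurable_completion, simp)
    have s: "(\<lambda>x. snd x) \<in> ?L \<Otimes>\<^sub>M ?N \<rightarrow>\<^sub>M (borel :: (complex^'n) measure)"
      by (rule measurable_compose[OF measurable_snd GN]) measurable
    have "(\<lambda>x. (fst x, snd x)) \<in> ?L \<Otimes>\<^sub>M ?N \<rightarrow>\<^sub>M (borel :: (real \<times> (complex^'n)) measure)"
      by (rule borel_measurable_Pair[OF f s])
    moreover have "(\<lambda>x. cis (fst x) *s snd x) \<in> borel_measurable (borel :: (real \<times> (complex^'n)) measure)"
    proof (intro borel_measurable_continuous_onI)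
      have "bounded_bilinear (\<lambda>(c::complex) (x::complex^'n). c *s x)"
        by (intro bilinear_conv_bounded_bilinear[THEN iffD1])
          (auto simp: bilinear_def vec_eq_iff algebra_simps intro!: linearI)
      then show "continuous_on UNIV (\<lambda>x :: real \<times> (complex^'n). cis (fst x) *s snd x)"
        by (rule bounded_bilinear.continuous_on) (intro continuous_intros)+
    qed
    ultimately have "(\<lambda>x. cis (fst x) *s snd x) \<in> ?L \<Otimes>\<^sub>M ?N \<rightarrow>\<^sub>M borel"
      using measurable_compose by force
    from measurable_compose[OF this G] show ?thesis
      by (simp add: split_beta')
  qed
  have I: "integrable (?L \<Otimes>\<^sub>M ?N) (\<lambda>(t, w). G (cis t *s w))"
  proof (rule P.Fubini_integrable[OF m])
    have "(\<integral>w. norm (case (t, w) of (t, w) \<Rightarrow> G (cis t *s w)) \<partial>?N) = (\<integral>w. norm (G w) \<partial>?N)" for t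
      using rotG(2)[OF integrable_norm[OF Gint], of t] by simp
    then show "integrable ?L (\<lambda>t. \<integral>w. norm (case (t, w) of (t, w) \<Rightarrow> G (cis t *s w)) \<partial>?N)"
      by simp
    show "AE t in ?L. integrable ?N (\<lambda>w. case (t, w) of (t, w) \<Rightarrow> G (cis t *s w))"
      using rotG(1)[OF Gint] by simp
  qed
  \<comment> \<open>A circle around 0 through a point of \<open>ball 0 r\<close> stays in that ball,
    and the closed disc that it bounds lies in the unit ball, so the slice is holomorphic on the
    closed disc. Outside \<open>ball 0 r\<close> the whole circle misses the support of
    \<open>G\<close>.\<close>
  have mean: "(\<integral>t. G (cis t *s w) \<partial>?L) = (2 * pi) *\<^sub>R (if w \<in> ball 0 r then F 0 else 0)" if w: "w \<in> space ?N" for w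
  proof (cases "w \<in> ball 0 r")
    case True
    have "norm (t *s w) < 1" if "t \<in> cball 0 1" for t
      using w that mult_le_less_imp_less[of "cmod t" 1 "norm w" 1] mult_left_le_one_le[of "norm w" "cmod t"]
      by (simp add: norm_vec_cmult)
    then have "(\<lambda>t. F (t *s w)) holomorphic_on cball 0 1"
      by (intro holomorphic_on_slice[OF F])
    from circle_mean_value[OF this] have "(\<integral>t. F (cis t *s w) \<partial>?L) = 2 * pi * F 0"
      by simp
    moreover have "G (cis t *s w) = F (cis t *s w)" for t
      using w True by (simp add: G_def norm_vec_cmult)
    ultimately show ?thesis
      using True by (simp add: scaleR_conv_of_real)
  next
    case False
    then have "G (cis t *s w) = 0" for t
      by (simp add: G_def norm_vec_cmult)
    then show ?thesis
      using False by simp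
  qed
  have "(2 * pi) *\<^sub>R (\<integral>w. G w \<partial>?N) = (\<integral>t. (\<integral>w. G (cis t *s w) \<partial>?N) \<partial>?L)"
    by (simp add: rotG(2)[OF Gint] measure_restrict_space)
  also have "\<dots> = (\<integral>w. (\<integral>t. G (cis t *s w) \<partial>?L) \<partial>?N)"
    by (rule P.Fubini_integral[OF I, symmetric])
  also have "\<dots> = (\<integral>w. (2 * pi) *\<^sub>R (indicator (ball 0 r \<inter> unit_ball) w *\<^sub>R F 0) \<partial>?N)"
    by (rule Bochner_Integration.integral_cong) (simp_all add: mean indicator_def)
  also have "\<dots> = (2 * pi) *\<^sub>R (\<integral>w. indicator (ball 0 r \<inter> unit_ball) w *\<^sub>R F 0 \<partial>?N)"
    by (rule integral_scaleR_right)
  also have "(\<integral>w. indicator (ball 0 r \<inter> unit_ball) w *\<^sub>R F 0 \<partial>?N) = measure ?N (ball 0 r \<inter> unit_ball) *\<^sub>R F 0"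
  proof -
    have "ball 0 r \<inter> unit_ball \<in> sets ?N"
      by (simp add: sets_nu sets_restrict_space_iff)
    moreover have "emeasure ?N (ball 0 r \<inter> unit_ball) < \<infinity>"
      using N.emeasure_finite by (metis infinity_ennreal_def less_top)
    ultimately show ?thesis
      by (subst integral_scaleR_left) (simp_all add: integrable_indicator_iff Int_absorb2)
  qed
  finally have "(\<integral>w. G w \<partial>?N) = measure ?N (ball 0 r \<inter> unit_ball) *\<^sub>R F 0"
    by (simp only: scaleR_cancel_left) simp
  also have "(\<integral>w. G w \<partial>?N) = (\<integral>w. indicator (ball 0 r) w *\<^sub>R F w \<partial>?N)"
    by (rule Bochner_Integration.integral_cong) (simp_all add: GF)
  finally show ?thesis .
qed

section \<open>Local size and oscillation of holomorphic functions\<close>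

lemma ball_Int_unit_ball_sets: "ball 0 r \<inter> unit_ball \<in> sets (nu \<alpha> :: (complex^'n) measure)"
  by (simp add: sets_nu sets_restrict_space_iff)

lemma measurable_nu_ball [measurable]:
  "Measurable.pred (nu \<alpha> :: (complex^'n) measure) (\<lambda>w. w \<in> ball 0 r)"
  unfolding pred_def using ball_Int_unit_ball_sets[of r \<alpha>, where 'n='n] by (simp add: Int_def conj_commute)

lemma measure_nu_ball_pos:
  assumes \<alpha>: "\<alpha> > - 1" and r: "r > 0"
  shows "measure (nu \<alpha>) (ball 0 r \<inter> unit_ball :: (complex^'n) set) > 0"
proof -
  let ?X = "ball 0 r \<inter> unit_ball :: (complex^'n) set"
  interpret finite_measure "nu \<alpha> :: (complex^'n) measure"
    by (rule finite_measure_nu[OF \<alpha>])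
  have "emeasure (nu \<alpha>) ?X \<noteq> 0"
  proof
    assume "emeasure (nu \<alpha>) ?X = 0"
    then have "?X \<in> null_sets (density (lebesgue_on unit_ball) (\<lambda>z. ennreal (wt \<alpha> z)))"
      using ball_Int_unit_ball_sets[of r \<alpha>, where 'n='n] by (simp add: null_sets_def nu_eq)
    then have X: "?X \<in> sets (lebesgue_on unit_ball)"
      and ae: "AE z in lebesgue_on unit_ball. z \<in> ?X \<longrightarrow> ennreal (wt \<alpha> z) = 0"
      by (subst (asm) null_sets_density_iff, simp_all)+
    have "AE z in lebesgue_on unit_ball. z \<notin> ?X"
      using ae
    proof eventually_elim
      case (elim z)
      then show ?case
        using wt_pos[OF \<alpha>, of z] by (auto simp: ennreal_eq_0_iff)
    qed
    then have "emeasure (lebesgue_on unit_ball) ?X = 0"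
      using X AE_iff_null_sets by (metis null_setsD1)
    then have "emeasure lebesgue ?X = 0"
      by (simp add: emeasure_restrict_space)
    moreover have "?X = ball 0 (min r 1)"
      by auto
    ultimately have "measure lebesgue (ball 0 (min r 1) :: (complex^'n) set) = 0"
      by (simp add: measure_def)
    then show False
      using r content_ball_gt_0_iff[of "0::complex^'n" "min r 1"] by simp
  qed
  then show ?thesis
    by (simp add: emeasure_eq_measure zero_less_measure_iff)
qed

lemma measurable_holomorphic_ball: "holomorphic_ball F \<Longrightarrow> F \<in> borel_measurable (nu \<alpha>)"
  by (intro measurable_nu_continuous continuous_on_holomorphic_ball)

text \<open>The mean value property of the holomorphic function \<open>F * F\<close>, whose modulus
  is the square of that of \<open>F\<close>.\<close>

lemma norm_center_le:
  fixes F :: "complex^'n \<Rightarrow> complex"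
  assumes \<alpha>: "\<alpha> > - 1" and F: "holomorphic_ball F"
  shows "ennreal (measure (nu \<alpha>) (ball 0 r \<inter> unit_ball :: (complex^'n) set)) * ennreal ((cmod (F 0))\<^sup>2)
    \<le> (\<integral>\<^sup>+w. indicator (ball 0 r) w * ennreal ((cmod (F w))\<^sup>2) \<partial>nu \<alpha>)" (is "_ \<le> ?R")
proof (cases "?R = \<infinity>")
  case False
  note [measurable] = measurable_holomorphic_ball[OF F]
  have eq: "ennreal (cmod (indicator (ball 0 r) w *\<^sub>R (F w * F w))) = indicator (ball 0 r) w * ennreal ((cmod (F w))\<^sup>2)" for w
    by (simp add: indicator_def norm_mult power2_eq_square)
  have int: "integrable (nu \<alpha>) (\<lambda>w. indicator (ball 0 r) w *\<^sub>R (F w * F w))"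
    using False by (intro integrableI_bounded) (simp_all only: eq less_top infinity_ennreal_def not_False_eq_True, measurable)
  have "ennreal (measure (nu \<alpha>) (ball 0 r \<inter> unit_ball :: (complex^'n) set)) * ennreal ((cmod (F 0))\<^sup>2)
    = ennreal (cmod (\<integral>w. indicator (ball 0 r) w *\<^sub>R (F w * F w) \<partial>nu \<alpha>))"
    unfolding mean_value_nu[OF \<alpha> holomorphic_ball_mult[OF F F] int]
    by (simp add: norm_mult power2_eq_square ennreal_mult)
  also have "\<dots> \<le> (\<integral>\<^sup>+w. ennreal (cmod (indicator (ball 0 r) w *\<^sub>R (F w * F w))) \<partial>nu \<alpha>)"
    using int by (intro integral_norm_bound_ennreal)
  also have "\<dots> = ?R"
    by (simp only: eq)
  finally show ?thesis .
qed simp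

text \<open>With \<open>w = phi u v\<close> the formula for
  \<open>1 - (norm (phi u v))\<^sup>2\<close> gives at least 945/1089 here, and this exceeds
  3/4.\<close>

lemma phi_small_ball:
  assumes u: "norm u < 1/4" and w: "norm w < 1" and p: "norm (phi u w) < 1/8"
  shows "norm w < 1/2"
proof -
  define v where "v = phi u w"
  have u1: "norm u < 1"
    using u by simp
  have v1: "norm v < 1"
    using p by (simp add: v_def)
  have wv: "w = phi u v"
    by (simp add: v_def phi_phi u1 w)
  have "cmod (hinner v u) \<le> 1/8 * (1/4)"
    using norm_hinner_le[of v u] mult_mono[of "norm v" "1/8" "norm u" "1/4"] p u by (simp add: v_def)
  then have t: "cmod (1 - hinner v u) \<le> 33/32"
    using norm_triangle_ineq4[of 1 "hinner v u"] by simp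
  have t0: "cmod (1 - hinner v u) > 0"
    using one_minus_hinner_nz[OF v1 u1] by simp
  have nu: "(norm u)\<^sup>2 \<le> (1/4)\<^sup>2" and nv: "(norm v)\<^sup>2 \<le> (1/8)\<^sup>2"
    using u p by (intro power_mono; simp add: v_def)+
  have "15/16 * (63/64) \<le> (1 - (norm u)\<^sup>2) * (1 - (norm v)\<^sup>2)"
    using nu nv by (intro mult_mono) (auto simp: power2_eq_square)
  moreover have "(cmod (1 - hinner v u))\<^sup>2 \<le> (33/32)\<^sup>2"
    using t by (intro power_mono) auto
  ultimately have "15/16 * (63/64) / (33/32)\<^sup>2 \<le> (1 - (norm u)\<^sup>2) * (1 - (norm v)\<^sup>2) / (cmod (1 - hinner v u))\<^sup>2"
    using t0 by (intro frac_le) auto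
  also have "\<dots> = 1 - (norm w)\<^sup>2"
    unfolding wv by (rule one_minus_norm_phi[OF u1 v1, symmetric])
  finally have "(norm w)\<^sup>2 < (1/2)\<^sup>2"
    by (simp add: power2_eq_square)
  then show ?thesis
    by (rule power2_less_imp_less) simp
qed

text \<open>Mean values control only the centre, so \<open>phi u\<close> recentres at
  \<open>u\<close>. The ball of radius 1/8 in the new coordinates lies in
  \<open>ball 0 (1/2)\<close> by \<open>phi_small_ball\<close>, and there the density of the
  substitution is at most \<open>2 powr l\<close>, because \<open>cmod (1 - hinner w u)\<close> is
  at least 7/8.\<close>

lemma local_norm_bound:
  assumes \<alpha>: "\<alpha> > - 1"
  obtains C where "C > 0" "\<And>F u. holomorphic_ball F \<Longrightarrow> norm u < 1/4 \<Longrightarrow>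
    ennreal ((cmod (F u))\<^sup>2) \<le> ennreal C * (\<integral>\<^sup>+w. indicator (ball 0 (1/2)) w * ennreal ((cmod (F w))\<^sup>2) \<partial>(nu \<alpha> :: (complex^'n) measure))"
proof -
  define l where "l = real CARD('n) + 1 + \<alpha>"
  define m where "m = measure (nu \<alpha>) (ball 0 (1/8) \<inter> unit_ball :: (complex^'n) set)"
  have m: "m > 0"
    unfolding m_def by (rule measure_nu_ball_pos[OF \<alpha>]) simp
  have l: "l \<ge> 0"
    using \<alpha> by (simp add: l_def)
  have "ennreal ((cmod (F u))\<^sup>2) \<le> ennreal (2 powr l / m) *
      (\<integral>\<^sup>+w. indicator (ball 0 (1/2)) w * ennreal ((cmod (F w))\<^sup>2) \<partial>nu \<alpha>)"
    if F: "holomorphic_ball F" and u: "norm u < 1/4" for F and u :: "complex^'n"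
  proof -
    have u1: "norm u < 1"
      using u by simp
    note [measurable] = measurable_holomorphic_ball[OF F]
    let ?I = "\<integral>\<^sup>+w. indicator (ball 0 (1/2)) w * ennreal ((cmod (F w))\<^sup>2) \<partial>nu \<alpha>"
    have pm: "(\<lambda>w. indicator (ball 0 (1/8)) (phi u w) * ennreal ((cmod (F w))\<^sup>2)) \<in> borel_measurable (nu \<alpha>)"
      using measurable_phi_nu[OF u1, of \<alpha>] by measurable
    have "ennreal m * ennreal ((cmod (F u))\<^sup>2) \<le> (\<integral>\<^sup>+v. indicator (ball 0 (1/8)) v * ennreal ((cmod (F (phi u v)))\<^sup>2) \<partial>nu \<alpha>)"
      using norm_center_le[OF \<alpha> holomorphic_ball_comp_phi[OF F u1], of "1/8"] by (simp add: m_def)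
    also have "\<dots> = (\<integral>\<^sup>+v. indicator (ball 0 (1/8)) (phi u (phi u v)) * ennreal ((cmod (F (phi u v)))\<^sup>2) \<partial>nu \<alpha>)"
      by (rule nn_integral_cong) (simp add: phi_phi u1)
    also have "\<dots> = (\<integral>\<^sup>+w. indicator (ball 0 (1/8)) (phi u w) * ennreal ((cmod (F w))\<^sup>2) * ennreal ((cmod (kern \<alpha> u w))\<^sup>2) \<partial>nu \<alpha>)"
      by (rule nn_integral_nu_phi'[OF u1 pm])
    also have "\<dots> \<le> (\<integral>\<^sup>+w. ennreal (2 powr l) * (indicator (ball 0 (1/2)) w * ennreal ((cmod (F w))\<^sup>2)) \<partial>nu \<alpha>)"
    proof (rule nn_integral_mono)
      fix w :: "complex^'n" assume "w \<in> space (nu \<alpha>)"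
      then have w: "norm w < 1"
        by simp
      show "indicator (ball 0 (1/8)) (phi u w) * ennreal ((cmod (F w))\<^sup>2) * ennreal ((cmod (kern \<alpha> u w))\<^sup>2)
        \<le> ennreal (2 powr l) * (indicator (ball 0 (1/2)) w * ennreal ((cmod (F w))\<^sup>2))"
      proof (cases "norm (phi u w) < 1/8")
        case True
        then have w2: "norm w < 1/2"
          by (rule phi_small_ball[OF u w])
        have "cmod (hinner w u) \<le> 1/2 * (1/4)"
          using norm_hinner_le[of w u] mult_mono[of "norm w" "1/2" "norm u" "1/4"] w2 u by simp
        then have t: "7/8 \<le> cmod (1 - hinner w u)"
          using norm_triangle_ineq2[of 1 "hinner w u"] by simp
        have "(1 - (norm u)\<^sup>2) / (cmod (1 - hinner w u))\<^sup>2 \<le> 1 / (7/8)\<^sup>2"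
          using t one_minus_norm2_pos[OF u1] by (intro frac_le power_mono) auto
        also have "\<dots> \<le> 2"
          by (simp add: power2_eq_square)
        finally have "(cmod (kern \<alpha> u w))\<^sup>2 \<le> 2 powr l"
          unfolding norm_kern_squared[OF u1 w] l_def[symmetric]
          using one_minus_norm2_pos[OF u1] by (intro powr_mono2 l) auto
        then have "ennreal ((cmod (F w))\<^sup>2) * ennreal ((cmod (kern \<alpha> u w))\<^sup>2) \<le> ennreal ((cmod (F w))\<^sup>2) * ennreal (2 powr l)"
          by (intro mult_left_mono ennreal_leI) auto
        then show ?thesis
          using True w2 by (simp add: mult.commute)
      qed simp
    qed
    also have "\<dots> = ennreal (2 powr l) * ?I"
      by (rule nn_integral_cmult) measurable
    finally have "ennreal (1 / m) * (ennreal m * ennreal ((cmod (F u))\<^sup>2)) \<le> ennreal (1 / m) * (ennreal (2 powr l) * ?I)"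
      by (rule mult_left_mono) simp
    moreover have "ennreal (1 / m) * ennreal m = 1"
      using m by (simp add: ennreal_mult'[symmetric])
    moreover have "ennreal (1 / m) * ennreal (2 powr l) = ennreal (2 powr l / m)"
      using m by (simp add: ennreal_mult'[symmetric])
    ultimately show ?thesis
      by (simp only: mult.assoc[symmetric] mult_1_left)
  qed
  then show ?thesis
    using m by (intro that[of "2 powr l / m"]) auto
qed

text \<open>Schwarz's lemma on the complex line through \<open>u\<close>. Rescaling the disc of
  radius 1/4 to the unit disc costs a factor 4, and bounding \<open>F - F 0\<close> by
  \<open>2 * S\<close> a factor 2.\<close>

lemma schwarz_ball:
  assumes F: "holomorphic_ball F" and S: "\<And>v. norm v < 1/4 \<Longrightarrow> cmod (F v) \<le> S" and u: "norm u < 1/4"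
  shows "cmod (F u - F 0) \<le> 8 * norm u * S"
proof (cases "u = 0")
  case False
  have S0: "S \<ge> 0"
    using S[of 0] norm_ge_zero[of "F 0"] by (simp del: norm_ge_zero)
  \<comment> \<open>The slack \<open>d\<close> makes the normalised slice strictly smaller than 1,
    also when \<open>S = 0\<close>; it is removed at the end.\<close>
  have "cmod (F u - F 0) \<le> 4 * norm u * (2 * S + d)" if d: "d > 0" for d
  proof -
    define e where "e = of_real (1 / (4 * norm u)) *s u"
    define G where "G t = (F (t *s e) - F 0) / of_real (2 * S + d)" for t
    have ne: "norm e = 1/4"
      using False by (simp add: e_def norm_vec_cmult norm_divide norm_mult)
    have nz: "complex_of_real (2 * S + d) \<noteq> 0"
      unfolding of_real_eq_0_iff using S0 d by simp
    have "(\<lambda>t. F (t *s e)) holomorphic_on ball 0 1"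
      by (rule holomorphic_on_slice[OF F]) (simp add: norm_vec_cmult ne)
    then have "G holomorphic_on ball 0 1"
      unfolding G_def by (intro holomorphic_intros nz)
    moreover have "G 0 = 0"
      by (simp add: G_def)
    moreover have "norm (G t) < 1" if "norm t < 1" for t
    proof -
      have "cmod (F (t *s e) - F 0) \<le> 2 * S"
        using S[of "t *s e"] S[of 0] norm_triangle_ineq4[of "F (t *s e)" "F 0"] that
        by (simp add: norm_vec_cmult ne)
      then show ?thesis
        using S0 d by (simp add: G_def norm_divide del: of_real_add of_real_mult)
    qed
    moreover have "norm (complex_of_real (4 * norm u)) < 1"
      using u by (simp del: of_real_mult)
    ultimately have "norm (G (of_real (4 * norm u))) \<le> norm (complex_of_real (4 * norm u))"
      by (rule Schwarz_Lemma(1))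
    moreover have "of_real (4 * norm u) *s e = u"
      using False by (simp add: e_def vec_eq_iff)
    ultimately have "cmod (F u - F 0) / (2 * S + d) \<le> 4 * norm u"
      using S0 d by (simp add: G_def norm_divide del: of_real_add of_real_mult)
    then show ?thesis
      using S0 d by (simp add: divide_le_eq)
  qed
  then have "cmod (F u - F 0) - 8 * norm u * S \<le> d" if "d > 0" for d
  proof -
    have n: "norm u > 0"
      using False by simp
    then have "cmod (F u - F 0) \<le> 4 * norm u * (2 * S + d / (4 * norm u))"
      using that by (intro \<open>\<And>d. d > 0 \<Longrightarrow> cmod (F u - F 0) \<le> 4 * norm u * (2 * S + d)\<close>) simp
    also have "\<dots> = 8 * norm u * S + d"
      using n by (simp add: algebra_simps)
    finally show ?thesis
      by simp
  qed
  then show ?thesis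
    by (meson diff_le_0_iff_le dense_le le_cases not_le field_le_epsilon add_0)
qed simp

lemma norm_vec_squared: "(norm (x :: complex^'d))\<^sup>2 = (\<Sum>i\<in>UNIV. (cmod (x $ i))\<^sup>2)"
  by (simp add: norm_vec_def L2_set_def sum_nonneg)

lemma measurable_holomorphic_vec:
  fixes f :: "complex^'n \<Rightarrow> complex^'d"
  assumes "holomorphic_vec f unit_ball"
  shows "f \<in> borel_measurable (nu \<alpha>)"
proof (rule measurable_nu_continuous, rule continuous_at_imp_continuous_on, rule ballI)
  fix z :: "complex^'n" assume "z \<in> unit_ball"
  with assms obtain D where "(f has_derivative D) (at z)"
    unfolding holomorphic_vec_def by blast
  then show "isCont f z"
    by (rule has_derivative_continuous)
qed

text \<open>The mass of \<open>f\<close> on the Bergman ball of radius 1/2 around \<open>w\<close>,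
  in the coordinates centred at \<open>w\<close>. This radius stays fixed while the averaging radius
  shrinks.\<close>

definition local_mass :: "real \<Rightarrow> (complex^'n \<Rightarrow> complex^'d) \<Rightarrow> complex^'n \<Rightarrow> ennreal" where
  "local_mass \<alpha> f w = (\<integral>\<^sup>+v. indicator (ball 0 (1/2)) v * ennreal ((norm (f (phi w v)))\<^sup>2) \<partial>nu \<alpha>)"

text \<open>The components of \<open>f\<close> composed with \<open>phi w\<close> are holomorphic on
  the ball and take the value of \<open>f w\<close> at 0, so both bounds are statements at the
  origin and their constant does not depend on \<open>w\<close>. The factor 64 is the square of the
  8 in \<open>schwarz_ball\<close>.\<close>

lemma local_mass_bounds:
  assumes \<alpha>: "\<alpha> > - 1"
  obtains C where "C > 0"
    "\<And>f w u. holomorphic_vec f unit_ball \<Longrightarrow> norm w < 1 \<Longrightarrow> norm u < 1/4 \<Longrightarrow>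
      ennreal ((norm (f (phi w u) :: complex^'d))\<^sup>2) \<le> ennreal C * local_mass \<alpha> f (w :: complex^'n)"
    "\<And>f w u. holomorphic_vec f unit_ball \<Longrightarrow> norm w < 1 \<Longrightarrow> norm u < 1/4 \<Longrightarrow>
      ennreal ((norm (f (phi w u) - f w :: complex^'d))\<^sup>2) \<le> ennreal (C * (norm u)\<^sup>2) * local_mass \<alpha> f (w :: complex^'n)"
proof -
  obtain C where C: "C > 0" and bound: "\<And>F u. holomorphic_ball F \<Longrightarrow> norm u < 1/4 \<Longrightarrow>
    ennreal ((cmod (F u))\<^sup>2) \<le> ennreal C * (\<integral>\<^sup>+w. indicator (ball 0 (1/2)) w * ennreal ((cmod (F w))\<^sup>2) \<partial>(nu \<alpha> :: (complex^'n) measure))"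
    using local_norm_bound[OF \<alpha>, where 'n='n] by blast
  have diff: "ennreal ((cmod (F u - F 0))\<^sup>2) \<le> ennreal (64 * C * (norm u)\<^sup>2) *
      (\<integral>\<^sup>+w. indicator (ball 0 (1/2)) w * ennreal ((cmod (F w))\<^sup>2) \<partial>nu \<alpha>)" (is "_ \<le> _ * ?I")
    if F: "holomorphic_ball F" and u: "norm u < 1/4" for F and u :: "complex^'n"
  proof (cases "u = 0 \<or> ?I = top")
    \<comment> \<open>For \<open>u = 0\<close> the left side vanishes; otherwise the coefficient is
      positive and an infinite integral makes the right side infinite.\<close>
    case True
    then show ?thesis
      using C by (auto simp: ennreal_mult_top)
  next
    case False
    then obtain i where i: "?I = ennreal i" "i \<ge> 0"
      by (cases "?I") auto
    have "cmod (F v) \<le> sqrt (C * i)" if "norm v < 1/4" for v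
    proof -
      have "ennreal ((cmod (F v))\<^sup>2) \<le> ennreal (C * i)"
        using bound[OF F that] C i by (simp add: ennreal_mult)
      then show ?thesis
        using C i by (intro real_le_rsqrt) (simp add: ennreal_le_iff)
    qed
    from schwarz_ball[OF F this u] have "(cmod (F u - F 0))\<^sup>2 \<le> (8 * norm u * sqrt (C * i))\<^sup>2"
      by (intro power_mono) auto
    also have "\<dots> = 64 * C * (norm u)\<^sup>2 * i"
      using C i by (simp add: power_mult_distrib)
    finally show ?thesis
      using C i by (simp add: ennreal_mult[symmetric] ennreal_leI)
  qed
  have mass: "local_mass \<alpha> f w = (\<Sum>i\<in>UNIV. \<integral>\<^sup>+v. indicator (ball 0 (1/2)) v * ennreal ((cmod (f (phi w v) $ i))\<^sup>2) \<partial>nu \<alpha>)"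
    if f: "holomorphic_vec f unit_ball" and w: "norm w < 1" for f :: "complex^'n \<Rightarrow> complex^'d" and w
  proof -
    have [measurable]: "(\<lambda>v. f (phi w v) $ i) \<in> borel_measurable (nu \<alpha>)" for i
      using f unfolding holomorphic_vec_iff
      by (intro measurable_holomorphic_ball holomorphic_ball_comp_phi[OF _ w, of "\<lambda>z. f z $ i"]) simp
    have "local_mass \<alpha> f w = (\<integral>\<^sup>+v. (\<Sum>i\<in>UNIV. indicator (ball 0 (1/2)) v * ennreal ((cmod (f (phi w v) $ i))\<^sup>2)) \<partial>nu \<alpha>)"
      unfolding local_mass_def norm_vec_squared
      by (intro nn_integral_cong) (simp add: sum_distrib_left[symmetric] sum_ennreal[symmetric] del: sum_ennreal)
    also have "\<dots> = (\<Sum>i\<in>UNIV. \<integral>\<^sup>+v. indicator (ball 0 (1/2)) v * ennreal ((cmod (f (phi w v) $ i))\<^sup>2) \<partial>nu \<alpha>)"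
      by (rule nn_integral_sum) measurable
    finally show ?thesis .
  qed
  have comp: "holomorphic_ball (\<lambda>v. f (phi w v) $ i)"
    if f: "holomorphic_vec f unit_ball" and w: "norm w < 1" for f :: "complex^'n \<Rightarrow> complex^'d" and w i
    using f unfolding holomorphic_vec_iff
    by (intro holomorphic_ball_comp_phi[OF _ w, of "\<lambda>z. f z $ i"]) simp
  show ?thesis
  proof (rule that[of "64 * C"])
    fix f :: "complex^'n \<Rightarrow> complex^'d" and w u :: "complex^'n"
    assume f: "holomorphic_vec f unit_ball" and w: "norm w < 1" and u: "norm u < 1/4"
    have "ennreal ((norm (f (phi w u)))\<^sup>2) = (\<Sum>i\<in>UNIV. ennreal ((cmod (f (phi w u) $ i))\<^sup>2))"
      unfolding norm_vec_squared by simp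
    also have "\<dots> \<le> (\<Sum>i\<in>UNIV. ennreal C * (\<integral>\<^sup>+v. indicator (ball 0 (1/2)) v * ennreal ((cmod (f (phi w v) $ i))\<^sup>2) \<partial>nu \<alpha>))"
      by (intro sum_mono bound[OF comp[OF f w] u])
    also have "\<dots> = ennreal C * local_mass \<alpha> f w"
      by (simp add: mass[OF f w] sum_distrib_left)
    also have "\<dots> \<le> ennreal (64 * C) * local_mass \<alpha> f w"
      using C by (intro mult_right_mono ennreal_leI) auto
    finally show "ennreal ((norm (f (phi w u)))\<^sup>2) \<le> ennreal (64 * C) * local_mass \<alpha> f w" .
    have "ennreal ((norm (f (phi w u) - f w))\<^sup>2) = (\<Sum>i\<in>UNIV. ennreal ((cmod (f (phi w u) $ i - f (phi w 0) $ i))\<^sup>2))"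
      unfolding norm_vec_squared by simp
    also have "\<dots> \<le> (\<Sum>i\<in>UNIV. ennreal (64 * C * (norm u)\<^sup>2) * (\<integral>\<^sup>+v. indicator (ball 0 (1/2)) v * ennreal ((cmod (f (phi w v) $ i))\<^sup>2) \<partial>nu \<alpha>))"
      by (intro sum_mono diff[OF comp[OF f w] u])
    also have "\<dots> = ennreal (64 * C * (norm u)\<^sup>2) * local_mass \<alpha> f w"
      by (simp add: mass[OF f w] sum_distrib_left)
    finally show "ennreal ((norm (f (phi w u) - f w))\<^sup>2) \<le> ennreal (64 * C * (norm u)\<^sup>2) * local_mass \<alpha> f w" .
  qed (use C in simp)
qed

section \<open>The kernel and its reproducing property\<close>

lemma cnj_Kern:
  assumes "norm z < 1" "norm w < 1"
  shows "cnj (Kern \<alpha> z w) = Kern \<alpha> w (z :: complex^'n)"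
proof -
  have "cnj (exp (- of_real (real CARD('n) + 1 + \<alpha>) * Ln (1 - hinner w z)))
      = exp (- of_real (real CARD('n) + 1 + \<alpha>) * Ln (cnj (1 - hinner w z)))"
    using cnj_Ln[OF one_minus_hinner_not_nonpos[OF assms(2,1)]] by (simp add: exp_cnj)
  then show ?thesis
    using one_minus_hinner_nz[OF assms] one_minus_hinner_nz[OF assms(2,1)]
    by (simp add: Kern_def powr_def cnj_hinner)
qed

lemma norm_Kern_le:
  fixes z w :: "complex^'n"
  assumes \<alpha>: "\<alpha> > - 1" and z: "norm z \<le> r" and r: "r < 1" and w: "norm w < 1"
  shows "cmod (Kern \<alpha> z w) \<le> (1 - r) powr (- (real CARD('n) + 1 + \<alpha>))"
proof -
  have "cmod (hinner w z) \<le> norm w * norm z"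
    by (rule norm_hinner_le)
  also have "\<dots> \<le> 1 * r"
    using z w by (intro mult_mono) auto
  finally have "1 - r \<le> cmod (1 - hinner w z)"
    using norm_triangle_ineq2[of 1 "hinner w z"] by simp
  then show ?thesis
    unfolding norm_Kern using r \<alpha> by (intro powr_mono2') auto
qed

text \<open>With \<open>a = 1 - (norm z)\<^sup>2\<close>, \<open>t = 1 - hinner u z\<close> and
  \<open>l\<close> the exponent, the left side is \<open>(a / (cmod t)\<^sup>2) powr l\<close> times
  the power \<open>- l\<close> of \<open>a / cnj t\<close>, formally the power \<open>- l\<close> of
  \<open>t\<close>. Since complex powers are not multiplicative in general, this is verified on
  logarithms, using that \<open>t\<close> lies in the right half-plane.\<close>

lemma kern_mult_Kern_phi:
  fixes z u :: "complex^'n"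
  assumes z: "norm z < 1" and u: "norm u < 1"
  shows "of_real ((cmod (kern \<alpha> z u))\<^sup>2) * cnj (Kern \<alpha> z (phi z u)) = Kern \<alpha> z u"
proof -
  define l where "l = real CARD('n) + 1 + \<alpha>"
  define t where "t = 1 - hinner u z"
  define a where "a = 1 - (norm z)\<^sup>2"
  have a: "a > 0"
    using one_minus_norm2_pos[OF z] by (simp add: a_def)
  have t: "t \<noteq> 0" "t \<notin> \<real>\<^sub>\<le>\<^sub>0"
    using one_minus_hinner_nz[OF u z] one_minus_hinner_not_nonpos[OF u z] by (simp_all add: t_def)
  have Ln: "Ln (of_real a / t) = of_real (ln a) - Ln t"
    using a t by (simp add: divide_inverse Ln_times_of_real Ln_inverse Ln_of_real)
  have cn: "cnj (Ln t) = 2 * of_real (ln (cmod t)) - Ln t"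
  proof -
    have "Ln t + cnj (Ln t) = of_real (2 * Re (Ln t))"
      by (rule complex_add_cnj)
    then show ?thesis
      using t by (simp add: Re_Ln eq_diff_eq add.commute)
  qed
  have "Kern \<alpha> z (phi z u) = exp (- of_real l * (of_real (ln a) - Ln t))"
    using a t by (simp add: Kern_def one_minus_hinner_phi[OF z u, folded a_def t_def] l_def[symmetric] powr_def Ln)
  then have "cnj (Kern \<alpha> z (phi z u)) = exp (- of_real l * (of_real (ln a) - cnj (Ln t)))"
    by (simp add: exp_cnj)
  moreover have "(cmod (kern \<alpha> z u))\<^sup>2 = exp (l * (ln a - 2 * ln (cmod t)))"
    using a t by (simp add: norm_kern_squared[OF z u] l_def[symmetric] a_def[symmetric] t_def[symmetric] powr_def ln_div ln_realpow)
  then have "complex_of_real ((cmod (kern \<alpha> z u))\<^sup>2) = exp (of_real l * (of_real (ln a) - 2 * of_real (ln (cmod t))))"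
    by (simp only: exp_of_real[symmetric] of_real_mult of_real_diff of_real_numeral)
  ultimately have "of_real ((cmod (kern \<alpha> z u))\<^sup>2) * cnj (Kern \<alpha> z (phi z u))
      = exp (of_real l * (of_real (ln a) - 2 * of_real (ln (cmod t))) + - of_real l * (of_real (ln a) - cnj (Ln t)))"
    by (simp only: exp_add)
  also have "\<dots> = exp (- of_real l * Ln t)"
    unfolding cn by (simp add: algebra_simps)
  also have "\<dots> = Kern \<alpha> z u"
    using t by (simp add: Kern_def t_def[symmetric] l_def[symmetric] powr_def)
  finally show ?thesis .
qed

lemma measurable_cnj_Kern: "norm z < 1 \<Longrightarrow> (\<lambda>w. cnj (Kern \<alpha> z w)) \<in> borel_measurable (nu \<alpha>)"
  by (intro measurable_nu_continuous continuous_on_cnj continuous_on_Kern)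

lemma integrable_Kern_mult:
  fixes q :: "complex^'n \<Rightarrow> complex"
  assumes \<alpha>: "\<alpha> > - 1" and q: "integrable (nu \<alpha>) q" and z: "norm z < 1"
  shows "integrable (nu \<alpha>) (\<lambda>w. cnj (Kern \<alpha> z w) * q w)"
proof (rule Bochner_Integration.integrable_bound)
  let ?c = "(1 - norm z) powr (- (real CARD('n) + 1 + \<alpha>))"
  show "integrable (nu \<alpha>) (\<lambda>w. ?c * norm (q w))"
    using q by simp
  show "(\<lambda>w. cnj (Kern \<alpha> z w) * q w) \<in> borel_measurable (nu \<alpha>)"
    by (intro borel_measurable_times measurable_cnj_Kern z borel_measurable_integrable q)
  show "AE w in nu \<alpha>. norm (cnj (Kern \<alpha> z w) * q w) \<le> norm (?c * norm (q w))"
    using norm_Kern_le[OF \<alpha> order_refl z] by (intro AE_I2) (auto simp: norm_mult intro!: mult_right_mono)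
qed

text \<open>The substitution \<open>phi z\<close> turns the integral into the mean of a holomorphic function.\<close>

theorem reproducing:
  fixes F :: "complex^'n \<Rightarrow> complex"
  assumes \<alpha>: "\<alpha> > - 1" and F: "holomorphic_ball F" and int: "integrable (nu \<alpha>) F" and z: "norm z < 1"
  shows "(\<integral>w. cnj (Kern \<alpha> z w) * F w \<partial>nu \<alpha>) = F z"
proof -
  \<comment> \<open>By \<open>kern_mult_Kern_phi\<close> the density of the substitution times the
    conjugated kernel is again holomorphic in \<open>u\<close>. At 0 it equals 1, so
    \<open>G 0\<close> is \<open>F z\<close>.\<close>
  define G where "G u = Kern \<alpha> z u * F (phi z u)" for u
  have G: "holomorphic_ball G"
    unfolding G_def Kern_def by (intro holomorphic_ball_mult holomorphic_ball_powr holomorphic_ball_comp_phi F z)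
  have m: "(\<lambda>w. cnj (Kern \<alpha> z w) * F w) \<in> borel_measurable (nu \<alpha>)"
    by (intro borel_measurable_times measurable_cnj_Kern z measurable_holomorphic_ball F)
  have eq: "(cmod (kern \<alpha> z u))\<^sup>2 *\<^sub>R (cnj (Kern \<alpha> z (phi z u)) * F (phi z u)) = G u" if "u \<in> space (nu \<alpha>)" for u
    using kern_mult_Kern_phi[OF z, of u \<alpha>] that
    by (simp add: G_def scaleR_conv_of_real mult.assoc[symmetric])
  have "integrable (nu \<alpha>) (\<lambda>u. (cmod (kern \<alpha> z u))\<^sup>2 *\<^sub>R (cnj (Kern \<alpha> z (phi z u)) * F (phi z u)))"
    using integral_nu_phi(2)[OF z m] integrable_Kern_mult[OF \<alpha> int z] by simp
  then have Gi: "integrable (nu \<alpha>) (\<lambda>u. indicator (ball 0 1) u *\<^sub>R G u)"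
    by (rule Bochner_Integration.integrable_cong[THEN iffD1, rotated 2]) (simp_all add: eq)
  have "(\<integral>w. cnj (Kern \<alpha> z w) * F w \<partial>nu \<alpha>) = (\<integral>u. (cmod (kern \<alpha> z u))\<^sup>2 *\<^sub>R (cnj (Kern \<alpha> z (phi z u)) * F (phi z u)) \<partial>nu \<alpha>)"
    by (rule integral_nu_phi(1)[OF z m, symmetric])
  also have "\<dots> = (\<integral>u. indicator (ball 0 1) u *\<^sub>R G u \<partial>nu \<alpha>)"
    by (rule Bochner_Integration.integral_cong) (simp_all add: eq)
  also have "\<dots> = G 0"
    unfolding mean_value_nu[OF \<alpha> G Gi] by (simp add: measure_nu_space[OF \<alpha>])
  also have "\<dots> = F z"
    by (simp add: G_def Kern_def)
  finally show ?thesis .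
qed

section \<open>The Bergman projection\<close>

lemma continuous_on_smult:
  assumes "continuous_on S f" "continuous_on S g"
  shows "continuous_on S (\<lambda>x. (f x :: complex) *s (g x :: complex^'d))"
proof -
  have "bounded_bilinear (\<lambda>(c::complex) (x::complex^'d). c *s x)"
    by (intro bilinear_conv_bounded_bilinear[THEN iffD1])
      (auto simp: bilinear_def vec_eq_iff algebra_simps intro!: linearI)
  then show ?thesis
    using bounded_bilinear.continuous_on assms by blast
qed

lemma measurable_smult [measurable]:
  assumes "f \<in> borel_measurable M" "g \<in> borel_measurable M"
  shows "(\<lambda>x. (f x :: complex) *s (g x :: complex^'d)) \<in> borel_measurable M"
  using assms by (rule borel_measurable_continuous_Pair)
    (intro continuous_on_smult continuous_intros)

lemma measurable_hinner [measurable]: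
  assumes "f \<in> borel_measurable M" "g \<in> borel_measurable M"
  shows "(\<lambda>x. hinner (f x :: complex^'d) (g x)) \<in> borel_measurable M"
  using assms by (rule borel_measurable_continuous_Pair)
    (unfold hinner_def, intro continuous_intros)

text \<open>The Bergman projection as an integral operator on all integrable functions. The value 0
  off the ball is the convention of \<open>A2\<close>, so that the reproducing formula can be an
  equality of functions.\<close>

definition bproj :: "real \<Rightarrow> (complex^'n \<Rightarrow> complex^'d) \<Rightarrow> complex^'n \<Rightarrow> complex^'d" where
  "bproj \<alpha> q z = (if z \<in> unit_ball then \<integral>w. cnj (Kern \<alpha> z w) *s q w \<partial>nu \<alpha> else 0)"

lemma toeplitz_int_eq_bproj: "toeplitz_int \<alpha> b f = bproj \<alpha> (\<lambda>w. blinfun_apply (b w) (f w))"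
  by (simp add: fun_eq_iff toeplitz_int_def bproj_def)

lemma integrable_Kern_smult:
  fixes q :: "complex^'n \<Rightarrow> complex^'d"
  assumes \<alpha>: "\<alpha> > - 1" and q: "integrable (nu \<alpha>) q" and z: "norm z < 1"
  shows "integrable (nu \<alpha>) (\<lambda>w. cnj (Kern \<alpha> z w) *s q w)"
proof (rule Bochner_Integration.integrable_bound)
  let ?c = "(1 - norm z) powr (- (real CARD('n) + 1 + \<alpha>))"
  show "integrable (nu \<alpha>) (\<lambda>w. ?c * norm (q w))"
    using q by simp
  show "(\<lambda>w. cnj (Kern \<alpha> z w) *s q w) \<in> borel_measurable (nu \<alpha>)"
    by (intro measurable_smult measurable_cnj_Kern z borel_measurable_integrable q)
  show "AE w in nu \<alpha>. norm (cnj (Kern \<alpha> z w) *s q w) \<le> norm (?c * norm (q w))"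
    using norm_Kern_le[OF \<alpha> order_refl z] by (intro AE_I2) (auto simp: norm_vec_cmult intro!: mult_right_mono)
qed

lemma integrable_nth:
  fixes q :: "'a \<Rightarrow> complex^'d"
  shows "integrable M q \<Longrightarrow> integrable M (\<lambda>w. q w $ i)"
  by (rule integrable_bounded_linear[OF bounded_linear_vec_nth])

lemma bproj_nth:
  fixes q :: "complex^'n \<Rightarrow> complex^'d"
  assumes \<alpha>: "\<alpha> > - 1" and q: "integrable (nu \<alpha>) q" and z: "norm z < 1"
  shows "bproj \<alpha> q z $ i = (\<integral>w. cnj (Kern \<alpha> z w) * (q w $ i) \<partial>nu \<alpha>)"
  using integral_bounded_linear[OF bounded_linear_vec_nth integrable_Kern_smult[OF \<alpha> q z], of i] z
  by (simp add: bproj_def)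

section \<open>Holomorphy of integrals against the kernel\<close>

text \<open>First order Taylor expansion with a remainder uniform on a disc of radius below 1. The
  quadratic error, uniform in the integration variable, is what justifies differentiation under the
  integral sign below.\<close>

lemma powr_one_minus_Taylor:
  fixes l r :: real
  assumes r: "r < 1"
  obtains B where "B \<ge> 0" "\<And>x y. cmod x \<le> r \<Longrightarrow> cmod y \<le> r \<Longrightarrow>
    cmod ((1 - x) powr (- of_real l) - (1 - y) powr (- of_real l) - of_real l * (1 - y) powr (- of_real l - 1) * (x - y))
      \<le> B * (cmod (x - y))\<^sup>2"
proof -
  \<comment> \<open>\<open>f i\<close> is the \<open>i\<close>-th derivative of \<open>f 0\<close>:
    the sign of the exponent and the inner derivative \<open>- 1\<close> cancel, so rising
    factorials appear.\<close>
  define f where "f i x = pochhammer (complex_of_real l) i * (1 - x) powr (- of_real l - of_nat i)" for i x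
  have np: "1 - x \<notin> \<real>\<^sub>\<le>\<^sub>0" if "cmod x \<le> r" for x
    using complex_Re_le_cmod[of x] that r by (auto simp: complex_nonpos_Reals_iff)
  have der: "(f i has_field_derivative f (Suc i) x) (at x within cball 0 r)" if "x \<in> cball 0 r" for i x
  proof -
    have "((\<lambda>x. 1 - x) has_field_derivative - 1) (at x)"
      by (auto intro!: derivative_eq_intros)
    from DERIV_chain2[OF has_field_derivative_powr[OF np] this] that
    have "((\<lambda>x. (1 - x) powr a) has_field_derivative a * (1 - x) powr (a - 1) * - 1) (at x)" for a
      by simp
    from DERIV_cmult[OF this[of "- of_real l - of_nat i"], of "pochhammer (complex_of_real l) i"]
    have "(f i has_field_derivative f (Suc i) x) (at x)"
      unfolding f_def by (simp add: pochhammer_Suc algebra_simps)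
    then show ?thesis
      by (rule has_field_derivative_at_within)
  qed
  \<comment> \<open>The sign of \<open>- l - 2\<close> is not fixed, so the power is bounded by its
    larger value at the two extremes \<open>1 - r\<close> and \<open>1 + r\<close> of
    \<open>cmod (1 - x)\<close>.\<close>
  define B where "B = cmod (pochhammer (complex_of_real l) 2) * (max ((1 - r) powr (- l - 2)) ((1 + r) powr (- l - 2)))"
  have B: "cmod (f (Suc 1) x) \<le> B" if "x \<in> cball 0 r" for x
  proof -
    have x: "cmod x \<le> r"
      using that by simp
    have "cmod (1 - x) \<ge> 1 - r" "cmod (1 - x) \<le> 1 + r"
      using norm_triangle_ineq2[of 1 x] norm_triangle_ineq4[of 1 x] x by simp_all
    moreover have "- of_real l - of_nat (Suc 1) \<in> (\<real> :: complex set)"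
      by (intro Reals_diff Reals_minus) auto
    then have "cmod ((1 - x) powr (- of_real l - of_nat (Suc 1))) = cmod (1 - x) powr (- l - 2)"
      by (subst norm_powr_real_powr') simp_all
    moreover have "cmod (1 - x) powr (- l - 2) \<le> max ((1 - r) powr (- l - 2)) ((1 + r) powr (- l - 2))"
    proof (cases "- l - 2 \<ge> 0")
      case True
      then have "cmod (1 - x) powr (- l - 2) \<le> (1 + r) powr (- l - 2)"
        using calculation(2) by (intro powr_mono2) auto
      then show ?thesis
        by simp
    next
      case False
      then have "cmod (1 - x) powr (- l - 2) \<le> (1 - r) powr (- l - 2)"
        using calculation(1) r by (intro powr_mono2') auto
      then show ?thesis
        by simp
    qed
    ultimately show ?thesis
      unfolding f_def B_def norm_mult by (intro mult_mono) (simp_all add: numeral_2_eq_2)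
  qed
  show ?thesis
  proof (rule that[of B])
    show "B \<ge> 0"
      unfolding B_def by (intro mult_nonneg_nonneg) (auto simp: le_max_iff_disj)
    fix x y assume xy: "cmod x \<le> r" "cmod y \<le> r"
    have "cmod (f 0 x - (\<Sum>i\<le>1. f i y * (x - y) ^ i / fact i)) \<le> B * cmod (x - y) ^ Suc 1 / fact 1"
      by (rule complex_Taylor[OF convex_cball der B]) (use xy in auto)
    then show "cmod ((1 - x) powr (- of_real l) - (1 - y) powr (- of_real l) - of_real l * (1 - y) powr (- of_real l - 1) * (x - y))
      \<le> B * (cmod (x - y))\<^sup>2"
      by (simp add: f_def power2_eq_square algebra_simps)
  qed
qed

lemma continuous_hinner_right: "continuous_on S (\<lambda>w. hinner z w)"
  unfolding hinner_def by (intro continuous_intros)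

text \<open>Differentiation under the integral sign by a direct estimate: the remainder has an
  integrand bounded by a constant times \<open>(norm (y - z0))\<^sup>2 * norm (q w)\<close>,
  uniformly in \<open>w\<close>, and \<open>q\<close> is integrable. The derivative is
  complex-linear because \<open>hinner h w\<close> is so in \<open>h\<close>.\<close>

lemma holomorphic_ball_Kern_integral:
  fixes q :: "complex^'n \<Rightarrow> complex"
  assumes \<alpha>: "\<alpha> > - 1" and q: "integrable (nu \<alpha>) q"
  shows "holomorphic_ball (\<lambda>z. \<integral>w. cnj (Kern \<alpha> z w) * q w \<partial>nu \<alpha>)"
  unfolding holomorphic_ball_def
proof
  fix z0 :: "complex^'n" assume "z0 \<in> unit_ball"
  then have z0: "norm z0 < 1"
    by simp
  define l where "l = real CARD('n) + 1 + \<alpha>"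
  have l0: "l \<ge> 0"
    using \<alpha> by (simp add: l_def)
  define r where "r = (1 + norm z0) / 2"
  have r: "r < 1" "norm z0 \<le> r"
    using z0 by (simp_all add: r_def)
  obtain B where B: "B \<ge> 0" "\<And>x y. cmod x \<le> r \<Longrightarrow> cmod y \<le> r \<Longrightarrow>
    cmod ((1 - x) powr (- of_real l) - (1 - y) powr (- of_real l) - of_real l * (1 - y) powr (- of_real l - 1) * (x - y))
      \<le> B * (cmod (x - y))\<^sup>2"
    using powr_one_minus_Taylor[OF r(1)] by blast
  let ?F = "\<lambda>z. \<integral>w. cnj (Kern \<alpha> z w) * q w \<partial>nu \<alpha>"
  define p where "p w = of_real l * (1 - hinner z0 w) powr (- of_real l - 1)" for w
  define D where "D h = (\<integral>w. p w * hinner h w * q w \<partial>nu \<alpha>)" for h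
  have hr: "cmod (hinner z w) \<le> r" if "norm z \<le> r" "norm w < 1" for z w :: "complex^'n"
    using norm_hinner_le[of z w] mult_mono[of "norm z" r "norm w" 1] that norm_ge_zero[of z] by auto
  have pc: "continuous_on unit_ball p"
    unfolding p_def
  proof (intro continuous_intros continuous_hinner_right)
    show "unit_ball \<subseteq> {w. 0 \<le> Re (1 - hinner z0 w) \<or> Im (1 - hinner z0 w) \<noteq> 0}"
      using Re_one_minus_hinner_pos[OF z0] by (force intro: less_imp_le)
    show "0 < Re (- of_real l - 1)" if "w \<in> unit_ball" "1 - hinner z0 w = 0" for w
      using one_minus_hinner_nz[OF z0, of w] that by simp
  qed
  have pb: "cmod (p w) \<le> l * (1 - r) powr (- l - 1)" if w: "norm w < 1" for w
  proof -
    have "- of_real l - 1 \<in> (\<real> :: complex set)"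
      by (intro Reals_diff Reals_minus) auto
    then have "cmod ((1 - hinner z0 w) powr (- of_real l - 1)) = cmod (1 - hinner z0 w) powr (- l - 1)"
      by (subst norm_powr_real_powr') simp_all
    also have "\<dots> \<le> (1 - r) powr (- l - 1)"
      using norm_triangle_ineq2[of 1 "hinner z0 w"] hr[OF r(2) w] r \<alpha>
      by (intro powr_mono2') (auto simp: l_def)
    finally show ?thesis
      using l0 by (simp add: p_def norm_mult mult_left_mono)
  qed
  have Dint: "integrable (nu \<alpha>) (\<lambda>w. p w * hinner h w * q w)" for h
  proof (rule Bochner_Integration.integrable_bound)
    show "integrable (nu \<alpha>) (\<lambda>w. (l * (1 - r) powr (- l - 1) * norm h) * norm (q w))"
      using q by simp
    show "(\<lambda>w. p w * hinner h w * q w) \<in> borel_measurable (nu \<alpha>)"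
      by (intro borel_measurable_times borel_measurable_integrable[OF q]
          measurable_nu_continuous[OF pc] measurable_nu_continuous[OF continuous_hinner_right])
    show "AE w in nu \<alpha>. norm (p w * hinner h w * q w) \<le> norm ((l * (1 - r) powr (- l - 1) * norm h) * norm (q w))"
    proof (rule AE_I2)
      fix w assume "w \<in> space (nu \<alpha> :: (complex^'n) measure)"
      then have w: "norm w < 1"
        by simp
      have "cmod (hinner h w) \<le> norm h"
        using norm_hinner_le[of h w] mult_left_le[of "norm w" "norm h"] w by simp
      then have "cmod (p w) * cmod (hinner h w) * norm (q w) \<le> (l * (1 - r) powr (- l - 1) * norm h) * norm (q w)"
        using pb[OF w] by (intro mult_mono mult_right_mono) (auto intro: order_trans[OF norm_ge_zero])
      then show "norm (p w * hinner h w * q w) \<le> norm ((l * (1 - r) powr (- l - 1) * norm h) * norm (q w))"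
        by (simp add: norm_mult)
    qed
  qed
  have Dc: "D (c *s v) = c * D v" for c v
    unfolding D_def integral_mult_right_zero[symmetric] by (simp add: hinner_cmult_left mult_ac)
  have linD: "linear D"
  proof (rule linearI)
    show "D (x + y) = D x + D y" for x y
      unfolding D_def Bochner_Integration.integral_add[OF Dint Dint, symmetric]
      by (simp add: hinner_add_left algebra_simps)
    show "D (a *\<^sub>R x) = a *\<^sub>R D x" for a x
      by (simp add: scaleR_conv_cmult[of a x] Dc scaleR_conv_of_real[where 'a=complex])
  qed
  have "(?F has_derivative D) (at z0)"
  proof (rule has_derivativeI_sandwich[where e="(1 - norm z0) / 2" and H="\<lambda>y. B * (\<integral>w. norm (q w) \<partial>nu \<alpha>) * norm (y - z0)"])
    show "0 < (1 - norm z0) / 2"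
      using z0 by simp
    show "bounded_linear D"
      using linD by (simp add: linear_conv_bounded_linear)
    have "((\<lambda>y. B * (\<integral>w. norm (q w) \<partial>nu \<alpha>) * norm (y - z0)) \<longlongrightarrow> B * (\<integral>w. norm (q w) \<partial>nu \<alpha>) * norm (z0 - z0)) (at z0)"
      by (intro tendsto_intros)
    then show "((\<lambda>y. B * (\<integral>w. norm (q w) \<partial>nu \<alpha>) * norm (y - z0)) \<longlongrightarrow> 0) (at z0)"
      by simp
    fix y :: "complex^'n" assume ne: "y \<noteq> z0" and "dist y z0 < (1 - norm z0) / 2"
    then have y: "norm y \<le> r"
      using norm_triangle_sub[of y z0] by (simp add: r_def dist_norm field_simps)
    then have y1: "norm y < 1"
      using r by simp
    define R where "R w = cnj (Kern \<alpha> y w) * q w - cnj (Kern \<alpha> z0 w) * q w - p w * hinner (y - z0) w * q w" for w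
    have Rint: "integrable (nu \<alpha>) R"
      unfolding R_def by (intro Bochner_Integration.integrable_diff integrable_Kern_mult \<alpha> q y1 z0 Dint)
    have "?F y - ?F z0 - D (y - z0) = (\<integral>w. R w \<partial>nu \<alpha>)"
      unfolding D_def R_def
      by (simp add: integrable_Kern_mult[OF \<alpha> q] y1 z0 Dint)
    moreover have "norm (\<integral>w. R w \<partial>nu \<alpha>) \<le> (\<integral>w. (B * (norm (y - z0))\<^sup>2) * norm (q w) \<partial>nu \<alpha>)"
    proof (rule Bochner_Integration.integral_norm_bound_integral[OF Rint])
      show "integrable (nu \<alpha>) (\<lambda>w. B * (norm (y - z0))\<^sup>2 * norm (q w))"
        using q by simp
      fix w assume "w \<in> space (nu \<alpha> :: (complex^'n) measure)"
      then have w: "norm w < 1"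
        by simp
      have "norm (R w) = cmod ((1 - hinner y w) powr (- of_real l) - (1 - hinner z0 w) powr (- of_real l)
          - of_real l * (1 - hinner z0 w) powr (- of_real l - 1) * (hinner y w - hinner z0 w)) * norm (q w)"
        unfolding R_def cnj_Kern[OF y1 w] cnj_Kern[OF z0 w] norm_mult[symmetric]
        by (simp add: Kern_def l_def p_def hinner_diff_left algebra_simps)
      also have "\<dots> \<le> (B * (cmod (hinner y w - hinner z0 w))\<^sup>2) * norm (q w)"
        by (intro mult_right_mono B hr y r w) simp
      also have "\<dots> \<le> (B * (norm (y - z0))\<^sup>2) * norm (q w)"
      proof (intro mult_right_mono mult_left_mono power_mono)
        show "cmod (hinner y w - hinner z0 w) \<le> norm (y - z0)"
          using norm_hinner_le[of "y - z0" w] mult_left_le[of "norm w" "norm (y - z0)"] w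
          by (simp add: hinner_diff_left)
      qed (use B in auto)
      finally show "norm (R w) \<le> B * (norm (y - z0))\<^sup>2 * norm (q w)" .
    qed
    ultimately have "norm (?F y - ?F z0 - D (y - z0)) \<le> B * (norm (y - z0))\<^sup>2 * (\<integral>w. norm (q w) \<partial>nu \<alpha>)"
      by simp
    then show "norm (?F y - ?F z0 - D (y - z0)) / norm (y - z0) \<le> B * (\<integral>w. norm (q w) \<partial>nu \<alpha>) * norm (y - z0)"
      using ne by (simp add: divide_le_eq power2_eq_square mult_ac)
  qed
  with Dc show "\<exists>D. (?F has_derivative D) (at z0) \<and> (\<forall>c v. D (c *s v) = c * D v)"
    by blast
qed

lemma holomorphic_vec_bproj:
  fixes q :: "complex^'n \<Rightarrow> complex^'d"
  assumes \<alpha>: "\<alpha> > - 1" and q: "integrable (nu \<alpha>) q"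
  shows "holomorphic_vec (bproj \<alpha> q) unit_ball"
  unfolding holomorphic_vec_iff
proof
  fix i
  show "holomorphic_ball (\<lambda>z. bproj \<alpha> q z $ i)"
    by (rule holomorphic_ball_cong[OF holomorphic_ball_Kern_integral[OF \<alpha> integrable_nth[OF q, of i]]])
      (simp add: bproj_nth[OF \<alpha> q])
qed

section \<open>Symmetry of the projection\<close>

lemma measurable_pair_continuous:
  fixes g :: "(complex^'n) \<times> (complex^'n) \<Rightarrow> 'b::topological_space"
  assumes "continuous_on (unit_ball \<times> unit_ball) g"
  shows "g \<in> borel_measurable (nu \<alpha> \<Otimes>\<^sub>M nu \<alpha>)"
proof -
  have id: "(\<lambda>x. x) \<in> borel_measurable (nu \<alpha> :: (complex^'n) measure)"
    by (intro measurable_nu_continuous continuous_intros)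
  have "(\<lambda>x. (fst x, snd x)) \<in> borel_measurable (nu \<alpha> \<Otimes>\<^sub>M nu \<alpha> :: ((complex^'n) \<times> (complex^'n)) measure)"
    by (intro borel_measurable_Pair measurable_compose[OF measurable_fst id] measurable_compose[OF measurable_snd id])
  then have "(\<lambda>x. x) \<in> (nu \<alpha> \<Otimes>\<^sub>M nu \<alpha>) \<rightarrow>\<^sub>M restrict_space (borel :: ((complex^'n) \<times> (complex^'n)) measure) (unit_ball \<times> unit_ball)"
    by (intro measurable_restrict_space2) (auto simp: space_pair_measure)
  from measurable_compose[OF this borel_measurable_continuous_on_restrict[OF assms]] show ?thesis
    by simp
qed

lemma continuous_on_pair_hinner: "continuous_on S (\<lambda>x. hinner (f x) (g x))"
  if "continuous_on S f" "continuous_on S g" for f g :: "'a::topological_space \<Rightarrow> complex^'n"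
  unfolding hinner_def using that by (intro continuous_intros)

lemma measurable_pair_Kern:
  "(\<lambda>x. Kern \<alpha> (fst x) (snd x)) \<in> borel_measurable (nu \<alpha> \<Otimes>\<^sub>M nu \<alpha> :: ((complex^'n) \<times> (complex^'n)) measure)"
  unfolding Kern_def
proof (intro measurable_pair_continuous continuous_on_powr_complex continuous_on_diff continuous_on_const
    continuous_on_pair_hinner continuous_on_snd continuous_on_fst continuous_on_id)
  show "unit_ball \<times> unit_ball \<subseteq> {x :: (complex^'n) \<times> (complex^'n). 0 \<le> Re (1 - hinner (snd x) (fst x)) \<or> Im (1 - hinner (snd x) (fst x)) \<noteq> 0}"
    using Re_one_minus_hinner_pos by (force intro: less_imp_le)
  show "0 < Re (- of_real (real CARD('n) + 1 + \<alpha>))" if "x \<in> unit_ball \<times> unit_ball" "1 - hinner (snd x) (fst x) = 0"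
    for x :: "(complex^'n) \<times> (complex^'n)"
    using one_minus_hinner_nz[of "snd x" "fst x"] that by auto
qed

lemma integrable_bounded_nu:
  fixes k :: "complex^'n \<Rightarrow> 'b::{banach, second_countable_topology}"
  assumes "\<alpha> > - 1" "k \<in> borel_measurable (nu \<alpha>)" "\<And>w. norm w < 1 \<Longrightarrow> norm (k w) \<le> K"
  shows "integrable (nu \<alpha>) k"
proof -
  interpret finite_measure "nu \<alpha> :: (complex^'n) measure"
    by (rule finite_measure_nu[OF assms(1)])
  show ?thesis
    using assms by (intro integrable_const_bound[of _ K] AE_I2) auto
qed

text \<open>\<open>test_fun R k\<close> describes the functions for which all integrals below converge absolutely.\<close>

definition test_fun :: "real \<Rightarrow> real \<Rightarrow> (complex^'n \<Rightarrow> complex^'d) \<Rightarrow> bool" where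
  "test_fun \<alpha> R k \<longleftrightarrow> k \<in> borel_measurable (nu \<alpha>) \<and> 0 \<le> R \<and> R < 1 \<and>
     (\<exists>K. \<forall>w. norm w < 1 \<longrightarrow> norm (k w) \<le> K) \<and> (\<forall>w. R \<le> norm w \<longrightarrow> k w = 0)"

lemma integrable_test_fun:
  fixes k :: "complex^'n \<Rightarrow> complex^'d"
  assumes "\<alpha> > - 1" "test_fun \<alpha> R k"
  shows "integrable (nu \<alpha>) k" "integrable (nu \<alpha>) (\<lambda>w. (norm (k w))\<^sup>2)"
proof -
  obtain K where K: "\<And>w. norm w < 1 \<Longrightarrow> norm (k w) \<le> K" and m [measurable]: "k \<in> borel_measurable (nu \<alpha>)"
    using assms(2) by (auto simp: test_fun_def)
  show "integrable (nu \<alpha>) k"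
    by (rule integrable_bounded_nu[OF assms(1) m K])
  show "integrable (nu \<alpha>) (\<lambda>w. (norm (k w))\<^sup>2)"
    by (rule integrable_bounded_nu[OF assms(1), of _ "K\<^sup>2"]) (auto intro: power_mono K)
qed

lemma bounded_linear_hinner_right: "bounded_linear (\<lambda>x. hinner z x)"
  by (intro linear_conv_bounded_linear[THEN iffD1] linearI)
    (simp_all add: hinner_add_right hinner_scaleR_right scaleR_conv_of_real[where 'a=complex])

text \<open>Fubini with a bounded kernel, since \<open>k\<close> vanishes outside the ball of radius
  \<open>R < 1\<close>; the Hermitian symmetry \<open>cnj_Kern\<close> moves the projection to the
  other side. The function \<open>q\<close> is only assumed integrable because it will be a possibly
  unbounded symbol times a function in \<open>A2\<close>.\<close>

lemma integral_hinner_bproj: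
  fixes q k :: "complex^'n \<Rightarrow> complex^'d"
  assumes \<alpha>: "\<alpha> > - 1" and q: "integrable (nu \<alpha>) q" and k: "test_fun \<alpha> R k"
  shows "(\<integral>w. hinner (q w) (bproj \<alpha> k w) \<partial>nu \<alpha>) = (\<integral>z. hinner (bproj \<alpha> q z) (k z) \<partial>nu \<alpha>)"
proof -
  let ?N = "nu \<alpha> :: (complex^'n) measure"
  interpret N: finite_measure ?N
    by (rule finite_measure_nu[OF \<alpha>])
  interpret P: pair_sigma_finite ?N ?N ..
  obtain K where R: "0 \<le> R" "R < 1" and K: "\<And>w. norm w < 1 \<Longrightarrow> norm (k w) \<le> K"
    and km: "k \<in> borel_measurable ?N" and k0: "\<And>w. R \<le> norm w \<Longrightarrow> k w = 0"
    using k by (auto simp: test_fun_def)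
  have K0: "K \<ge> 0"
    using K[of 0] by (auto intro: order_trans[OF norm_ge_zero])
  define f where "f w z = Kern \<alpha> w z * hinner (q w) (k z)" for w z
  define c where "c = (1 - R) powr (- (real CARD('n) + 1 + \<alpha>)) * K"
  have fm: "case_prod f \<in> borel_measurable (?N \<Otimes>\<^sub>M ?N)"
    unfolding f_def split_beta'
    by (intro borel_measurable_times measurable_pair_Kern measurable_hinner
        measurable_compose[OF measurable_fst borel_measurable_integrable[OF q]] measurable_compose[OF measurable_snd km])
  have fb: "norm (f w z) \<le> c * norm (q w)" if w: "norm w < 1" and z: "norm z < 1" for w z
  proof (cases "norm z < R")
    case True
    have "cmod (Kern \<alpha> w z) = cmod (Kern \<alpha> z w)"
      using cnj_Kern[OF z w, of \<alpha>] complex_mod_cnj by metis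
    also have "\<dots> \<le> (1 - R) powr (- (real CARD('n) + 1 + \<alpha>))"
      using True by (intro norm_Kern_le \<alpha> R w) simp
    finally have "cmod (Kern \<alpha> w z) * cmod (hinner (q w) (k z)) \<le> (1 - R) powr (- (real CARD('n) + 1 + \<alpha>)) * (norm (q w) * K)"
      using norm_hinner_le[of "q w" "k z"] mult_left_mono[OF K[OF z], of "norm (q w)"]
      by (intro mult_mono) auto
    then show ?thesis
      by (simp add: f_def norm_mult c_def mult_ac)
  next
    case False
    then show ?thesis
      using K0 by (simp add: f_def k0 c_def)
  qed
  have fi: "integrable (?N \<Otimes>\<^sub>M ?N) (case_prod f)"
  proof (rule integrableI_bounded[OF fm])
    have "(\<integral>\<^sup>+x. ennreal (norm (case_prod f x)) \<partial>(?N \<Otimes>\<^sub>M ?N)) = (\<integral>\<^sup>+w. \<integral>\<^sup>+z. ennreal (norm (case_prod f (w, z))) \<partial>?N \<partial>?N)"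
      by (intro N.nn_integral_fst[symmetric] measurable_compose[OF measurable_compose[OF fm borel_measurable_norm] measurable_ennreal])
    also have "\<dots> \<le> (\<integral>\<^sup>+w. \<integral>\<^sup>+z. ennreal (c * norm (q w)) \<partial>?N \<partial>?N)"
      by (intro nn_integral_mono) (auto intro!: ennreal_leI fb)
    also have "\<dots> = (\<integral>\<^sup>+w. ennreal (norm (c *\<^sub>R q w)) \<partial>?N)"
      using K0 by (simp add: emeasure_nu_space[OF \<alpha>] c_def)
    also have "\<dots> < \<infinity>"
      using q integrable_iff_bounded[of ?N "\<lambda>w. c *\<^sub>R q w"] by simp
    finally show "(\<integral>\<^sup>+x. ennreal (norm (case_prod f x)) \<partial>(?N \<Otimes>\<^sub>M ?N)) < \<infinity>" .
  qed
  note ki = integrable_test_fun(1)[OF \<alpha> k]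
  have "(\<integral>w. hinner (q w) (bproj \<alpha> k w) \<partial>?N) = (\<integral>w. (\<integral>z. f w z \<partial>?N) \<partial>?N)"
  proof (rule Bochner_Integration.integral_cong[OF refl])
    fix w assume "w \<in> space ?N"
    then have w: "norm w < 1"
      by simp
    have "hinner (q w) (bproj \<alpha> k w) = (\<integral>z. hinner (q w) (cnj (Kern \<alpha> w z) *s k z) \<partial>?N)"
      using w integral_bounded_linear[OF bounded_linear_hinner_right integrable_Kern_smult[OF \<alpha> ki w], of "q w"]
      by (simp add: bproj_def)
    then show "hinner (q w) (bproj \<alpha> k w) = (\<integral>z. f w z \<partial>?N)"
      by (simp add: hinner_cmult_right f_def)
  qed
  also have "\<dots> = (\<integral>z. (\<integral>w. f w z \<partial>?N) \<partial>?N)"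
    by (rule P.Fubini_integral[OF fi, symmetric])
  also have "\<dots> = (\<integral>z. hinner (bproj \<alpha> q z) (k z) \<partial>?N)"
  proof (rule Bochner_Integration.integral_cong[OF refl])
    fix z assume "z \<in> space ?N"
    then have z: "norm z < 1"
      by simp
    have "hinner (bproj \<alpha> q z) (k z) = (\<integral>w. hinner (cnj (Kern \<alpha> z w) *s q w) (k z) \<partial>?N)"
      using z integral_bounded_linear[OF bounded_linear_hinner_left integrable_Kern_smult[OF \<alpha> q z], of "k z"]
      by (simp add: bproj_def)
    also have "\<dots> = (\<integral>w. f w z \<partial>?N)"
      by (rule Bochner_Integration.integral_cong) (simp_all add: hinner_cmult_left f_def cnj_Kern[OF z])
    finally show "(\<integral>w. f w z \<partial>?N) = hinner (bproj \<alpha> q z) (k z)" ..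
  qed
  finally show ?thesis .
qed

lemma A2_norm_squared: "(A2_norm \<alpha> f)\<^sup>2 = (\<integral>z. (norm (f z))\<^sup>2 \<partial>nu \<alpha>)"
  by (simp add: A2_norm_def)

lemma A2_norm_nonneg [simp]: "A2_norm \<alpha> f \<ge> 0"
  by (simp add: A2_norm_def)

lemma nn_integral_norm_squared:
  assumes "integrable (nu \<alpha>) (\<lambda>z. (norm (f z))\<^sup>2)"
  shows "(\<integral>\<^sup>+z. ennreal ((norm (f z))\<^sup>2) \<partial>nu \<alpha>) = ennreal ((A2_norm \<alpha> f)\<^sup>2)"
  unfolding A2_norm_squared by (rule nn_integral_eq_integral[OF assms]) simp

lemma norm_integral_hinner_le:
  fixes f g :: "complex^'n \<Rightarrow> complex^'d"
  assumes f: "f \<in> borel_measurable (nu \<alpha>)" "integrable (nu \<alpha>) (\<lambda>z. (norm (f z))\<^sup>2)"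
    and g: "g \<in> borel_measurable (nu \<alpha>)" "integrable (nu \<alpha>) (\<lambda>z. (norm (g z))\<^sup>2)"
  shows "integrable (nu \<alpha>) (\<lambda>z. hinner (f z) (g z))"
    and "cmod (\<integral>z. hinner (f z) (g z) \<partial>nu \<alpha>) \<le> A2_norm \<alpha> f * A2_norm \<alpha> g"
proof -
  note [measurable] = f(1) g(1)
  let ?I = "\<integral>\<^sup>+z. ennreal (norm (f z)) * ennreal (norm (g z)) \<partial>nu \<alpha>"
  have "?I\<^sup>2 \<le> (\<integral>\<^sup>+z. (ennreal (norm (f z)))\<^sup>2 \<partial>nu \<alpha>) * (\<integral>\<^sup>+z. (ennreal (norm (g z)))\<^sup>2 \<partial>nu \<alpha>)"
    by (rule Cauchy_Schwarz_nn_integral) measurable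
  also have "\<dots> = (ennreal (A2_norm \<alpha> f * A2_norm \<alpha> g))\<^sup>2"
    using nn_integral_norm_squared[OF f(2)] nn_integral_norm_squared[OF g(2)]
    by (simp add: ennreal_power ennreal_mult[symmetric] power_mult_distrib)
  finally have sq: "?I\<^sup>2 \<le> (ennreal (A2_norm \<alpha> f * A2_norm \<alpha> g))\<^sup>2" .
  have "?I \<le> ennreal (A2_norm \<alpha> f * A2_norm \<alpha> g)"
  proof (cases ?I)
    case (real i)
    then have "i\<^sup>2 \<le> (A2_norm \<alpha> f * A2_norm \<alpha> g)\<^sup>2"
      using sq by (simp add: ennreal_power ennreal_le_iff)
    then have "i \<le> A2_norm \<alpha> f * A2_norm \<alpha> g"
      by (rule power2_le_imp_le) simp
    then show ?thesis
      unfolding real by (rule ennreal_leI)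
  next
    case top
    then show ?thesis
      using sq by (simp add: ennreal_power power2_eq_square ennreal_mult[symmetric] top_unique)
  qed
  moreover have "(\<integral>\<^sup>+z. ennreal (norm (hinner (f z) (g z))) \<partial>nu \<alpha>) \<le> ?I"
    by (intro nn_integral_mono) (simp add: ennreal_mult[symmetric] ennreal_leI norm_hinner_le)
  ultimately have le: "(\<integral>\<^sup>+z. ennreal (norm (hinner (f z) (g z))) \<partial>nu \<alpha>) \<le> ennreal (A2_norm \<alpha> f * A2_norm \<alpha> g)"
    by simp
  then show int: "integrable (nu \<alpha>) (\<lambda>z. hinner (f z) (g z))"
    by (intro integrableI_bounded) (auto intro: le_less_trans)
  have "ennreal (cmod (\<integral>z. hinner (f z) (g z) \<partial>nu \<alpha>)) \<le> ennreal (A2_norm \<alpha> f * A2_norm \<alpha> g)"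
    using integral_norm_bound_ennreal[OF int] le by (rule order_trans)
  then show "cmod (\<integral>z. hinner (f z) (g z) \<partial>nu \<alpha>) \<le> A2_norm \<alpha> f * A2_norm \<alpha> g"
    by simp
qed

section \<open>Bounded functions inside the Bergman space\<close>

lemma A2D:
  fixes f :: "complex^'n \<Rightarrow> complex^'d"
  assumes "f \<in> A2 \<alpha>"
  shows "holomorphic_vec f unit_ball" "integrable (nu \<alpha>) (\<lambda>z. (norm (f z))\<^sup>2)" "\<And>z. \<not> norm z < 1 \<Longrightarrow> f z = 0"
    "f \<in> borel_measurable (nu \<alpha>)"
  using assms by (auto simp: A2_def intro: measurable_holomorphic_vec)

lemma integrable_A2:
  fixes f :: "complex^'n \<Rightarrow> complex^'d"
  assumes \<alpha>: "\<alpha> > - 1" and f: "f \<in> A2 \<alpha>"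
  shows "integrable (nu \<alpha>) f"
proof (rule Bochner_Integration.integrable_bound)
  interpret finite_measure "nu \<alpha> :: (complex^'n) measure"
    by (rule finite_measure_nu[OF \<alpha>])
  show "integrable (nu \<alpha>) (\<lambda>z. 1 + (norm (f z))\<^sup>2)"
    using A2D(2)[OF f] by simp
  have "x \<le> 1 + x\<^sup>2" for x :: real
    using zero_le_power2[of "x - 1/2"] by (simp add: power2_eq_square algebra_simps)
  then show "AE z in nu \<alpha>. norm (f z) \<le> norm (1 + (norm (f z))\<^sup>2)"
    by (intro AE_I2) (simp add: add_nonneg_nonneg)
qed (rule A2D(4)[OF f])

lemma Hinf_subset_A2: "\<alpha> > - 1 \<Longrightarrow> f \<in> Hinf \<Longrightarrow> (f :: complex^'n \<Rightarrow> complex^'d) \<in> A2 \<alpha>"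
proof -
  assume \<alpha>: "\<alpha> > - 1" and f: "f \<in> Hinf"
  then have "\<exists>K. \<forall>z\<in>unit_ball. norm (f z) \<le> K"
    by (auto simp: Hinf_def bounded_iff)
  then obtain K where "\<forall>z\<in>unit_ball. norm (f z) \<le> K" ..
  then have K: "\<And>z. norm z < 1 \<Longrightarrow> norm (f z) \<le> K"
    by simp
  have [measurable]: "f \<in> borel_measurable (nu \<alpha>)"
    using f by (intro measurable_holomorphic_vec) (simp add: Hinf_def)
  have "integrable (nu \<alpha>) (\<lambda>z. (norm (f z))\<^sup>2)"
    by (rule integrable_bounded_nu[OF \<alpha>, of _ "K\<^sup>2"]) (auto intro: power_mono K)
  then show "f \<in> A2 \<alpha>"
    using f by (simp add: Hinf_def A2_def)
qed

lemma bproj_reproducing: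
  fixes f :: "complex^'n \<Rightarrow> complex^'d"
  assumes \<alpha>: "\<alpha> > - 1" and f: "f \<in> A2 \<alpha>"
  shows "bproj \<alpha> f = f"
proof (rule ext, subst vec_eq_iff, rule allI)
  fix z i
  show "bproj \<alpha> f z $ i = f z $ i"
  proof (cases "norm z < 1")
    case True
    have "holomorphic_ball (\<lambda>z. f z $ i)"
      using A2D(1)[OF f] by (simp add: holomorphic_vec_iff)
    from reproducing[OF \<alpha> this integrable_nth[OF integrable_A2[OF \<alpha> f]] True] show ?thesis
      by (simp add: bproj_nth[OF \<alpha> integrable_A2[OF \<alpha> f] True])
  next
    case False
    then show ?thesis
      using A2D(3)[OF f False] by (simp add: bproj_def)
  qed
qed

text \<open>On the support of \<open>k\<close> the kernel is bounded uniformly in \<open>z\<close>,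
  so the projection stays bounded up to the sphere.\<close>

lemma bproj_test_fun:
  fixes k :: "complex^'n \<Rightarrow> complex^'d"
  assumes \<alpha>: "\<alpha> > - 1" and k: "test_fun \<alpha> R k"
  shows "bproj \<alpha> k \<in> Hinf"
proof -
  obtain K where R: "0 \<le> R" "R < 1" and K: "\<And>w. norm w < 1 \<Longrightarrow> norm (k w) \<le> K"
    and k0: "\<And>w. R \<le> norm w \<Longrightarrow> k w = 0"
    using k by (auto simp: test_fun_def)
  have K0: "K \<ge> 0"
    using K[of 0] by (auto intro: order_trans[OF norm_ge_zero])
  note ki = integrable_test_fun(1)[OF \<alpha> k]
  define c where "c = (1 - R) powr (- (real CARD('n) + 1 + \<alpha>)) * K"
  interpret finite_measure "nu \<alpha> :: (complex^'n) measure"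
    by (rule finite_measure_nu[OF \<alpha>])
  have "norm (bproj \<alpha> k z) \<le> c" if z: "norm z < 1" for z
  proof -
    have "norm (\<integral>w. cnj (Kern \<alpha> z w) *s k w \<partial>nu \<alpha>) \<le> (\<integral>w. c \<partial>(nu \<alpha> :: (complex^'n) measure))"
    proof (rule Bochner_Integration.integral_norm_bound_integral[OF integrable_Kern_smult[OF \<alpha> ki z]])
      fix w assume "w \<in> space (nu \<alpha> :: (complex^'n) measure)"
      then have w: "norm w < 1"
        by simp
      show "norm (cnj (Kern \<alpha> z w) *s k w) \<le> c"
      proof (cases "norm w < R")
        case True
        have "cmod (Kern \<alpha> w z) \<le> (1 - R) powr (- (real CARD('n) + 1 + \<alpha>))"
          using True by (intro norm_Kern_le \<alpha> R z) simp
        then show ?thesis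
          unfolding cnj_Kern[OF z w] norm_vec_cmult c_def using K[OF w] by (intro mult_mono) auto
      next
        case False
        then show ?thesis
          using K0 by (simp add: k0 c_def norm_vec_cmult)
      qed
    qed simp
    then show ?thesis
      using z by (simp add: bproj_def measure_nu_space[OF \<alpha>])
  qed
  then have "bounded (bproj \<alpha> k ` unit_ball)"
    unfolding bounded_iff by (intro exI[of _ c]) auto
  then show ?thesis
    using holomorphic_vec_bproj[OF \<alpha> ki] by (auto simp: Hinf_def bproj_def)
qed

text \<open>For \<open>h = bproj \<alpha> k\<close>, symmetry and the reproducing formula turn the
  squared norm of \<open>h\<close> into the inner product of \<open>h\<close> and \<open>k\<close>,
  and Cauchy-Schwarz applies. That \<open>h\<close> lies in \<open>A2\<close> is known beforehand,
  from its boundedness, so the norm of \<open>h\<close> may be cancelled.\<close>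

lemma bproj_test_fun_norm:
  fixes k :: "complex^'n \<Rightarrow> complex^'d"
  assumes \<alpha>: "\<alpha> > - 1" and k: "test_fun \<alpha> R k"
  shows "A2_norm \<alpha> (bproj \<alpha> k) \<le> A2_norm \<alpha> k"
proof -
  let ?h = "bproj \<alpha> k"
  have h: "?h \<in> A2 \<alpha>"
    by (rule Hinf_subset_A2[OF \<alpha> bproj_test_fun[OF \<alpha> k]])
  have km: "k \<in> borel_measurable (nu \<alpha>)"
    using k by (simp add: test_fun_def)
  have "of_real ((A2_norm \<alpha> ?h)\<^sup>2) = (\<integral>z. hinner (?h z) (?h z) \<partial>nu \<alpha>)"
    by (simp only: A2_norm_squared hinner_self integral_complex_of_real)
  also have "\<dots> = (\<integral>z. hinner (bproj \<alpha> ?h z) (k z) \<partial>nu \<alpha>)"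
    by (rule integral_hinner_bproj[OF \<alpha> integrable_A2[OF \<alpha> h] k])
  also have "bproj \<alpha> ?h = ?h"
    by (rule bproj_reproducing[OF \<alpha> h])
  finally have "cmod (complex_of_real ((A2_norm \<alpha> ?h)\<^sup>2)) \<le> A2_norm \<alpha> ?h * A2_norm \<alpha> k"
    using norm_integral_hinner_le(2)[OF A2D(4,2)[OF h] km integrable_test_fun(2)[OF \<alpha> k]] by simp
  then have "A2_norm \<alpha> ?h * A2_norm \<alpha> ?h \<le> A2_norm \<alpha> ?h * A2_norm \<alpha> k"
    by (simp add: power2_eq_square norm_mult)
  then show ?thesis
    by (cases "A2_norm \<alpha> ?h = 0") (auto simp: mult_le_cancel_left less_le)
qed

text \<open>The factor 2 is that of the square of a sum. Such a crude form suffices for closure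
  under addition and for the density argument in \<open>bounded_ops_unique\<close>.\<close>

lemma A2_add:
  fixes f g :: "complex^'n \<Rightarrow> complex^'d"
  assumes f: "f \<in> A2 \<alpha>" and g: "g \<in> A2 \<alpha>"
  shows "(\<lambda>z. f z + g z) \<in> A2 \<alpha>" "(A2_norm \<alpha> (\<lambda>z. f z + g z))\<^sup>2 \<le> 2 * (A2_norm \<alpha> f)\<^sup>2 + 2 * (A2_norm \<alpha> g)\<^sup>2"
proof -
  note [measurable] = A2D(4)[OF f] A2D(4)[OF g]
  have le: "(norm (f z + g z))\<^sup>2 \<le> 2 * (norm (f z))\<^sup>2 + 2 * (norm (g z))\<^sup>2" for z
  proof -
    have "(norm (f z + g z))\<^sup>2 \<le> (norm (f z) + norm (g z))\<^sup>2"
      by (intro power_mono norm_triangle_ineq) simp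
    also have "\<dots> \<le> 2 * (norm (f z))\<^sup>2 + 2 * (norm (g z))\<^sup>2"
      using zero_le_power2[of "norm (f z) - norm (g z)"] by (simp add: power2_eq_square algebra_simps)
    finally show ?thesis .
  qed
  have i: "integrable (nu \<alpha>) (\<lambda>z. 2 * (norm (f z))\<^sup>2 + 2 * (norm (g z))\<^sup>2)"
    using A2D(2)[OF f] A2D(2)[OF g] by simp
  have int: "integrable (nu \<alpha>) (\<lambda>z. (norm (f z + g z))\<^sup>2)"
    by (rule Bochner_Integration.integrable_bound[OF i]) (auto intro!: AE_I2 le)
  have "holomorphic_vec (\<lambda>z. f z + g z) unit_ball"
    unfolding holomorphic_vec_def
  proof
    fix z :: "complex^'n" assume z: "z \<in> unit_ball"
    then obtain D E where "(f has_derivative D) (at z)" "\<forall>c v. D (c *s v) = c *s D v"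
      "(g has_derivative E) (at z)" "\<forall>c v. E (c *s v) = c *s E v"
      using A2D(1)[OF f] A2D(1)[OF g] unfolding holomorphic_vec_def by meson
    then show "\<exists>D. ((\<lambda>z. f z + g z) has_derivative D) (at z) \<and> (\<forall>c v. D (c *s v) = c *s D v)"
      by (intro exI[of _ "\<lambda>h. D h + E h"]) (auto intro: has_derivative_add simp: vector_add_ldistrib)
  qed
  then show "(\<lambda>z. f z + g z) \<in> A2 \<alpha>"
    using int A2D(3)[OF f] A2D(3)[OF g] by (simp add: A2_def)
  have "(A2_norm \<alpha> (\<lambda>z. f z + g z))\<^sup>2 \<le> (\<integral>z. 2 * (norm (f z))\<^sup>2 + 2 * (norm (g z))\<^sup>2 \<partial>nu \<alpha>)"
    unfolding A2_norm_squared by (rule integral_mono[OF int i le])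
  also have "\<dots> = 2 * (A2_norm \<alpha> f)\<^sup>2 + 2 * (A2_norm \<alpha> g)\<^sup>2"
    unfolding A2_norm_squared using A2D(2)[OF f] A2D(2)[OF g] by simp
  finally show "(A2_norm \<alpha> (\<lambda>z. f z + g z))\<^sup>2 \<le> 2 * (A2_norm \<alpha> f)\<^sup>2 + 2 * (A2_norm \<alpha> g)\<^sup>2" .
qed

lemma A2_norm_cmult:
  fixes f :: "complex^'n \<Rightarrow> complex^'d"
  shows "A2_norm \<alpha> (\<lambda>z. c *s f z) = cmod c * A2_norm \<alpha> f"
  by (simp add: A2_norm_def norm_vec_cmult power_mult_distrib real_sqrt_mult)

lemma A2_cmult:
  fixes f :: "complex^'n \<Rightarrow> complex^'d"
  assumes f: "f \<in> A2 \<alpha>"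
  shows "(\<lambda>z. c *s f z) \<in> A2 \<alpha>"
proof -
  have "holomorphic_ball (\<lambda>z. c * f z $ i)" for i
  proof (rule holomorphic_ball_mult)
    show "holomorphic_ball (\<lambda>z. c)"
      unfolding holomorphic_ball_def by (intro ballI exI[of _ "\<lambda>_. 0"]) simp
    show "holomorphic_ball (\<lambda>z. f z $ i)"
      using A2D(1)[OF f] by (simp add: holomorphic_vec_iff)
  qed
  then show ?thesis
    using A2D[OF f] by (simp add: A2_def holomorphic_vec_iff norm_vec_cmult power_mult_distrib)
qed

lemma A2_diff:
  fixes f g :: "complex^'n \<Rightarrow> complex^'d"
  assumes f: "f \<in> A2 \<alpha>" and g: "g \<in> A2 \<alpha>"
  shows "(\<lambda>z. f z - g z) \<in> A2 \<alpha>" "(A2_norm \<alpha> (\<lambda>z. f z - g z))\<^sup>2 \<le> 2 * (A2_norm \<alpha> f)\<^sup>2 + 2 * (A2_norm \<alpha> g)\<^sup>2"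
proof -
  have eq: "(\<lambda>z. f z - g z) = (\<lambda>z. f z + (- 1) *s g z)"
    by (simp add: fun_eq_iff vec_eq_iff)
  show "(\<lambda>z. f z - g z) \<in> A2 \<alpha>" "(A2_norm \<alpha> (\<lambda>z. f z - g z))\<^sup>2 \<le> 2 * (A2_norm \<alpha> f)\<^sup>2 + 2 * (A2_norm \<alpha> g)\<^sup>2"
    using A2_add[OF f A2_cmult[OF g, of "- 1"]] unfolding eq A2_norm_cmult by simp_all
qed

lemma bproj_diff:
  fixes q r :: "complex^'n \<Rightarrow> complex^'d"
  assumes "\<alpha> > - 1" "integrable (nu \<alpha>) q" "integrable (nu \<alpha>) r"
  shows "bproj \<alpha> (\<lambda>w. q w - r w) = (\<lambda>z. bproj \<alpha> q z - bproj \<alpha> r z)"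
  using Bochner_Integration.integral_diff[OF integrable_Kern_smult[OF assms(1,2)] integrable_Kern_smult[OF assms(1,3)]]
  by (auto simp: fun_eq_iff bproj_def vector_ssub_ldistrib)

lemma bproj_add:
  fixes q r :: "complex^'n \<Rightarrow> complex^'d"
  assumes "\<alpha> > - 1" "integrable (nu \<alpha>) q" "integrable (nu \<alpha>) r"
  shows "bproj \<alpha> (\<lambda>w. q w + r w) = (\<lambda>z. bproj \<alpha> q z + bproj \<alpha> r z)"
  using Bochner_Integration.integral_add[OF integrable_Kern_smult[OF assms(1,2)] integrable_Kern_smult[OF assms(1,3)]]
  by (auto simp: fun_eq_iff bproj_def vector_add_ldistrib)

lemma bproj_cmult:
  fixes q :: "complex^'n \<Rightarrow> complex^'d"
  assumes "\<alpha> > - 1" "integrable (nu \<alpha>) q"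
  shows "bproj \<alpha> (\<lambda>w. c *s q w) = (\<lambda>z. c *s bproj \<alpha> q z)"
proof (rule ext)
  fix z
  have bl: "bounded_linear (\<lambda>x :: complex^'d. c *s x)"
    by (intro linear_conv_bounded_linear[THEN iffD1] linearI) (simp_all add: vec_eq_iff algebra_simps)
  show "bproj \<alpha> (\<lambda>w. c *s q w) z = c *s bproj \<alpha> q z"
    using integral_bounded_linear[OF bl integrable_Kern_smult[OF assms], of z]
    by (auto simp: bproj_def vector_smult_assoc mult.commute[of c])
qed

section \<open>Truncation, norm bounds for the projection and density\<close>

definition trunc :: "real \<Rightarrow> (complex^'n \<Rightarrow> complex^'d) \<Rightarrow> complex^'n \<Rightarrow> complex^'d" where
  "trunc R h z = (if norm z < R then h z else 0)"

lemma measurable_trunc: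
  assumes "h \<in> borel_measurable (nu \<alpha>)"
  shows "trunc R h \<in> borel_measurable (nu \<alpha>)"
proof -
  note [measurable] = assms
  have "(\<lambda>z. if z \<in> ball 0 R then h z else 0) \<in> borel_measurable (nu \<alpha>)"
    by measurable
  then show ?thesis
    by (simp add: trunc_def[abs_def])
qed

lemma test_fun_trunc:
  fixes h :: "complex^'n \<Rightarrow> complex^'d"
  assumes h: "holomorphic_vec h unit_ball" and R: "0 \<le> R" "R < 1"
  shows "test_fun \<alpha> R (trunc R h)"
proof -
  have "continuous_on (cball 0 R) h"
  proof (rule continuous_at_imp_continuous_on, rule ballI)
    fix z :: "complex^'n" assume "z \<in> cball 0 R"
    then have "z \<in> unit_ball"
      using R by simp
    with h obtain D where "(h has_derivative D) (at z)"
      unfolding holomorphic_vec_def by blast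
    then show "isCont h z"
      by (rule has_derivative_continuous)
  qed
  then have "bounded (h ` cball 0 R)"
    by (intro compact_imp_bounded compact_continuous_image) auto
  then have "\<exists>K. \<forall>z\<in>cball 0 R. norm (h z) \<le> K"
    by (auto simp: bounded_iff)
  then obtain K where "\<forall>z\<in>cball 0 R. norm (h z) \<le> K" ..
  then have "\<forall>w. norm w < 1 \<longrightarrow> norm (trunc R h w) \<le> max K 0"
    by (auto simp: trunc_def le_max_iff_disj)
  moreover have "\<forall>w. R \<le> norm w \<longrightarrow> trunc R h w = 0"
    by (simp add: trunc_def)
  ultimately show ?thesis
    using R measurable_trunc[OF measurable_holomorphic_vec[OF h], of R] unfolding test_fun_def by blast
qed

abbreviation radius :: "nat \<Rightarrow> real" where
  "radius n \<equiv> real n / real (Suc n)"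

lemma eventually_radius: "norm z < 1 \<Longrightarrow> \<forall>\<^sub>F n in sequentially. norm z < radius n"
  by (rule order_tendstoD(1)[OF LIMSEQ_n_over_Suc_n])

lemma radius_mono: "m \<le> n \<Longrightarrow> radius m \<le> radius n"
  by (simp add: field_simps)

text \<open>Testing against \<open>g = bproj (trunc R (bproj q))\<close> and letting \<open>R\<close> tend to \<open>1\<close>.\<close>

theorem bproj_bounded:
  fixes q :: "complex^'n \<Rightarrow> complex^'d"
  assumes \<alpha>: "\<alpha> > - 1" and q: "integrable (nu \<alpha>) q" and e: "\<epsilon> \<ge> 0"
    and le: "\<And>g. g \<in> Hinf \<Longrightarrow> cmod (\<integral>w. hinner (q w) (g w) \<partial>nu \<alpha>) \<le> \<epsilon> * A2_norm \<alpha> g"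
  shows "bproj \<alpha> q \<in> A2 \<alpha>" "A2_norm \<alpha> (bproj \<alpha> q) \<le> \<epsilon>"
proof -
  let ?h = "bproj \<alpha> q"
  have h: "holomorphic_vec ?h unit_ball"
    by (rule holomorphic_vec_bproj[OF \<alpha> q])
  note hm = measurable_holomorphic_vec[OF h, of \<alpha>]
  have bound: "(\<integral>\<^sup>+z. ennreal ((norm (trunc (radius n) ?h z))\<^sup>2) \<partial>nu \<alpha>) \<le> ennreal (\<epsilon>\<^sup>2)" for n
  proof -
    let ?k = "trunc (radius n) ?h"
    have k: "test_fun \<alpha> (radius n) ?k"
      by (rule test_fun_trunc[OF h]) auto
    \<comment> \<open>The squared norm of the truncation is its inner product with
      \<open>?h\<close>, hence that of \<open>bproj \<alpha> ?k\<close> with \<open>q\<close>. The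
      hypothesis and the contraction property bound it by \<epsilon> times the norm of
      \<open>?k\<close>, and one factor cancels.\<close>
    have "complex_of_real ((A2_norm \<alpha> ?k)\<^sup>2) = (\<integral>z. hinner (?k z) (?k z) \<partial>nu \<alpha>)"
      by (simp only: A2_norm_squared hinner_self integral_complex_of_real)
    also have "\<dots> = (\<integral>z. hinner (?h z) (?k z) \<partial>nu \<alpha>)"
      by (rule Bochner_Integration.integral_cong) (auto simp: trunc_def)
    also have "\<dots> = (\<integral>w. hinner (q w) (bproj \<alpha> ?k w) \<partial>nu \<alpha>)"
      by (rule integral_hinner_bproj[OF \<alpha> q k, symmetric])
    finally have "(A2_norm \<alpha> ?k)\<^sup>2 = cmod (\<integral>w. hinner (q w) (bproj \<alpha> ?k w) \<partial>nu \<alpha>)"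
      by (metis abs_power2 norm_of_real)
    also have "\<dots> \<le> \<epsilon> * A2_norm \<alpha> (bproj \<alpha> ?k)"
      by (rule le[OF bproj_test_fun[OF \<alpha> k]])
    also have "\<dots> \<le> \<epsilon> * A2_norm \<alpha> ?k"
      by (intro mult_left_mono bproj_test_fun_norm[OF \<alpha> k] e)
    finally have "A2_norm \<alpha> ?k * A2_norm \<alpha> ?k \<le> A2_norm \<alpha> ?k * \<epsilon>"
      by (simp add: power2_eq_square mult.commute)
    then have "A2_norm \<alpha> ?k \<le> \<epsilon>"
      using e by (cases "A2_norm \<alpha> ?k = 0") (auto simp: mult_le_cancel_left less_le)
    then have "(A2_norm \<alpha> ?k)\<^sup>2 \<le> \<epsilon>\<^sup>2"
      by (intro power_mono) auto
    then show ?thesis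
      using nn_integral_norm_squared[OF integrable_test_fun(2)[OF \<alpha> k]] by (simp add: ennreal_leI)
  qed
  \<comment> \<open>The bound does not depend on the radius, so monotone convergence yields the
    square integrability of \<open>?h\<close>, which was not known before.\<close>
  have "(\<lambda>n. \<integral>\<^sup>+z. ennreal ((norm (trunc (radius n) ?h z))\<^sup>2) \<partial>nu \<alpha>) \<longlonglongrightarrow> (\<integral>\<^sup>+z. ennreal ((norm (?h z))\<^sup>2) \<partial>nu \<alpha>)"
  proof (rule nn_integral_LIMSEQ)
    show "incseq (\<lambda>n z. ennreal ((norm (trunc (radius n) ?h z))\<^sup>2))"
    proof (intro incseq_SucI le_funI)
      fix n z
      show "ennreal ((norm (trunc (radius n) ?h z))\<^sup>2) \<le> ennreal ((norm (trunc (radius (Suc n)) ?h z))\<^sup>2)"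
        using radius_mono[of n "Suc n"] by (auto simp: trunc_def simp del: of_nat_Suc)
    qed
    show "(\<lambda>z. ennreal ((norm (trunc (radius n) ?h z))\<^sup>2)) \<in> borel_measurable (nu \<alpha>)" for n
      using measurable_trunc[OF hm, of "radius n"] by measurable
    show "(\<lambda>n. ennreal ((norm (trunc (radius n) ?h z))\<^sup>2)) \<longlonglongrightarrow> ennreal ((norm (?h z))\<^sup>2)" for z
    proof (cases "norm z < 1")
      case True
      show ?thesis
        by (rule tendsto_eventually, rule eventually_mono[OF eventually_radius[OF True]]) (simp add: trunc_def)
    next
      case False
      then have 0: "?h z = 0"
        by (simp add: bproj_def)
      then have "trunc (radius n) ?h z = 0" for n
        by (simp add: trunc_def)
      with 0 show ?thesis
        by simp
    qed
  qed
  then have nn: "(\<integral>\<^sup>+z. ennreal ((norm (?h z))\<^sup>2) \<partial>nu \<alpha>) \<le> ennreal (\<epsilon>\<^sup>2)"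
    by (rule LIMSEQ_le_const2) (use bound in auto)
  have int: "integrable (nu \<alpha>) (\<lambda>z. (norm (?h z))\<^sup>2)"
    using hm nn by (intro integrableI_nonneg) (auto intro: le_less_trans)
  then show "?h \<in> A2 \<alpha>"
    using h by (simp add: A2_def bproj_def)
  have "(A2_norm \<alpha> ?h)\<^sup>2 \<le> \<epsilon>\<^sup>2"
    using nn nn_integral_norm_squared[OF int] by (simp add: ennreal_le_iff)
  then show "A2_norm \<alpha> ?h \<le> \<epsilon>"
    using e by (rule power2_le_imp_le)
qed

text \<open>Since \<open>f\<close> reproduces itself, \<open>f\<close> minus the projection of its
  truncation is the projection of \<open>q n\<close>, the part of \<open>f\<close> near the sphere.
  By Cauchy-Schwarz and \<open>bproj_bounded\<close> its norm is at most that of \<open>q n\<close>,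
  which tends to 0 by dominated convergence.\<close>

theorem Hinf_dense:
  fixes f :: "complex^'n \<Rightarrow> complex^'d"
  assumes \<alpha>: "\<alpha> > - 1" and f: "f \<in> A2 \<alpha>" and e: "e > 0"
  obtains g where "g \<in> Hinf" "A2_norm \<alpha> (\<lambda>z. f z - g z) < e"
proof -
  define q where "q n z = f z - trunc (radius n) f z" for n z
  note fh = A2D(1)[OF f] and fm = A2D(4)[OF f]
  have k: "test_fun \<alpha> (radius n) (trunc (radius n) f)" for n
    by (rule test_fun_trunc[OF fh]) auto
  have qm [measurable]: "q n \<in> borel_measurable (nu \<alpha>)" for n
    unfolding q_def using fm measurable_trunc[OF fm, of "radius n"] by measurable
  have qle: "norm (q n z) \<le> norm (f z)" for n z
    by (simp add: q_def trunc_def)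
  have qi: "integrable (nu \<alpha>) (q n)" for n
    by (rule Bochner_Integration.integrable_bound[OF integrable_A2[OF \<alpha> f] qm]) (auto intro!: AE_I2 qle)
  have q2: "integrable (nu \<alpha>) (\<lambda>z. (norm (q n z))\<^sup>2)" for n
    by (rule Bochner_Integration.integrable_bound[OF A2D(2)[OF f]]) (auto intro!: AE_I2 power_mono qle)
  have "(\<lambda>n. \<integral>z. (norm (q n z))\<^sup>2 \<partial>nu \<alpha>) \<longlonglongrightarrow> (\<integral>z. 0 \<partial>(nu \<alpha> :: (complex^'n) measure))"
  proof (rule integral_dominated_convergence)
    show "integrable (nu \<alpha>) (\<lambda>z. (norm (f z))\<^sup>2)"
      by (rule A2D(2)[OF f])
    show "AE z in nu \<alpha>. (\<lambda>n. (norm (q n z))\<^sup>2) \<longlonglongrightarrow> 0"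
    proof (rule AE_I2)
      fix z assume "z \<in> space (nu \<alpha> :: (complex^'n) measure)"
      then have z: "norm z < 1"
        by simp
      show "(\<lambda>n. (norm (q n z))\<^sup>2) \<longlonglongrightarrow> 0"
        by (rule tendsto_eventually, rule eventually_mono[OF eventually_radius[OF z]]) (simp add: q_def trunc_def)
    qed
    show "AE z in nu \<alpha>. norm ((norm (q n z))\<^sup>2) \<le> (norm (f z))\<^sup>2" for n
      by (auto intro!: AE_I2 power_mono qle)
  qed measurable
  then have "\<forall>\<^sub>F n in sequentially. (\<integral>z. (norm (q n z))\<^sup>2 \<partial>nu \<alpha>) < e\<^sup>2"
    using e by (intro order_tendstoD(2)[where y="0::real"]) auto
  then obtain n where "(A2_norm \<alpha> (q n))\<^sup>2 < e\<^sup>2"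
    unfolding A2_norm_squared eventually_sequentially by blast
  then have n: "A2_norm \<alpha> (q n) < e"
    using e by (simp add: power2_less_imp_less)
  have "A2_norm \<alpha> (bproj \<alpha> (q n)) \<le> A2_norm \<alpha> (q n)"
  proof (rule bproj_bounded(2)[OF \<alpha> qi])
    fix g :: "complex^'n \<Rightarrow> complex^'d" assume "g \<in> Hinf"
    then have g: "g \<in> A2 \<alpha>"
      by (rule Hinf_subset_A2[OF \<alpha>])
    show "cmod (\<integral>w. hinner (q n w) (g w) \<partial>nu \<alpha>) \<le> A2_norm \<alpha> (q n) * A2_norm \<alpha> g"
      by (rule norm_integral_hinner_le(2)[OF qm q2 A2D(4,2)[OF g]])
  qed simp
  moreover have "bproj \<alpha> (q n) = (\<lambda>z. f z - bproj \<alpha> (trunc (radius n) f) z)"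
    using bproj_diff[OF \<alpha> integrable_A2[OF \<alpha> f] integrable_test_fun(1)[OF \<alpha> k[of n]]]
    by (simp add: q_def[abs_def] bproj_reproducing[OF \<alpha> f])
  ultimately show ?thesis
    using n by (intro that[of "bproj \<alpha> (trunc (radius n) f)"] bproj_test_fun[OF \<alpha> k]) auto
qed

text \<open>Norm 0 means vanishing almost everywhere; the reproducing formula upgrades this to every
  point.\<close>

lemma A2_norm_eq_0:
  fixes f :: "complex^'n \<Rightarrow> complex^'d"
  assumes \<alpha>: "\<alpha> > - 1" and f: "f \<in> A2 \<alpha>" and 0: "A2_norm \<alpha> f = 0"
  shows "f z = 0"
proof (cases "norm z < 1")
  case True
  have "(\<integral>z. (norm (f z))\<^sup>2 \<partial>nu \<alpha>) = 0"
    using 0 by (simp add: A2_norm_squared[symmetric])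
  then have ae: "AE w in nu \<alpha>. f w = 0"
    using integral_nonneg_eq_0_iff_AE[OF A2D(2)[OF f]] by simp
  have "(\<integral>w. cnj (Kern \<alpha> z w) *s f w \<partial>nu \<alpha>) = (\<integral>w. 0 \<partial>(nu \<alpha> :: (complex^'n) measure))"
    using ae by (intro integral_cong_AE borel_measurable_integrable[OF integrable_Kern_smult[OF \<alpha> integrable_A2[OF \<alpha> f] True]]) auto
  then have "bproj \<alpha> f z = 0"
    by (simp add: bproj_def)
  then show ?thesis
    by (simp add: bproj_reproducing[OF \<alpha> f])
qed (rule A2D(3)[OF f])

section \<open>Toeplitz operators with bounded forms\<close>

text \<open>Bounds the sesquilinear form instead of the symbol, so that an unbounded symbol can
  qualify, and a difference with one even with a small constant. The sum of squares is what
  pointwise estimates deliver; the product of norms is recovered in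
  \<open>form_bound_homogeneous\<close>.\<close>

definition form_bound :: "real \<Rightarrow> (complex^'n \<Rightarrow> 'd::finite endo) \<Rightarrow> real \<Rightarrow> bool" where
  "form_bound \<alpha> b K \<longleftrightarrow> b \<in> unit_ball \<rightarrow> clin_ops \<and> K \<ge> 0 \<and>
     (\<forall>f\<in>A2 \<alpha>. integrable (nu \<alpha>) (\<lambda>w. blinfun_apply (b w) (f w))) \<and>
     (\<forall>f\<in>A2 \<alpha>. \<forall>g\<in>A2 \<alpha>. integrable (nu \<alpha>) (\<lambda>w. hinner (blinfun_apply (b w) (f w)) (g w))) \<and>
     (\<forall>f\<in>A2 \<alpha>. \<forall>g\<in>A2 \<alpha>. cmod (\<integral>w. hinner (blinfun_apply (b w) (f w)) (g w) \<partial>nu \<alpha>)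
        \<le> K * ((A2_norm \<alpha> f)\<^sup>2 + (A2_norm \<alpha> g)\<^sup>2))"

lemma clin_opsD: "A \<in> clin_ops \<Longrightarrow> blinfun_apply A (c *s v) = c *s blinfun_apply A v"
  by (simp add: clin_ops_def)

text \<open>The bound is applied to \<open>f\<close> and \<open>g\<close> divided by their norms,
  which makes the sum of squares 2; the complex linearity of the values of \<open>b\<close> lets the
  scalars out. Functions of norm 0 vanish identically.\<close>

lemma form_bound_homogeneous:
  fixes f g :: "complex^'n \<Rightarrow> complex^'d"
  assumes \<alpha>: "\<alpha> > - 1" and b: "form_bound \<alpha> b K" and f: "f \<in> A2 \<alpha>" and g: "g \<in> A2 \<alpha>"
  shows "cmod (\<integral>w. hinner (blinfun_apply (b w) (f w)) (g w) \<partial>nu \<alpha>) \<le> 2 * K * A2_norm \<alpha> f * A2_norm \<alpha> g"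
proof (cases "A2_norm \<alpha> f = 0 \<or> A2_norm \<alpha> g = 0")
  case True
  then show ?thesis
  proof
    assume "A2_norm \<alpha> f = 0"
    then have "f = (\<lambda>_. 0)"
      using A2_norm_eq_0[OF \<alpha> f] by (simp add: fun_eq_iff)
    then show ?thesis
      by (simp add: blinfun.zero_right A2_norm_def)
  next
    assume "A2_norm \<alpha> g = 0"
    then have "g = (\<lambda>_. 0)"
      using A2_norm_eq_0[OF \<alpha> g] by (simp add: fun_eq_iff)
    then show ?thesis
      by (simp add: A2_norm_def)
  qed
next
  case False
  define s t where "s = A2_norm \<alpha> f" and "t = A2_norm \<alpha> g"
  have st: "s > 0" "t > 0"
    using False by (auto simp: s_def t_def less_le)
  let ?I = "\<integral>w. hinner (blinfun_apply (b w) (f w)) (g w) \<partial>nu \<alpha>"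
  let ?f = "\<lambda>z. of_real (1 / s) *s f z" and ?g = "\<lambda>z. of_real (1 / t) *s g z"
  have bc: "b \<in> unit_ball \<rightarrow> clin_ops"
    using b by (simp add: form_bound_def)
  have "(\<integral>w. hinner (blinfun_apply (b w) (?f w)) (?g w) \<partial>nu \<alpha>)
    = (\<integral>w. of_real (1 / (s * t)) * hinner (blinfun_apply (b w) (f w)) (g w) \<partial>nu \<alpha>)"
  proof (rule Bochner_Integration.integral_cong[OF refl])
    fix w assume "w \<in> space (nu \<alpha> :: (complex^'n) measure)"
    then have "b w \<in> clin_ops"
      using bc by auto
    then show "hinner (blinfun_apply (b w) (?f w)) (?g w) = of_real (1 / (s * t)) * hinner (blinfun_apply (b w) (f w)) (g w)"
      by (simp add: clin_opsD hinner_cmult_left hinner_cmult_right)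
  qed
  then have "(\<integral>w. hinner (blinfun_apply (b w) (?f w)) (?g w) \<partial>nu \<alpha>) = of_real (1 / (s * t)) * ?I"
    by (simp only: integral_mult_right_zero)
  moreover have "cmod (\<integral>w. hinner (blinfun_apply (b w) (?f w)) (?g w) \<partial>nu \<alpha>)
      \<le> K * ((A2_norm \<alpha> ?f)\<^sup>2 + (A2_norm \<alpha> ?g)\<^sup>2)"
  proof -
    have "cmod (\<integral>w. hinner (blinfun_apply (b w) (f w)) (g w) \<partial>nu \<alpha>) \<le> K * ((A2_norm \<alpha> f)\<^sup>2 + (A2_norm \<alpha> g)\<^sup>2)"
      if "f \<in> A2 \<alpha>" "g \<in> A2 \<alpha>" for f g
      using b that by (simp add: form_bound_def)
    from this[OF A2_cmult[OF f] A2_cmult[OF g]] show ?thesis .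
  qed
  moreover have "A2_norm \<alpha> ?f = 1" "A2_norm \<alpha> ?g = 1"
    unfolding A2_norm_cmult s_def[symmetric] t_def[symmetric] norm_of_real using st by simp_all
  ultimately have "cmod (of_real (1 / (s * t)) * ?I) \<le> 2 * K"
    by simp
  then have "cmod ?I / (s * t) \<le> 2 * K"
    unfolding norm_mult norm_of_real using st by simp
  then show ?thesis
    using st by (simp add: divide_le_eq s_def[symmetric] t_def[symmetric] mult.assoc)
qed

text \<open>For fixed \<open>f\<close> the form bound is the hypothesis of
  \<open>bproj_bounded\<close> with \<open>2 * K * A2_norm \<alpha> f\<close> in place of
  \<epsilon>.\<close>

lemma toeplitz_int_A2:
  fixes f :: "complex^'n \<Rightarrow> complex^'d"
  assumes \<alpha>: "\<alpha> > - 1" and b: "form_bound \<alpha> b K" and f: "f \<in> A2 \<alpha>"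
  shows "toeplitz_int \<alpha> b f \<in> A2 \<alpha>" "A2_norm \<alpha> (toeplitz_int \<alpha> b f) \<le> 2 * K * A2_norm \<alpha> f"
proof -
  have q: "integrable (nu \<alpha>) (\<lambda>w. blinfun_apply (b w) (f w))" and K: "K \<ge> 0"
    using b f by (auto simp: form_bound_def)
  have le: "cmod (\<integral>w. hinner (blinfun_apply (b w) (f w)) (g w) \<partial>nu \<alpha>) \<le> 2 * K * A2_norm \<alpha> f * A2_norm \<alpha> g"
    if "g \<in> Hinf" for g :: "complex^'n \<Rightarrow> complex^'d"
    by (rule form_bound_homogeneous[OF \<alpha> b f Hinf_subset_A2[OF \<alpha> that]])
  show "toeplitz_int \<alpha> b f \<in> A2 \<alpha>" "A2_norm \<alpha> (toeplitz_int \<alpha> b f) \<le> 2 * K * A2_norm \<alpha> f"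
    unfolding toeplitz_int_eq_bproj using bproj_bounded[OF \<alpha> q _ le] K by simp_all
qed

lemma bproj_cong: "(\<And>w. norm w < 1 \<Longrightarrow> q w = r w) \<Longrightarrow> bproj \<alpha> q = bproj \<alpha> r"
  unfolding bproj_def by (intro ext if_cong refl Bochner_Integration.integral_cong) simp_all

lemma toeplitz_int_bounded_ops:
  fixes b :: "complex^'n \<Rightarrow> 'd::finite endo"
  assumes \<alpha>: "\<alpha> > - 1" and b: "form_bound \<alpha> b K"
  shows "restrict (toeplitz_int \<alpha> b) (A2 \<alpha>) \<in> bounded_ops \<alpha>"
proof -
  note T = toeplitz_int_A2[OF \<alpha> b]
  have q: "integrable (nu \<alpha>) (\<lambda>w. blinfun_apply (b w) (f w))" if "f \<in> A2 \<alpha>" for f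
    using b that by (auto simp: form_bound_def)
  have bc: "b w \<in> clin_ops" if "norm w < 1" for w
    using b that by (auto simp: form_bound_def)
  have add: "toeplitz_int \<alpha> b (\<lambda>z. f z + g z) = (\<lambda>z. toeplitz_int \<alpha> b f z + toeplitz_int \<alpha> b g z)"
    if "f \<in> A2 \<alpha>" "g \<in> A2 \<alpha>" for f g
    unfolding toeplitz_int_eq_bproj blinfun.add_right by (rule bproj_add[OF \<alpha> q q]) (rule that)+
  have cmult: "toeplitz_int \<alpha> b (\<lambda>z. c *s f z) = (\<lambda>z. c *s toeplitz_int \<alpha> b f z)" if "f \<in> A2 \<alpha>" for f c
  proof -
    have "toeplitz_int \<alpha> b (\<lambda>z. c *s f z) = bproj \<alpha> (\<lambda>w. c *s blinfun_apply (b w) (f w))"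
      unfolding toeplitz_int_eq_bproj by (rule bproj_cong) (simp add: clin_opsD bc)
    also have "\<dots> = (\<lambda>z. c *s toeplitz_int \<alpha> b f z)"
      unfolding toeplitz_int_eq_bproj by (rule bproj_cmult[OF \<alpha> q[OF that]])
    finally show ?thesis .
  qed
  show ?thesis
    unfolding bounded_ops_def
  proof (intro CollectI conjI ballI allI)
    show "restrict (toeplitz_int \<alpha> b) (A2 \<alpha>) \<in> A2 \<alpha> \<rightarrow>\<^sub>E A2 \<alpha>"
      using T(1) by auto
    show "\<exists>C. \<forall>f\<in>A2 \<alpha>. A2_norm \<alpha> (restrict (toeplitz_int \<alpha> b) (A2 \<alpha>) f) \<le> C * A2_norm \<alpha> f"
      using T(2) by (intro exI[of _ "2 * K"]) simp
  qed (simp_all add: A2_add A2_cmult add cmult)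
qed

text \<open>Both operators are continuous and agree on a dense set; off \<open>A2\<close> both are
  \<open>undefined\<close>, being extensional. This makes the description in \<open>toeplitz\<close>
  unique.\<close>

lemma bounded_ops_unique:
  fixes S T :: "('n::finite, 'd::finite) fun_op"
  assumes \<alpha>: "\<alpha> > - 1" and S: "S \<in> bounded_ops \<alpha>" and T: "T \<in> bounded_ops \<alpha>"
    and eq: "\<And>f. f \<in> Hinf \<Longrightarrow> S f = T f"
  shows "S = T"
proof (rule ext)
  fix f :: "complex^'n \<Rightarrow> complex^'d"
  show "S f = T f"
  proof (cases "f \<in> A2 \<alpha>")
    case False
    then show ?thesis
      using S T by (auto simp: bounded_ops_def dest!: PiE_arb)
  next
    case f: True
    have bdd: "\<exists>C. \<forall>f\<in>A2 \<alpha>. A2_norm \<alpha> (R f) \<le> C * A2_norm \<alpha> f" if "R \<in> bounded_ops \<alpha>" for R :: "('n, 'd) fun_op"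
      using that by (simp add: bounded_ops_def)
    obtain C1 where C1: "\<forall>f\<in>A2 \<alpha>. A2_norm \<alpha> (S f) \<le> C1 * A2_norm \<alpha> f"
      using bdd[OF S] ..
    obtain C2 where C2: "\<forall>f\<in>A2 \<alpha>. A2_norm \<alpha> (T f) \<le> C2 * A2_norm \<alpha> f"
      using bdd[OF T] ..
    have mem: "S f \<in> A2 \<alpha>" "T f \<in> A2 \<alpha>" if "f \<in> A2 \<alpha>" for f
      using S T that by (auto simp: bounded_ops_def)
    define D where "D z = S f z - T f z" for z
    have D: "D \<in> A2 \<alpha>"
      unfolding D_def[abs_def] by (rule A2_diff(1)[OF mem(1)[OF f] mem(2)[OF f]])
    \<comment> \<open>Bounds the squared norm of \<open>S h - T h\<close> in terms of that of
      \<open>h\<close>; the summand 1 only keeps \<open>A\<close> positive for the division in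
      \<open>e / A\<close>.\<close>
    define A where "A = 2 * C1\<^sup>2 + 2 * C2\<^sup>2 + 1"
    have A: "A > 0"
      by (simp add: A_def add_nonneg_pos)
    have "(A2_norm \<alpha> D)\<^sup>2 \<le> 0 + e" if e: "e > 0" for e
    proof -
      obtain g where g: "g \<in> Hinf" and le: "A2_norm \<alpha> (\<lambda>z. f z - g z) < sqrt (e / A)"
        using Hinf_dense[OF \<alpha> f, of "sqrt (e / A)"] e A by auto
      have g2: "g \<in> A2 \<alpha>"
        by (rule Hinf_subset_A2[OF \<alpha> g])
      define h where "h z = f z - g z" for z
      have h: "h \<in> A2 \<alpha>"
        unfolding h_def[abs_def] by (rule A2_diff(1)[OF f g2])
      have fgh: "f = (\<lambda>z. g z + h z)"
        by (simp add: h_def fun_eq_iff)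
      have "S f = (\<lambda>z. S g z + S h z)" "T f = (\<lambda>z. T g z + T h z)"
        using S T g2 h unfolding fgh bounded_ops_def by blast+
      then have "D = (\<lambda>z. S h z - T h z)"
        by (simp add: D_def fun_eq_iff eq[OF g])
      then have "(A2_norm \<alpha> D)\<^sup>2 \<le> 2 * (A2_norm \<alpha> (S h))\<^sup>2 + 2 * (A2_norm \<alpha> (T h))\<^sup>2"
        using A2_diff(2)[OF mem(1)[OF h] mem(2)[OF h]] by simp
      also have "\<dots> \<le> 2 * (C1 * A2_norm \<alpha> h)\<^sup>2 + 2 * (C2 * A2_norm \<alpha> h)\<^sup>2"
        using bspec[OF C1 h] bspec[OF C2 h] by (intro add_mono mult_left_mono power_mono) auto
      also have "\<dots> \<le> A * (A2_norm \<alpha> h)\<^sup>2"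
        by (simp add: A_def power_mult_distrib algebra_simps)
      also have "\<dots> \<le> A * (sqrt (e / A))\<^sup>2"
        using le A by (intro mult_left_mono power_mono) (auto simp: h_def[abs_def])
      also have "\<dots> = e"
        using A e by simp
      finally show ?thesis
        by simp
    qed
    then have "(A2_norm \<alpha> D)\<^sup>2 \<le> 0"
      by (rule field_le_epsilon)
    then have "A2_norm \<alpha> D = 0"
      by simp
    from A2_norm_eq_0[OF \<alpha> D this] show ?thesis
      by (simp add: D_def fun_eq_iff)
  qed
qed

text \<open>Under a form bound the integral formula is already a bounded operator on all of
  \<open>A2\<close>, so by uniqueness it is the extension from \<open>Hinf\<close>.\<close>

theorem toeplitz_eq:
  fixes b :: "complex^'n \<Rightarrow> 'd::finite endo"
  assumes \<alpha>: "\<alpha> > - 1" and b: "form_bound \<alpha> b K"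
  shows "toeplitz \<alpha> b = restrict (toeplitz_int \<alpha> b) (A2 \<alpha>)"
  unfolding toeplitz_def
proof (rule the_equality)
  note T0 = toeplitz_int_bounded_ops[OF \<alpha> b]
  have H: "restrict (toeplitz_int \<alpha> b) (A2 \<alpha>) f = toeplitz_int \<alpha> b f" if "f \<in> Hinf" for f
    using Hinf_subset_A2[OF \<alpha> that] by simp
  then show "restrict (toeplitz_int \<alpha> b) (A2 \<alpha>) \<in> bounded_ops \<alpha> \<and>
      (\<forall>f\<in>Hinf. restrict (toeplitz_int \<alpha> b) (A2 \<alpha>) f = toeplitz_int \<alpha> b f)"
    using T0 by simp
  fix T assume T: "T \<in> bounded_ops \<alpha> \<and> (\<forall>f\<in>Hinf. T f = toeplitz_int \<alpha> b f)"
  show "T = restrict (toeplitz_int \<alpha> b) (A2 \<alpha>)"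
    by (rule bounded_ops_unique[OF \<alpha> _ T0]) (use T H in auto)
qed

lemma toeplitz_bounded_ops:
  assumes "\<alpha> > - 1" and "form_bound \<alpha> b K"
  shows "toeplitz \<alpha> b \<in> bounded_ops \<alpha>"
  using toeplitz_int_bounded_ops[OF assms] by (simp only: toeplitz_eq[OF assms])

text \<open>The bounds for \<open>b\<close> and \<open>c\<close> identify both operators with their
  integral formulas; the difference is then the integral formula of \<open>b - c\<close>, and only
  the form of \<open>b - c\<close> enters the estimate.\<close>

theorem op_norm_toeplitz_diff_le:
  fixes b c :: "complex^'n \<Rightarrow> 'd::finite endo"
  assumes \<alpha>: "\<alpha> > - 1" and b: "form_bound \<alpha> b K" and c: "form_bound \<alpha> c L"
    and d: "form_bound \<alpha> (\<lambda>w. b w - c w) \<epsilon>"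
  shows "op_norm \<alpha> (\<lambda>f z. toeplitz \<alpha> b f z - toeplitz \<alpha> c f z) \<le> 2 * \<epsilon>"
  unfolding op_norm_def
proof (rule cSUP_least)
  have "(\<lambda>_. 0) \<in> (A2 \<alpha> :: (complex^'n \<Rightarrow> complex^'d) set)"
    unfolding A2_def holomorphic_vec_def
    by (auto intro!: exI[of _ "\<lambda>_. 0"])
  moreover have "A2_norm \<alpha> ((\<lambda>_. 0) :: complex^'n \<Rightarrow> complex^'d) \<le> 1"
    by (simp add: A2_norm_def)
  ultimately show "{f \<in> A2 \<alpha>. A2_norm \<alpha> f \<le> 1} \<noteq> ({} :: (complex^'n \<Rightarrow> complex^'d) set)"
    by blast
  fix f :: "complex^'n \<Rightarrow> complex^'d" assume "f \<in> {f \<in> A2 \<alpha>. A2_norm \<alpha> f \<le> 1}"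
  then have f: "f \<in> A2 \<alpha>" and le: "A2_norm \<alpha> f \<le> 1"
    by auto
  have "(\<lambda>z. toeplitz \<alpha> b f z - toeplitz \<alpha> c f z) = toeplitz_int \<alpha> (\<lambda>w. b w - c w) f"
    unfolding toeplitz_eq[OF \<alpha> b] toeplitz_eq[OF \<alpha> c] restrict_apply'[OF f] toeplitz_int_eq_bproj blinfun.diff_left
    by (rule bproj_diff[OF \<alpha>, symmetric]) (use b c f in \<open>auto simp: form_bound_def\<close>)
  then have "A2_norm \<alpha> (\<lambda>z. toeplitz \<alpha> b f z - toeplitz \<alpha> c f z) \<le> 2 * \<epsilon> * A2_norm \<alpha> f"
    using toeplitz_int_A2(2)[OF \<alpha> d f] by simp
  also have "\<dots> \<le> 2 * \<epsilon> * 1"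
    using d le by (intro mult_left_mono) (auto simp: form_bound_def)
  finally show "A2_norm \<alpha> (\<lambda>z. toeplitz \<alpha> b f z - toeplitz \<alpha> c f z) \<le> 2 * \<epsilon>"
    by simp
qed

section \<open>Carleson measures\<close>

lemma measurable_blinfun_apply [measurable]:
  fixes b :: "'a \<Rightarrow> ('c::euclidean_space \<Rightarrow>\<^sub>L 'e::euclidean_space)"
  assumes "b \<in> borel_measurable M" "f \<in> borel_measurable M"
  shows "(\<lambda>x. blinfun_apply (b x) (f x)) \<in> borel_measurable M"
  using assms by (rule borel_measurable_continuous_Pair) (intro continuous_intros)

lemma measurable_pair_norm_kern:
  "(\<lambda>x. (cmod (kern \<alpha> (fst x) (snd x)))\<^sup>2) \<in> borel_measurable (nu \<alpha> \<Otimes>\<^sub>M nu \<alpha> :: ((complex^'n) \<times> (complex^'n)) measure)"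
proof -
  have 1: "(\<lambda>x. (1 - (norm (fst x))\<^sup>2) powr p) \<in> borel_measurable (nu \<alpha> \<Otimes>\<^sub>M nu \<alpha> :: ((complex^'n) \<times> (complex^'n)) measure)" for p
    by (intro measurable_pair_continuous continuous_intros) (auto simp: abs_square_eq_1)
  have eq: "(cmod (kern \<alpha> z w))\<^sup>2 = ((1 - (norm z)\<^sup>2) powr ((real CARD('n) + 1 + \<alpha>) / 2))\<^sup>2 * (cmod (Kern \<alpha> z w))\<^sup>2"
    for z w :: "complex^'n"
    by (simp add: kern_def norm_mult power_mult_distrib)
  show ?thesis
    unfolding eq
    by (intro borel_measurable_times borel_measurable_power 1
        measurable_compose[OF measurable_pair_Kern borel_measurable_norm])
qed

text \<open>\<open>phi\<close> is defined by cases in its first argument. Its norm is nevertheless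
  jointly continuous, by the formula \<open>one_minus_norm_phi\<close>, and
  \<open>local_kern\<close> uses the norm only.\<close>

lemma measurable_pair_norm_phi:
  "(\<lambda>x. norm (phi (fst x) (snd x))) \<in> borel_measurable (nu \<alpha> \<Otimes>\<^sub>M nu \<alpha> :: ((complex^'n) \<times> (complex^'n)) measure)"
proof -
  have c: "continuous_on (unit_ball \<times> unit_ball) (\<lambda>x :: (complex^'n) \<times> (complex^'n).
      sqrt (1 - (1 - (norm (fst x))\<^sup>2) * (1 - (norm (snd x))\<^sup>2) / (cmod (1 - hinner (snd x) (fst x)))\<^sup>2))"
  proof (intro continuous_intros continuous_on_pair_hinner ballI)
    fix x :: "(complex^'n) \<times> (complex^'n)" assume "x \<in> unit_ball \<times> unit_ball"
    then show "(cmod (1 - hinner (snd x) (fst x)))\<^sup>2 \<noteq> 0"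
      using one_minus_hinner_nz[of "snd x" "fst x"] by auto
  qed
  have e: "norm (phi w v) = sqrt (1 - (1 - (norm w)\<^sup>2) * (1 - (norm v)\<^sup>2) / (cmod (1 - hinner v w))\<^sup>2)"
    if "norm w < 1" "norm v < 1" for w v :: "complex^'n"
    unfolding one_minus_norm_phi[OF that, symmetric] by simp
  have "continuous_on (unit_ball \<times> unit_ball) (\<lambda>x :: (complex^'n) \<times> (complex^'n). norm (phi (fst x) (snd x)))"
    by (rule continuous_on_eq[OF c]) (auto simp: e)
  then show ?thesis
    by (rule measurable_pair_continuous)
qed

text \<open>For fixed \<open>w\<close> in the ball, the density of the image under
  \<open>phi w\<close> of \<open>nu\<close> restricted to \<open>ball 0 r\<close>.\<close>

definition local_kern :: "real \<Rightarrow> real \<Rightarrow> complex^'n \<Rightarrow> complex^'n \<Rightarrow> real" where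
  "local_kern \<alpha> r w v = (if norm (phi w v) < r then (cmod (kern \<alpha> w v))\<^sup>2 else 0)"

lemma local_kern_nonneg [simp]: "local_kern \<alpha> r w v \<ge> 0"
  by (simp add: local_kern_def)

lemma measurable_pair_local_kern [measurable]:
  "(\<lambda>x. local_kern \<alpha> r (fst x) (snd x)) \<in> borel_measurable (nu \<alpha> \<Otimes>\<^sub>M nu \<alpha> :: ((complex^'n) \<times> (complex^'n)) measure)"
  unfolding local_kern_def
  by (intro measurable_If measurable_pair_norm_kern borel_measurable_const
      borel_measurable_less[OF measurable_pair_norm_phi borel_measurable_const])

lemma measurable_local_kern:
  fixes w v :: "complex^'n"
  shows "norm w < 1 \<Longrightarrow> (\<lambda>v. local_kern \<alpha> r w v) \<in> borel_measurable (nu \<alpha>)"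
    and "norm v < 1 \<Longrightarrow> (\<lambda>w. local_kern \<alpha> r w v) \<in> borel_measurable (nu \<alpha>)"
  using measurable_compose[OF measurable_Pair1'[of w "nu \<alpha>" "nu \<alpha>"] measurable_pair_local_kern[of \<alpha> r]]
    measurable_compose[OF measurable_Pair2'[of v "nu \<alpha>" "nu \<alpha>"] measurable_pair_local_kern[of \<alpha> r]]
  by simp_all

definition cmp_const :: "'n::finite itself \<Rightarrow> real \<Rightarrow> real" where
  "cmp_const _ \<alpha> = (16 / 3) powr (real CARD('n) + 1 + \<alpha>)"

text \<open>The two squared kernels differ only in the numerators \<open>a\<close> and
  \<open>b\<close>. On the Bergman ball of radius 1/2, \<open>one_minus_norm_phi\<close> gives
  \<open>3/4 * T\<^sup>2 \<le> a * b\<close>, and \<open>a \<le> 2 * T\<close> always; hence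
  \<open>a \<le> 16/3 * b\<close>, the base in \<open>cmp_const\<close>.\<close>

lemma norm_kern_swap_le:
  fixes w v :: "complex^'n"
  assumes \<alpha>: "\<alpha> > - 1" and w: "norm w < 1" and v: "norm v < 1" and p: "norm (phi w v) < 1/2"
  shows "(cmod (kern \<alpha> w v))\<^sup>2 \<le> cmp_const TYPE('n) \<alpha> * (cmod (kern \<alpha> v w))\<^sup>2"
proof -
  define T where "T = cmod (1 - hinner v w)"
  define a b where "a = 1 - (norm w)\<^sup>2" and "b = 1 - (norm v)\<^sup>2"
  have T: "T > 0"
    using one_minus_hinner_nz[OF v w] by (simp add: T_def)
  have a: "a > 0" and b: "b > 0"
    using one_minus_norm2_pos[OF w] one_minus_norm2_pos[OF v] by (simp_all add: a_def b_def)
  have Teq: "cmod (1 - hinner w v) = T"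
    unfolding T_def by (metis cnj_hinner complex_cnj_diff complex_cnj_one complex_mod_cnj)
  have "(norm (phi w v))\<^sup>2 \<le> (1/2)\<^sup>2"
    using p by (intro power_mono) auto
  moreover have "1 - (norm (phi w v))\<^sup>2 = a * b / T\<^sup>2"
    unfolding a_def b_def T_def by (rule one_minus_norm_phi[OF w v])
  moreover have "(1/2::real)\<^sup>2 = 1/4"
    by (simp add: power2_eq_square)
  ultimately have "3/4 \<le> a * b / T\<^sup>2"
    by linarith
  then have "3/4 * T\<^sup>2 \<le> a * b"
    using T by (simp add: le_divide_eq)
  moreover have "a / 2 \<le> T"
  proof -
    have "cmod (hinner v w) \<le> norm w"
      using norm_hinner_le[of v w] mult_left_le_one_le[of "norm w" "norm v"] v by simp
    then have "1 - norm w \<le> T"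
      using norm_triangle_ineq2[of 1 "hinner v w"] by (simp add: T_def)
    moreover have "a \<le> 2 * (1 - norm w)"
      using zero_le_power2[of "1 - norm w"] by (simp add: a_def power2_eq_square algebra_simps)
    ultimately show ?thesis
      by simp
  qed
  then have "(a / 2)\<^sup>2 \<le> T\<^sup>2"
    using a by (intro power_mono) auto
  ultimately have "a * (3/16 * a) \<le> a * b"
    by (simp add: power2_eq_square)
  then have "a \<le> 16/3 * b"
    using a by simp
  then have "a / T\<^sup>2 \<le> 16/3 * (b / T\<^sup>2)"
    using divide_right_mono[of a "16/3 * b" "T\<^sup>2"] by simp
  then have "(a / T\<^sup>2) powr (real CARD('n) + 1 + \<alpha>) \<le> (16/3 * (b / T\<^sup>2)) powr (real CARD('n) + 1 + \<alpha>)"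
    using a T \<alpha> by (intro powr_mono2) auto
  also have "\<dots> = (16/3) powr (real CARD('n) + 1 + \<alpha>) * (b / T\<^sup>2) powr (real CARD('n) + 1 + \<alpha>)"
    by (rule powr_mult)
  finally show ?thesis
    unfolding norm_kern_squared[OF w v] norm_kern_squared[OF v w] Teq cmp_const_def
    by (simp add: a_def b_def T_def)
qed

text \<open>The measures \<open>norm (b w) d nu\<close> of this kind are the Carleson measures for the Bergman space.\<close>

definition carleson :: "real \<Rightarrow> (complex^'n \<Rightarrow> 'd::finite endo) \<Rightarrow> real \<Rightarrow> bool" where
  "carleson \<alpha> b M \<longleftrightarrow> b \<in> borel_measurable (nu \<alpha>) \<and> M \<ge> 0 \<and>
     (AE v in nu \<alpha>. (\<integral>\<^sup>+w. ennreal (norm (b w)) * ennreal ((cmod (kern \<alpha> v w))\<^sup>2) \<partial>nu \<alpha>) \<le> ennreal M)"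

text \<open>Tonelli brings the integral over \<open>w\<close> inside. There the kernel centred at
  \<open>w\<close> is replaced by the one centred at \<open>v\<close>, at the cost of
  \<open>cmp_const\<close>, and the Carleson property bounds the inner integral for almost every
  \<open>v\<close>.\<close>

lemma carleson_local:
  fixes b :: "complex^'n \<Rightarrow> 'd::finite endo" and h :: "complex^'n \<Rightarrow> ennreal"
  assumes \<alpha>: "\<alpha> > - 1" and b: "carleson \<alpha> b M" and h [measurable]: "h \<in> borel_measurable (nu \<alpha>)"
  shows "(\<integral>\<^sup>+w. ennreal (norm (b w)) * (\<integral>\<^sup>+v. ennreal (local_kern \<alpha> (1/2) w v) * h v \<partial>nu \<alpha>) \<partial>nu \<alpha>)
    \<le> ennreal (cmp_const TYPE('n) \<alpha> * M) * (\<integral>\<^sup>+v. h v \<partial>nu \<alpha>)"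
proof -
  let ?N = "nu \<alpha> :: (complex^'n) measure"
  interpret N: finite_measure ?N
    by (rule finite_measure_nu[OF \<alpha>])
  interpret P: pair_sigma_finite ?N ?N ..
  have [measurable]: "b \<in> borel_measurable ?N"
    using b by (simp add: carleson_def)
  define k where "k w v = ennreal (local_kern \<alpha> (1/2) w v)" for w v :: "complex^'n"
  define C where "C = cmp_const TYPE('n) \<alpha>"
  have C: "C \<ge> 0"
    by (simp add: C_def cmp_const_def)
  have km: "(\<lambda>x. k (fst x) (snd x)) \<in> borel_measurable (?N \<Otimes>\<^sub>M ?N)"
    unfolding k_def by measurable
  note [measurable] = km
  have km1: "(\<lambda>v. k w v) \<in> borel_measurable ?N" if "w \<in> space ?N" for w
    using that unfolding k_def by (intro measurable_compose[OF measurable_local_kern(1) measurable_ennreal]) simp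
  have m: "(\<lambda>(w, v). ennreal (norm (b w)) * (k w v * h v)) \<in> borel_measurable (?N \<Otimes>\<^sub>M ?N)"
    unfolding split_beta' by measurable
  have "(\<integral>\<^sup>+w. ennreal (norm (b w)) * (\<integral>\<^sup>+v. k w v * h v \<partial>?N) \<partial>?N)
      = (\<integral>\<^sup>+w. (\<integral>\<^sup>+v. ennreal (norm (b w)) * (k w v * h v) \<partial>?N) \<partial>?N)"
    by (intro nn_integral_cong nn_integral_cmult[symmetric] borel_measurable_times_ennreal km1 h)
  also have "\<dots> = (\<integral>\<^sup>+v. (\<integral>\<^sup>+w. ennreal (norm (b w)) * (k w v * h v) \<partial>?N) \<partial>?N)"
    by (rule P.Fubini'[OF m, symmetric])
  also have "\<dots> \<le> (\<integral>\<^sup>+v. ennreal (C * M) * h v \<partial>?N)"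
  proof (rule nn_integral_mono_AE)
    have "AE v in ?N. (\<integral>\<^sup>+w. ennreal (norm (b w)) * ennreal ((cmod (kern \<alpha> v w))\<^sup>2) \<partial>?N) \<le> ennreal M"
      using b by (simp add: carleson_def)
    then show "AE v in ?N. (\<integral>\<^sup>+w. ennreal (norm (b w)) * (k w v * h v) \<partial>?N) \<le> ennreal (C * M) * h v"
    proof (rule AE_mp, intro AE_I2 impI)
      fix v assume "v \<in> space ?N"
        and le: "(\<integral>\<^sup>+w. ennreal (norm (b w)) * ennreal ((cmod (kern \<alpha> v w))\<^sup>2) \<partial>?N) \<le> ennreal M"
      then have v: "norm v < 1"
        by simp
      have "(\<integral>\<^sup>+w. ennreal (norm (b w)) * (k w v * h v) \<partial>?N)
        \<le> (\<integral>\<^sup>+w. ennreal C * h v * (ennreal (norm (b w)) * ennreal ((cmod (kern \<alpha> v w))\<^sup>2)) \<partial>?N)"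
      proof (rule nn_integral_mono)
        fix w assume "w \<in> space ?N"
        then have w: "norm w < 1"
          by simp
        have "k w v \<le> ennreal C * ennreal ((cmod (kern \<alpha> v w))\<^sup>2)"
          using norm_kern_swap_le[OF \<alpha> w v] C
          by (auto simp: k_def local_kern_def C_def ennreal_mult[symmetric] intro: ennreal_leI)
        then have "ennreal (norm (b w)) * h v * k w v \<le> ennreal (norm (b w)) * h v * (ennreal C * ennreal ((cmod (kern \<alpha> v w))\<^sup>2))"
          by (rule mult_left_mono) simp
        then show "ennreal (norm (b w)) * (k w v * h v) \<le> ennreal C * h v * (ennreal (norm (b w)) * ennreal ((cmod (kern \<alpha> v w))\<^sup>2))"
          by (simp only: mult_ac)
      qed
      also have "\<dots> = ennreal C * h v * (\<integral>\<^sup>+w. ennreal (norm (b w)) * ennreal ((cmod (kern \<alpha> v w))\<^sup>2) \<partial>?N)"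
        by (intro nn_integral_cmult borel_measurable_times_ennreal
            measurable_compose[OF measurable_norm_kern[OF v] measurable_ennreal]) measurable
      also have "\<dots> \<le> ennreal C * h v * ennreal M"
        by (rule mult_left_mono[OF le]) simp
      also have "\<dots> = ennreal (C * M) * h v"
        using C b by (simp add: ennreal_mult carleson_def mult_ac)
      finally show "(\<integral>\<^sup>+w. ennreal (norm (b w)) * (k w v * h v) \<partial>?N) \<le> ennreal (C * M) * h v" .
    qed
  qed
  also have "\<dots> = ennreal (C * M) * (\<integral>\<^sup>+v. h v \<partial>?N)"
    by (rule nn_integral_cmult[OF h])
  finally show ?thesis
    by (simp only: k_def C_def)
qed

text \<open>The substitution \<open>phi w\<close> trades the moving argument of \<open>f\<close> for
  a kernel. In this form the mass is an integral of a jointly measurable function and fits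
  \<open>carleson_local\<close>.\<close>

lemma local_mass_eq:
  fixes f :: "complex^'n \<Rightarrow> complex^'d"
  assumes f [measurable]: "f \<in> borel_measurable (nu \<alpha>)" and w: "norm w < 1"
  shows "local_mass \<alpha> f w = (\<integral>\<^sup>+v. ennreal (local_kern \<alpha> (1/2) w v) * ennreal ((norm (f v))\<^sup>2) \<partial>nu \<alpha>)"
proof -
  note [measurable] = measurable_phi_nu[OF w, of \<alpha>]
  have m: "(\<lambda>v. indicator (ball 0 (1/2)) (phi w v) * ennreal ((norm (f v))\<^sup>2)) \<in> borel_measurable (nu \<alpha>)"
    by measurable
  have "local_mass \<alpha> f w = (\<integral>\<^sup>+v. indicator (ball 0 (1/2)) (phi w (phi w v)) * ennreal ((norm (f (phi w v)))\<^sup>2) \<partial>nu \<alpha>)"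
    unfolding local_mass_def by (intro nn_integral_cong) (simp add: phi_phi w)
  also have "\<dots> = (\<integral>\<^sup>+v. indicator (ball 0 (1/2)) (phi w v) * ennreal ((norm (f v))\<^sup>2) * ennreal ((cmod (kern \<alpha> w v))\<^sup>2) \<partial>nu \<alpha>)"
    by (rule nn_integral_nu_phi'[OF w m])
  also have "\<dots> = (\<integral>\<^sup>+v. ennreal (local_kern \<alpha> (1/2) w v) * ennreal ((norm (f v))\<^sup>2) \<partial>nu \<alpha>)"
    by (intro nn_integral_cong) (simp add: indicator_def local_kern_def mult.commute)
  finally show ?thesis .
qed

lemma measurable_local_mass [measurable]:
  fixes f :: "complex^'n \<Rightarrow> complex^'d"
  assumes \<alpha>: "\<alpha> > - 1" and f [measurable]: "f \<in> borel_measurable (nu \<alpha>)"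
  shows "local_mass \<alpha> f \<in> borel_measurable (nu \<alpha>)"
proof -
  interpret finite_measure "nu \<alpha> :: (complex^'n) measure"
    by (rule finite_measure_nu[OF \<alpha>])
  have "(\<lambda>(w, v). ennreal (local_kern \<alpha> (1/2) w v) * ennreal ((norm (f v))\<^sup>2))
      \<in> borel_measurable (nu \<alpha> \<Otimes>\<^sub>M nu \<alpha> :: ((complex^'n) \<times> (complex^'n)) measure)"
    unfolding split_beta' by measurable
  from borel_measurable_nn_integral[OF this] show ?thesis
    by (rule measurable_cong[THEN iffD1, rotated]) (simp add: local_mass_eq f)
qed

lemma carleson_local_mass:
  fixes b :: "complex^'n \<Rightarrow> 'd::finite endo"
  assumes \<alpha>: "\<alpha> > - 1" and b: "carleson \<alpha> b M" and f: "f \<in> A2 \<alpha>"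
  shows "(\<integral>\<^sup>+w. ennreal (norm (b w)) * local_mass \<alpha> f w \<partial>nu \<alpha>) \<le> ennreal (cmp_const TYPE('n) \<alpha> * M * (A2_norm \<alpha> f)\<^sup>2)"
proof -
  note [measurable] = A2D(4)[OF f]
  have "(\<integral>\<^sup>+w. ennreal (norm (b w)) * local_mass \<alpha> f w \<partial>nu \<alpha>)
    = (\<integral>\<^sup>+w. ennreal (norm (b w)) * (\<integral>\<^sup>+v. ennreal (local_kern \<alpha> (1/2) w v) * ennreal ((norm (f v))\<^sup>2) \<partial>nu \<alpha>) \<partial>nu \<alpha>)"
    by (intro nn_integral_cong) (simp add: local_mass_eq A2D(4)[OF f])
  also have "\<dots> \<le> ennreal (cmp_const TYPE('n) \<alpha> * M) * (\<integral>\<^sup>+v. ennreal ((norm (f v))\<^sup>2) \<partial>nu \<alpha>)"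
    by (rule carleson_local[OF \<alpha> b]) measurable
  also have "\<dots> = ennreal (cmp_const TYPE('n) \<alpha> * M * (A2_norm \<alpha> f)\<^sup>2)"
    unfolding nn_integral_norm_squared[OF A2D(2)[OF f]] using b
    by (simp add: ennreal_mult carleson_def cmp_const_def)
  finally show ?thesis .
qed

lemma norm_apply_hinner_le: "cmod (hinner (blinfun_apply A x) y) \<le> norm A * (((norm x)\<^sup>2 + (norm y)\<^sup>2) / 2)"
proof -
  have "cmod (hinner (blinfun_apply A x) y) \<le> norm (blinfun_apply A x) * norm y"
    by (rule norm_hinner_le)
  also have "\<dots> \<le> norm A * norm x * norm y"
    by (intro mult_right_mono norm_blinfun) simp
  also have "\<dots> = norm A * (norm x * norm y)"
    by (rule mult.assoc)
  also have "\<dots> \<le> norm A * (((norm x)\<^sup>2 + (norm y)\<^sup>2) / 2)"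
    using zero_le_power2[of "norm x - norm y"] by (intro mult_left_mono) (auto simp: power2_eq_square algebra_simps)
  finally show ?thesis .
qed

text \<open>An embedding of \<open>A2\<close> into the square integrable functions for the measure
  \<open>norm (b w) d nu\<close> controls the form, by \<open>norm_apply_hinner_le\<close>. The
  image of \<open>f\<close> itself is integrable because
  \<open>norm (f w) \<le> 1 + (norm (f w))\<^sup>2\<close> and \<open>b\<close> is
  integrable.\<close>

lemma form_boundI:
  fixes b :: "complex^'n \<Rightarrow> 'd::finite endo"
  assumes \<alpha>: "\<alpha> > - 1" and clin: "b \<in> unit_ball \<rightarrow> clin_ops" and int: "integrable (nu \<alpha>) b" and A: "A \<ge> 0"
    and emb: "\<And>f :: complex^'n \<Rightarrow> complex^'d. f \<in> A2 \<alpha> \<Longrightarrow> (\<integral>\<^sup>+w. ennreal (norm (b w) * (norm (f w))\<^sup>2) \<partial>nu \<alpha>) \<le> ennreal (A * (A2_norm \<alpha> f)\<^sup>2)"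
  shows "form_bound \<alpha> b A"
  unfolding form_bound_def
proof (intro conjI ballI)
  have bm [measurable]: "b \<in> borel_measurable (nu \<alpha>)"
    using int by simp
  have i2: "integrable (nu \<alpha>) (\<lambda>w. norm (b w) * (norm (f w))\<^sup>2)"
    and le2: "(\<integral>w. norm (b w) * (norm (f w))\<^sup>2 \<partial>nu \<alpha>) \<le> A * (A2_norm \<alpha> f)\<^sup>2" if f: "f \<in> A2 \<alpha>" for f :: "complex^'n \<Rightarrow> complex^'d"
  proof -
    note [measurable] = A2D(4)[OF f]
    show i: "integrable (nu \<alpha>) (\<lambda>w. norm (b w) * (norm (f w))\<^sup>2)"
      using emb[OF f] by (intro integrableI_nonneg) (auto intro: le_less_trans)
    show "(\<integral>w. norm (b w) * (norm (f w))\<^sup>2 \<partial>nu \<alpha>) \<le> A * (A2_norm \<alpha> f)\<^sup>2"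
      using emb[OF f] nn_integral_eq_integral[OF i] A by (simp add: ennreal_le_iff)
  qed
  fix f :: "complex^'n \<Rightarrow> complex^'d" assume f: "f \<in> A2 \<alpha>"
  note [measurable] = A2D(4)[OF f]
  show "integrable (nu \<alpha>) (\<lambda>w. blinfun_apply (b w) (f w))"
  proof (rule Bochner_Integration.integrable_bound)
    show "integrable (nu \<alpha>) (\<lambda>w. norm (b w) + norm (b w) * (norm (f w))\<^sup>2)"
      using int i2[OF f] by simp
    have "norm (blinfun_apply (b w) (f w)) \<le> norm (b w) + norm (b w) * (norm (f w))\<^sup>2" for w
    proof -
      have "norm (blinfun_apply (b w) (f w)) \<le> norm (b w) * norm (f w)"
        by (rule norm_blinfun)
      also have "\<dots> \<le> norm (b w) * (1 + (norm (f w))\<^sup>2)"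
        using zero_le_power2[of "norm (f w) - 1/2"] by (intro mult_left_mono) (auto simp: power2_eq_square algebra_simps)
      finally show ?thesis
        by (simp add: algebra_simps)
    qed
    then show "AE w in nu \<alpha>. norm (blinfun_apply (b w) (f w)) \<le> norm (norm (b w) + norm (b w) * (norm (f w))\<^sup>2)"
      by (intro AE_I2) (simp add: add_nonneg_nonneg)
  qed measurable
  fix g :: "complex^'n \<Rightarrow> complex^'d" assume g: "g \<in> A2 \<alpha>"
  note [measurable] = A2D(4)[OF g]
  have i: "integrable (nu \<alpha>) (\<lambda>w. norm (b w) * (((norm (f w))\<^sup>2 + (norm (g w))\<^sup>2) / 2))"
    using i2[OF f] i2[OF g] by (simp add: algebra_simps)
  show int': "integrable (nu \<alpha>) (\<lambda>w. hinner (blinfun_apply (b w) (f w)) (g w))"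
    by (rule Bochner_Integration.integrable_bound[OF i]) (measurable, intro AE_I2, unfold real_norm_def, rule order_trans[OF norm_apply_hinner_le abs_ge_self])
  from int' have "cmod (\<integral>w. hinner (blinfun_apply (b w) (f w)) (g w) \<partial>nu \<alpha>)
    \<le> (\<integral>w. norm (b w) * (((norm (f w))\<^sup>2 + (norm (g w))\<^sup>2) / 2) \<partial>nu \<alpha>)"
    using i by (rule Bochner_Integration.integral_norm_bound_integral) (rule norm_apply_hinner_le)
  also have "\<dots> = ((\<integral>w. norm (b w) * (norm (f w))\<^sup>2 \<partial>nu \<alpha>) + (\<integral>w. norm (b w) * (norm (g w))\<^sup>2 \<partial>nu \<alpha>)) / 2"
    using i2[OF f] i2[OF g] by (simp add: distrib_left add_divide_distrib)
  also have "\<dots> \<le> (A * (A2_norm \<alpha> f)\<^sup>2 + A * (A2_norm \<alpha> g)\<^sup>2) / 2"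
    using le2[OF f] le2[OF g] by simp
  also have "\<dots> \<le> A * ((A2_norm \<alpha> f)\<^sup>2 + (A2_norm \<alpha> g)\<^sup>2)"
    using A by (simp add: algebra_simps add_nonneg_nonneg)
  finally show "cmod (\<integral>w. hinner (blinfun_apply (b w) (f w)) (g w) \<partial>nu \<alpha>) \<le> A * ((A2_norm \<alpha> f)\<^sup>2 + (A2_norm \<alpha> g)\<^sup>2)" .
qed (use clin A in auto)

text \<open>The value of \<open>f\<close> at \<open>w\<close> is the case \<open>u = 0\<close> of
  the local bound; integrating the local masses against \<open>norm (b w)\<close> gives the
  embedding.\<close>

lemma form_bound_carleson:
  fixes b :: "complex^'n \<Rightarrow> 'd::finite endo"
  assumes \<alpha>: "\<alpha> > - 1" and clin: "b \<in> unit_ball \<rightarrow> clin_ops" and int: "integrable (nu \<alpha>) b" and b: "carleson \<alpha> b M"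
  obtains A where "form_bound \<alpha> b A"
proof -
  obtain C where C: "C > 0" and bound: "\<And>f w u. holomorphic_vec f unit_ball \<Longrightarrow> norm w < 1 \<Longrightarrow> norm u < 1/4 \<Longrightarrow>
      ennreal ((norm (f (phi w u) :: complex^'d))\<^sup>2) \<le> ennreal C * local_mass \<alpha> f (w :: complex^'n)"
    and "\<And>f w u. holomorphic_vec f unit_ball \<Longrightarrow> norm w < 1 \<Longrightarrow> norm u < 1/4 \<Longrightarrow>
      ennreal ((norm (f (phi w u) - f w :: complex^'d))\<^sup>2) \<le> ennreal (C * (norm u)\<^sup>2) * local_mass \<alpha> f (w :: complex^'n)"
    by (rule local_mass_bounds[OF \<alpha>, where 'n='n and 'd='d], rule that)
  have M: "M \<ge> 0"
    using b by (simp add: carleson_def)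
  define A where "A = C * (cmp_const TYPE('n) \<alpha> * M)"
  have c: "cmp_const TYPE('n) \<alpha> \<ge> 0"
    by (simp add: cmp_const_def)
  have "form_bound \<alpha> b A"
  proof (rule form_boundI[OF \<alpha> clin int])
    show "A \<ge> 0"
      using C M c by (simp add: A_def)
    fix f :: "complex^'n \<Rightarrow> complex^'d" assume f: "f \<in> A2 \<alpha>"
    have "(\<integral>\<^sup>+w. ennreal (norm (b w) * (norm (f w))\<^sup>2) \<partial>nu \<alpha>) \<le> (\<integral>\<^sup>+w. ennreal C * (ennreal (norm (b w)) * local_mass \<alpha> f w) \<partial>nu \<alpha>)"
    proof (rule nn_integral_mono)
      fix w assume "w \<in> space (nu \<alpha> :: (complex^'n) measure)"
      then have "ennreal ((norm (f w))\<^sup>2) \<le> ennreal C * local_mass \<alpha> f w"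
        using bound[OF A2D(1)[OF f], of w 0] by simp
      then have "ennreal (norm (b w)) * ennreal ((norm (f w))\<^sup>2) \<le> ennreal (norm (b w)) * (ennreal C * local_mass \<alpha> f w)"
        by (rule mult_left_mono) simp
      then show "ennreal (norm (b w) * (norm (f w))\<^sup>2) \<le> ennreal C * (ennreal (norm (b w)) * local_mass \<alpha> f w)"
        by (simp only: ennreal_mult'' zero_le_power2 mult_ac)
    qed
    also have "\<dots> = ennreal C * (\<integral>\<^sup>+w. ennreal (norm (b w)) * local_mass \<alpha> f w \<partial>nu \<alpha>)"
      by (intro nn_integral_cmult borel_measurable_times_ennreal measurable_local_mass[OF \<alpha> A2D(4)[OF f]]
          measurable_compose[OF measurable_compose[OF borel_measurable_integrable[OF int] borel_measurable_norm] measurable_ennreal])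
    also have "\<dots> \<le> ennreal C * ennreal (cmp_const TYPE('n) \<alpha> * M * (A2_norm \<alpha> f)\<^sup>2)"
      by (intro mult_left_mono carleson_local_mass[OF \<alpha> b f]) simp
    also have "\<dots> = ennreal (A * (A2_norm \<alpha> f)\<^sup>2)"
      using C c M by (simp add: ennreal_mult[symmetric] A_def mult.assoc)
    finally show "(\<integral>\<^sup>+w. ennreal (norm (b w) * (norm (f w))\<^sup>2) \<partial>nu \<alpha>) \<le> ennreal (A * (A2_norm \<alpha> f)\<^sup>2)" .
  qed
  then show ?thesis
    by (rule that)
qed

section \<open>Averaged symbols\<close>

text \<open>The division by the mass of \<open>ball 0 r\<close> normalises in the variable
  \<open>v\<close>: for each fixed \<open>w\<close> the weight has integral 1 in \<open>v\<close>,
  as needed after Fubini.\<close>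

definition avg_symbol :: "real \<Rightarrow> real \<Rightarrow> (complex^'n \<Rightarrow> 'd::finite endo) \<Rightarrow> complex^'n \<Rightarrow> 'd endo" where
  "avg_symbol \<alpha> r b v = (\<integral>w. (local_kern \<alpha> r w v / measure (nu \<alpha>) (ball 0 r \<inter> unit_ball :: (complex^'n) set)) *\<^sub>R b w \<partial>nu \<alpha>)"

lemma local_kern_mono: "r \<le> s \<Longrightarrow> local_kern \<alpha> r w v \<le> local_kern \<alpha> s w v"
  by (auto simp: local_kern_def)

text \<open>After swapping the kernel, the defining integral is dominated by the Carleson integral
  at \<open>v\<close>, hence exists for almost every \<open>v\<close>. The bound grows like
  \<open>1 / m\<close> as \<open>r\<close> shrinks, but it is finite for each
  \<open>r\<close>.\<close>

lemma avg_symbol_bounded: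
  fixes b :: "complex^'n \<Rightarrow> 'd::finite endo"
  assumes \<alpha>: "\<alpha> > - 1" and b: "carleson \<alpha> b M" and r: "0 < r" "r \<le> 1/2"
  defines "m \<equiv> measure (nu \<alpha>) (ball 0 r \<inter> unit_ball :: (complex^'n) set)"
  shows "AE v in nu \<alpha>. integrable (nu \<alpha>) (\<lambda>w. (local_kern \<alpha> r w v / m) *\<^sub>R b w)
      \<and> norm (avg_symbol \<alpha> r b v) \<le> cmp_const TYPE('n) \<alpha> * M / m"
proof -
  have m: "m > 0"
    unfolding m_def by (rule measure_nu_ball_pos[OF \<alpha> r(1)])
  define C where "C = cmp_const TYPE('n) \<alpha>"
  have C: "C \<ge> 0"
    by (simp add: C_def cmp_const_def)
  have M: "M \<ge> 0" and bm [measurable]: "b \<in> borel_measurable (nu \<alpha>)"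
    using b by (simp_all add: carleson_def)
  have "AE v in nu \<alpha>. (\<integral>\<^sup>+w. ennreal (norm (b w)) * ennreal ((cmod (kern \<alpha> v w))\<^sup>2) \<partial>nu \<alpha>) \<le> ennreal M"
    using b by (simp add: carleson_def)
  then show ?thesis
  proof (rule AE_mp, intro AE_I2 impI)
    fix v :: "complex^'n"
    assume "v \<in> space (nu \<alpha>)" and le: "(\<integral>\<^sup>+w. ennreal (norm (b w)) * ennreal ((cmod (kern \<alpha> v w))\<^sup>2) \<partial>nu \<alpha>) \<le> ennreal M"
    then have v: "norm v < 1"
      by simp
    let ?F = "\<lambda>w. (local_kern \<alpha> r w v / m) *\<^sub>R b w"
    have Fm: "?F \<in> borel_measurable (nu \<alpha>)"
      using measurable_local_kern(2)[OF v, of \<alpha> r] by measurable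
    have "(\<integral>\<^sup>+w. ennreal (norm (?F w)) \<partial>nu \<alpha>)
      \<le> (\<integral>\<^sup>+w. ennreal (C / m) * (ennreal (norm (b w)) * ennreal ((cmod (kern \<alpha> v w))\<^sup>2)) \<partial>nu \<alpha>)"
    proof (rule nn_integral_mono)
      fix w assume "w \<in> space (nu \<alpha> :: (complex^'n) measure)"
      then have w: "norm w < 1"
        by simp
      have "local_kern \<alpha> r w v \<le> C * (cmod (kern \<alpha> v w))\<^sup>2"
        using norm_kern_swap_le[OF \<alpha> w v] C r by (auto simp: local_kern_def C_def)
      then have "local_kern \<alpha> r w v / m * norm (b w) \<le> C * (cmod (kern \<alpha> v w))\<^sup>2 / m * norm (b w)"
        using m by (intro mult_right_mono divide_right_mono) auto
      then have "norm (?F w) \<le> C / m * (norm (b w) * (cmod (kern \<alpha> v w))\<^sup>2)"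
        using m by (simp add: abs_mult abs_divide mult_ac)
      then show "ennreal (norm (?F w)) \<le> ennreal (C / m) * (ennreal (norm (b w)) * ennreal ((cmod (kern \<alpha> v w))\<^sup>2))"
        using C m by (simp add: ennreal_mult[symmetric] ennreal_leI)
    qed
    also have "\<dots> = ennreal (C / m) * (\<integral>\<^sup>+w. ennreal (norm (b w)) * ennreal ((cmod (kern \<alpha> v w))\<^sup>2) \<partial>nu \<alpha>)"
      by (intro nn_integral_cmult borel_measurable_times_ennreal
          measurable_compose[OF measurable_norm_kern[OF v] measurable_ennreal]) measurable
    also have "\<dots> \<le> ennreal (C / m) * ennreal M"
      by (rule mult_left_mono[OF le]) simp
    also have "\<dots> = ennreal (C * M / m)"
      using C M m by (simp add: ennreal_mult[symmetric])
    finally have nn: "(\<integral>\<^sup>+w. ennreal (norm (?F w)) \<partial>nu \<alpha>) \<le> ennreal (C * M / m)" .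
    then have int: "integrable (nu \<alpha>) ?F"
      using Fm by (intro integrableI_bounded) (auto intro: le_less_trans)
    have "ennreal (norm (avg_symbol \<alpha> r b v)) \<le> ennreal (C * M / m)"
      using integral_norm_bound_ennreal[OF int] nn unfolding avg_symbol_def m_def by (rule order_trans)
    then have "norm (avg_symbol \<alpha> r b v) \<le> C * M / m"
      using C M m by (simp add: ennreal_le_iff)
    with int show "integrable (nu \<alpha>) ?F \<and> norm (avg_symbol \<alpha> r b v) \<le> cmp_const TYPE('n) \<alpha> * M / m"
      by (simp add: C_def)
  qed
qed

lemma measurable_avg_symbol:
  fixes b :: "complex^'n \<Rightarrow> 'd::finite endo"
  assumes \<alpha>: "\<alpha> > - 1" and b: "b \<in> borel_measurable (nu \<alpha>)"
  shows "avg_symbol \<alpha> r b \<in> borel_measurable (nu \<alpha>)"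
proof -
  let ?N = "nu \<alpha> :: (complex^'n) measure"
  interpret finite_measure ?N
    by (rule finite_measure_nu[OF \<alpha>])
  let ?m = "measure ?N (ball 0 r \<inter> unit_ball)"
  have k: "(\<lambda>x. local_kern \<alpha> r (snd x) (fst x)) \<in> borel_measurable (?N \<Otimes>\<^sub>M ?N)"
    using measurable_compose[OF measurable_pair_swap'[of ?N ?N] measurable_pair_local_kern[of \<alpha> r]]
    by (simp add: split_beta')
  have bm: "(\<lambda>x. b (snd x)) \<in> borel_measurable (?N \<Otimes>\<^sub>M ?N)"
    by (rule measurable_compose[OF measurable_snd b])
  have "(\<lambda>(v, w). (local_kern \<alpha> r w v / ?m) *\<^sub>R b w) \<in> borel_measurable (?N \<Otimes>\<^sub>M ?N)"
    unfolding split_beta' by (intro borel_measurable_scaleR borel_measurable_divide k bm borel_measurable_const)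
  from borel_measurable_lebesgue_integral[OF this] show ?thesis
    unfolding avg_symbol_def .
qed

text \<open>The density of \<open>nu\<close> is positive on the ball. This connects bounds for
  \<open>nu\<close> with \<open>Linf\<close>, which refers to Lebesgue measure.\<close>

lemma AE_nu_iff:
  assumes \<alpha>: "\<alpha> > - 1"
  shows "(AE z in nu \<alpha>. P z) \<longleftrightarrow> (AE z in lebesgue_on (unit_ball :: (complex^'n) set). P z)"
proof -
  have "(AE z in nu \<alpha>. P z) \<longleftrightarrow> (AE z in lebesgue_on unit_ball. 0 < ennreal (wt \<alpha> z) \<longrightarrow> P z)"
    unfolding nu_eq by (rule AE_density) measurable
  also have "\<dots> \<longleftrightarrow> (AE z in lebesgue_on unit_ball. P z)"
    by (rule AE_cong) (simp add: wt_pos[OF \<alpha>])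
  finally show ?thesis .
qed

text \<open>Evaluation at a vector commutes with the integral. In the nonintegrable case the
  integral is 0, which is complex-linear too, so an averaged symbol has values in
  \<open>clin_ops\<close> at every point, as \<open>Linf\<close> demands.\<close>

lemma clin_ops_integral:
  fixes F :: "'a \<Rightarrow> 'd::finite endo"
  assumes "\<And>w. w \<in> space M \<Longrightarrow> F w \<in> clin_ops"
  shows "(\<integral>w. F w \<partial>M) \<in> clin_ops"
proof (cases "integrable M F")
  case True
  have ap: "blinfun_apply (\<integral>w. F w \<partial>M) x = (\<integral>w. blinfun_apply (F w) x \<partial>M)"
    and ai: "integrable M (\<lambda>w. blinfun_apply (F w) x)" for x
    using integral_bounded_linear[OF blinfun.bounded_linear_left True, of x]
      integrable_bounded_linear[OF blinfun.bounded_linear_left True, of x] by simp_all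
  have bl: "bounded_linear (\<lambda>x :: complex^'d. c *s x)" for c
    by (intro linear_conv_bounded_linear[THEN iffD1] linearI) (simp_all add: vec_eq_iff algebra_simps)
  show ?thesis
    unfolding clin_ops_def
  proof (intro CollectI allI)
    fix c v
    have "blinfun_apply (\<integral>w. F w \<partial>M) (c *s v) = (\<integral>w. c *s blinfun_apply (F w) v \<partial>M)"
      unfolding ap by (rule Bochner_Integration.integral_cong) (simp_all add: clin_opsD assms)
    also have "\<dots> = c *s blinfun_apply (\<integral>w. F w \<partial>M) v"
      unfolding ap by (rule integral_bounded_linear[OF bl ai, of c])
    finally show "blinfun_apply (\<integral>w. F w \<partial>M) (c *s v) = c *s blinfun_apply (\<integral>w. F w \<partial>M) v" .
  qed
next
  case False
  then show ?thesis
    by (simp add: not_integrable_integral_eq clin_ops_def)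
qed

lemma scaleR_clin_ops: "A \<in> clin_ops \<Longrightarrow> r *\<^sub>R A \<in> clin_ops"
  by (simp add: clin_ops_def blinfun.scaleR_left scaleR_conv_cmult vec_eq_iff)

lemma diff_clin_ops: "A \<in> clin_ops \<Longrightarrow> B \<in> clin_ops \<Longrightarrow> A - B \<in> clin_ops"
  by (simp add: clin_ops_def blinfun.diff_left vector_ssub_ldistrib)

lemma avg_symbol_Linf:
  fixes b :: "complex^'n \<Rightarrow> 'd::finite endo"
  assumes \<alpha>: "\<alpha> > - 1" and clin: "b \<in> unit_ball \<rightarrow> clin_ops" and b: "carleson \<alpha> b M" and r: "0 < r" "r \<le> 1/2"
  shows "avg_symbol \<alpha> r b \<in> Linf clin_ops"
proof -
  have bm: "b \<in> borel_measurable (nu \<alpha>)"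
    using b by (simp add: carleson_def)
  have "avg_symbol \<alpha> r b v \<in> clin_ops" for v
    unfolding avg_symbol_def using clin by (intro clin_ops_integral scaleR_clin_ops) auto
  moreover have "avg_symbol \<alpha> r b \<in> borel_measurable (lebesgue_on unit_ball)"
    using measurable_avg_symbol[OF \<alpha> bm] by (simp only: measurable_nu_iff)
  moreover have "\<exists>C. AE z in lebesgue_on unit_ball. norm (avg_symbol \<alpha> r b z) \<le> C"
    using avg_symbol_bounded[OF \<alpha> b r] unfolding AE_nu_iff[OF \<alpha>] AE_conj_iff by blast
  ultimately show ?thesis
    by (simp add: Linf_def)
qed

lemma form_bound_Linf:
  fixes b :: "complex^'n \<Rightarrow> 'd::finite endo"
  assumes \<alpha>: "\<alpha> > - 1" and b: "b \<in> Linf clin_ops"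
  obtains A where "form_bound \<alpha> b A"
proof -
  interpret finite_measure "nu \<alpha> :: (complex^'n) measure"
    by (rule finite_measure_nu[OF \<alpha>])
  have clin: "b \<in> unit_ball \<rightarrow> clin_ops" and bm [measurable]: "b \<in> borel_measurable (nu \<alpha>)"
    using b by (simp_all add: Linf_def measurable_nu_iff)
  have "\<exists>C. AE z in nu \<alpha>. norm (b z) \<le> C"
    using b by (simp add: Linf_def AE_nu_iff[OF \<alpha>])
  then obtain C where "AE z in nu \<alpha>. norm (b z) \<le> C" ..
  then have C: "AE z in nu \<alpha>. norm (b z) \<le> max C 0"
    by (rule AE_mp) (auto intro!: AE_I2)
  have "form_bound \<alpha> b (max C 0)"
  proof (rule form_boundI[OF \<alpha> clin])
    show "integrable (nu \<alpha>) b"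
      by (rule integrable_const_bound[OF C bm])
    fix f :: "complex^'n \<Rightarrow> complex^'d" assume f: "f \<in> A2 \<alpha>"
    note [measurable] = A2D(4)[OF f]
    have "(\<integral>\<^sup>+w. ennreal (norm (b w) * (norm (f w))\<^sup>2) \<partial>nu \<alpha>) \<le> (\<integral>\<^sup>+w. ennreal (max C 0) * ennreal ((norm (f w))\<^sup>2) \<partial>nu \<alpha>)"
    proof (rule nn_integral_mono_AE, rule AE_mp[OF C], intro AE_I2 impI)
      fix w assume "norm (b w) \<le> max C 0"
      then have "norm (b w) * (norm (f w))\<^sup>2 \<le> max C 0 * (norm (f w))\<^sup>2"
        by (rule mult_right_mono) simp
      then show "ennreal (norm (b w) * (norm (f w))\<^sup>2) \<le> ennreal (max C 0) * ennreal ((norm (f w))\<^sup>2)"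
        by (simp add: ennreal_mult[symmetric] ennreal_leI)
    qed
    also have "\<dots> = ennreal (max C 0) * (\<integral>\<^sup>+w. ennreal ((norm (f w))\<^sup>2) \<partial>nu \<alpha>)"
      by (rule nn_integral_cmult) measurable
    also have "\<dots> = ennreal (max C 0 * (A2_norm \<alpha> f)\<^sup>2)"
      by (simp add: nn_integral_norm_squared[OF A2D(2)[OF f]] ennreal_mult)
    finally show "(\<integral>\<^sup>+w. ennreal (norm (b w) * (norm (f w))\<^sup>2) \<partial>nu \<alpha>) \<le> ennreal (max C 0 * (A2_norm \<alpha> f)\<^sup>2)" .
  qed simp
  then show ?thesis
    by (rule that)
qed

text \<open>The double integral converges absolutely: \<open>norm_apply_hinner_le\<close> bounds the
  integrand by \<open>norm (b w)\<close>, the local kernel and the integrable function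
  \<open>h / m\<close> of \<open>v\<close>, and \<open>carleson_local\<close> sums this up.\<close>

lemma avg_symbol_Fubini:
  fixes b :: "complex^'n \<Rightarrow> 'd::finite endo"
  assumes \<alpha>: "\<alpha> > - 1" and b: "carleson \<alpha> b M" and r: "0 < r" "r \<le> 1/2"
    and f: "f \<in> A2 \<alpha>" and g: "g \<in> A2 \<alpha>"
  defines "m \<equiv> measure (nu \<alpha>) (ball 0 r \<inter> unit_ball :: (complex^'n) set)"
  shows "(\<integral>v. hinner (blinfun_apply (avg_symbol \<alpha> r b v) (f v)) (g v) \<partial>nu \<alpha>)
      = (\<integral>w. (\<integral>v. (local_kern \<alpha> r w v / m) *\<^sub>R hinner (blinfun_apply (b w) (f v)) (g v) \<partial>nu \<alpha>) \<partial>nu \<alpha>)"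
    and "integrable (nu \<alpha>) (\<lambda>w. (\<integral>v. (local_kern \<alpha> r w v / m) *\<^sub>R hinner (blinfun_apply (b w) (f v)) (g v) \<partial>nu \<alpha>))"
proof -
  let ?N = "nu \<alpha> :: (complex^'n) measure"
  interpret N: finite_measure ?N
    by (rule finite_measure_nu[OF \<alpha>])
  interpret P: pair_sigma_finite ?N ?N ..
  have m: "m > 0"
    unfolding m_def by (rule measure_nu_ball_pos[OF \<alpha> r(1)])
  have bm: "b \<in> borel_measurable ?N" and M: "M \<ge> 0"
    using b by (simp_all add: carleson_def)
  note fm [measurable] = A2D(4)[OF f] and gm [measurable] = A2D(4)[OF g]
  define F where "F w v = (local_kern \<alpha> r w v / m) *\<^sub>R hinner (blinfun_apply (b w) (f v)) (g v)" for w v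
  define h where "h v = (norm (f v))\<^sup>2 + (norm (g v))\<^sup>2" for v
  have hm [measurable]: "h \<in> borel_measurable ?N"
    unfolding h_def by measurable
  have Fm: "case_prod F \<in> borel_measurable (?N \<Otimes>\<^sub>M ?N)"
    unfolding F_def split_beta'
    by (intro borel_measurable_scaleR borel_measurable_divide measurable_pair_local_kern borel_measurable_const
        measurable_hinner measurable_blinfun_apply measurable_compose[OF measurable_fst bm]
        measurable_compose[OF measurable_snd fm] measurable_compose[OF measurable_snd gm])
  have Fi: "integrable (?N \<Otimes>\<^sub>M ?N) (case_prod F)"
  proof (rule integrableI_bounded[OF Fm])
    have "(\<integral>\<^sup>+x. ennreal (norm (case_prod F x)) \<partial>(?N \<Otimes>\<^sub>M ?N)) = (\<integral>\<^sup>+w. \<integral>\<^sup>+v. ennreal (norm (case_prod F (w, v))) \<partial>?N \<partial>?N)"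
      by (intro N.nn_integral_fst[symmetric] measurable_compose[OF measurable_compose[OF Fm borel_measurable_norm] measurable_ennreal])
    also have "\<dots> \<le> (\<integral>\<^sup>+w. ennreal (norm (b w)) * (\<integral>\<^sup>+v. ennreal (local_kern \<alpha> (1/2) w v) * ennreal (h v / m) \<partial>?N) \<partial>?N)"
    proof (rule nn_integral_mono)
      fix w assume w: "w \<in> space ?N"
      have "(\<integral>\<^sup>+v. ennreal (norm (case_prod F (w, v))) \<partial>?N) \<le> (\<integral>\<^sup>+v. ennreal (norm (b w)) * (ennreal (local_kern \<alpha> (1/2) w v) * ennreal (h v / m)) \<partial>?N)"
      proof (rule nn_integral_mono)
        fix v
        have h0: "h v \<ge> 0"
          by (simp add: h_def)
        have "norm (F w v) = local_kern \<alpha> r w v / m * cmod (hinner (blinfun_apply (b w) (f v)) (g v))"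
          using m by (simp add: F_def)
        also have "\<dots> \<le> local_kern \<alpha> (1/2) w v / m * (norm (b w) * (h v / 2))"
          unfolding h_def using m local_kern_mono[OF r(2), of \<alpha> w v]
          by (intro mult_mono divide_right_mono norm_apply_hinner_le) (auto simp: add_nonneg_nonneg)
        also have "\<dots> \<le> norm (b w) * (local_kern \<alpha> (1/2) w v * (h v / m))"
          using m h0 by (simp add: field_simps mult_left_mono)
        finally show "ennreal (norm (case_prod F (w, v))) \<le> ennreal (norm (b w)) * (ennreal (local_kern \<alpha> (1/2) w v) * ennreal (h v / m))"
          using m h0 by (simp add: ennreal_mult[symmetric] ennreal_leI)
      qed
      also have "\<dots> = ennreal (norm (b w)) * (\<integral>\<^sup>+v. ennreal (local_kern \<alpha> (1/2) w v) * ennreal (h v / m) \<partial>?N)"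
        using w by (intro nn_integral_cmult borel_measurable_times_ennreal
            measurable_compose[OF measurable_local_kern(1) measurable_ennreal]) (simp, measurable)
      finally show "(\<integral>\<^sup>+v. ennreal (norm (case_prod F (w, v))) \<partial>?N)
        \<le> ennreal (norm (b w)) * (\<integral>\<^sup>+v. ennreal (local_kern \<alpha> (1/2) w v) * ennreal (h v / m) \<partial>?N)" .
    qed
    also have "\<dots> \<le> ennreal (cmp_const TYPE('n) \<alpha> * M) * (\<integral>\<^sup>+v. ennreal (h v / m) \<partial>?N)"
      by (rule carleson_local[OF \<alpha> b]) measurable
    also have "\<dots> < \<infinity>"
    proof -
      have "integrable ?N (\<lambda>v. h v / m)"
        unfolding h_def using A2D(2)[OF f] A2D(2)[OF g] by simp
      moreover have "h v / m \<ge> 0" for v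
        using m by (simp add: h_def)
      ultimately have "(\<integral>\<^sup>+v. ennreal (h v / m) \<partial>?N) = ennreal (\<integral>v. h v / m \<partial>?N)"
        by (intro nn_integral_eq_integral) auto
      then show ?thesis
        by (simp add: ennreal_mult_less_top)
    qed
    finally show "(\<integral>\<^sup>+x. ennreal (norm (case_prod F x)) \<partial>(?N \<Otimes>\<^sub>M ?N)) < \<infinity>" .
  qed
  show "integrable ?N (\<lambda>w. (\<integral>v. (local_kern \<alpha> r w v / m) *\<^sub>R hinner (blinfun_apply (b w) (f v)) (g v) \<partial>?N))"
    using P.integrable_fst[OF Fi] by (simp add: F_def)
  have "(\<integral>v. hinner (blinfun_apply (avg_symbol \<alpha> r b v) (f v)) (g v) \<partial>?N) = (\<integral>v. (\<integral>w. F w v \<partial>?N) \<partial>?N)"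
  proof (rule integral_cong_AE)
    show "(\<lambda>v. hinner (blinfun_apply (avg_symbol \<alpha> r b v) (f v)) (g v)) \<in> borel_measurable ?N"
      by (intro measurable_hinner measurable_blinfun_apply measurable_avg_symbol \<alpha> bm fm gm)
    show "(\<lambda>v. \<integral>w. F w v \<partial>?N) \<in> borel_measurable ?N"
      by (rule borel_measurable_integrable[OF P.integrable_snd[OF Fi]])
    \<comment> \<open>For these \<open>v\<close> the operator-valued integral exists, so applying it
      to \<open>f v\<close> and pairing with \<open>g v\<close> may be done under the integral
      sign.\<close>
    have "AE v in ?N. integrable ?N (\<lambda>w. (local_kern \<alpha> r w v / m) *\<^sub>R b w)"
      using avg_symbol_bounded[OF \<alpha> b r] by (rule AE_mp) (simp add: m_def)
    then show "AE v in ?N. hinner (blinfun_apply (avg_symbol \<alpha> r b v) (f v)) (g v) = (\<integral>w. F w v \<partial>?N)"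
    proof (rule AE_mp, intro AE_I2 impI)
      fix v assume i: "integrable ?N (\<lambda>w. (local_kern \<alpha> r w v / m) *\<^sub>R b w)"
      have "bounded_linear (\<lambda>X :: 'd endo. hinner (blinfun_apply X (f v)) (g v))"
        by (rule bounded_linear_compose[OF bounded_linear_hinner_left blinfun.bounded_linear_left])
      from integral_bounded_linear[OF this i]
      show "hinner (blinfun_apply (avg_symbol \<alpha> r b v) (f v)) (g v) = (\<integral>w. F w v \<partial>?N)"
        by (simp add: avg_symbol_def m_def F_def blinfun.scaleR_left hinner_scaleR_left scaleR_conv_of_real[where 'a=complex])
    qed
  qed
  also have "\<dots> = (\<integral>w. (\<integral>v. F w v \<partial>?N) \<partial>?N)"
    by (rule P.Fubini_integral[OF Fi])
  finally show "(\<integral>v. hinner (blinfun_apply (avg_symbol \<alpha> r b v) (f v)) (g v) \<partial>?N)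
      = (\<integral>w. (\<integral>v. (local_kern \<alpha> r w v / m) *\<^sub>R hinner (blinfun_apply (b w) (f v)) (g v) \<partial>?N) \<partial>?N)"
    by (simp only: F_def)
qed

section \<open>Comparison of a symbol with its average\<close>

text \<open>In the coordinates \<open>phi w\<close> the weighted integral is a plain average over
  \<open>ball 0 r\<close>, of total mass \<open>m\<close>. The constant \<open>H w\<close> is its
  own average, so the oscillation bound \<open>D\<close> carries over.\<close>

lemma local_average_diff_le:
  fixes H :: "complex^'n \<Rightarrow> complex"
  assumes \<alpha>: "\<alpha> > - 1" and w: "norm w < 1" and r: "r > 0" and Hm: "H \<in> borel_measurable (nu \<alpha>)"
    and D: "\<And>u. norm u < r \<Longrightarrow> norm u < 1 \<Longrightarrow> cmod (H w - H (phi w u)) \<le> D"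
  defines "m \<equiv> measure (nu \<alpha>) (ball 0 r \<inter> unit_ball :: (complex^'n) set)"
  shows "cmod (H w - (\<integral>v. (local_kern \<alpha> r w v / m) *\<^sub>R H v \<partial>nu \<alpha>)) \<le> D"
proof -
  let ?N = "nu \<alpha> :: (complex^'n) measure"
  interpret finite_measure ?N
    by (rule finite_measure_nu[OF \<alpha>])
  have m: "m > 0"
    unfolding m_def by (rule measure_nu_ball_pos[OF \<alpha> r])
  have D0: "D \<ge> 0"
    using D[of 0] r by (simp add: order_trans[OF norm_ge_zero])
  define G where "G u = indicator (ball 0 r) u *\<^sub>R H (phi w u)" for u
  define J where "J u = indicator (ball 0 r) u *\<^sub>R H w" for u :: "complex^'n"
  have im: "indicator (ball 0 r) \<in> borel_measurable ?N"
    by (simp add: borel_measurable_indicator_iff ball_Int_unit_ball_sets)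
  have Gm: "G \<in> borel_measurable ?N"
    unfolding G_def by (intro borel_measurable_scaleR im measurable_compose[OF measurable_phi_nu[OF w] Hm])
  have Jm: "J \<in> borel_measurable ?N"
    unfolding J_def by (intro borel_measurable_scaleR im borel_measurable_const)
  have diff: "cmod (J u - G u) \<le> indicator (ball 0 r) u * D" if "norm u < 1" for u
    using D[OF _ that] by (simp add: J_def G_def indicator_def)
  have Ji: "integrable ?N J"
    by (rule integrable_bounded_nu[OF \<alpha> Jm, of "cmod (H w)"]) (simp add: J_def indicator_def)
  have Gi: "integrable ?N G"
  proof (rule integrable_bounded_nu[OF \<alpha> Gm, of "cmod (H w) + D"])
    fix u :: "complex^'n" assume u: "norm u < 1"
    have "cmod (J u) \<le> cmod (H w)" "cmod (J u - G u) \<le> D"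
      using diff[OF u] D0 by (auto simp: J_def indicator_def split: if_splits)
    then show "cmod (G u) \<le> cmod (H w) + D"
      using norm_triangle_ineq4[of "J u" "J u - G u"] by simp
  qed
  have ind: "(\<integral>u. indicator (ball 0 r) u \<partial>?N) = m"
    by (simp add: m_def)
  have ii: "integrable ?N (\<lambda>u. indicator (ball 0 r) u :: real)"
    by (rule integrable_bounded_nu[OF \<alpha> im, of 1]) (simp add: indicator_def)
  have "(\<integral>v. (local_kern \<alpha> r w v / m) *\<^sub>R H v \<partial>?N) = (\<integral>v. (1 / m) *\<^sub>R ((cmod (kern \<alpha> w v))\<^sup>2 *\<^sub>R G (phi w v)) \<partial>?N)"
    by (rule Bochner_Integration.integral_cong)
      (simp_all add: G_def local_kern_def indicator_def phi_phi[OF w])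
  also have "\<dots> = (1 / m) *\<^sub>R (\<integral>u. G u \<partial>?N)"
    by (simp only: integral_scaleR_right integral_nu_phi(1)[OF w Gm])
  finally have avg: "(\<integral>v. (local_kern \<alpha> r w v / m) *\<^sub>R H v \<partial>?N) = (1 / m) *\<^sub>R (\<integral>u. G u \<partial>?N)" .
  have "(\<integral>u. J u \<partial>?N) = m *\<^sub>R H w"
    unfolding J_def ind[symmetric] by (rule integral_scaleR_left) (rule ii)
  then have "m *\<^sub>R H w - (\<integral>u. G u \<partial>?N) = (\<integral>u. J u - G u \<partial>?N)"
    by (simp add: Bochner_Integration.integral_diff[OF Ji Gi])
  moreover have "cmod (\<integral>u. J u - G u \<partial>?N) \<le> (\<integral>u. indicator (ball 0 r) u * D \<partial>?N)"
    by (rule Bochner_Integration.integral_norm_bound_integral)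
      (use Ji Gi ii diff in auto)
  ultimately have le: "cmod (m *\<^sub>R H w - (\<integral>u. G u \<partial>?N)) \<le> m * D"
    using ind by simp
  have "H w - (1 / m) *\<^sub>R (\<integral>u. G u \<partial>?N) = (1 / m) *\<^sub>R (m *\<^sub>R H w - (\<integral>u. G u \<partial>?N))"
    using m by (simp add: scaleR_diff_right)
  then have "cmod (H w - (1 / m) *\<^sub>R (\<integral>u. G u \<partial>?N)) = cmod (m *\<^sub>R H w - (\<integral>u. G u \<partial>?N)) / m"
    using m by simp
  also have "\<dots> \<le> D"
    using le m by (simp add: divide_le_eq mult.commute)
  finally show ?thesis
    unfolding avg .
qed

text \<open>The inequality of arithmetic and geometric means for \<open>x\<close> and
  \<open>r * y\<close>. Here \<open>x\<close> is an oscillation, of order \<open>r\<close>, and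
  \<open>y\<close> a size of order 1; the balanced weight keeps one full power of
  \<open>r\<close>.\<close>

lemma norm_mult_le_weighted:
  fixes x y :: real
  assumes x: "x\<^sup>2 \<le> C * r\<^sup>2 * a" and y: "y\<^sup>2 \<le> C * b" and r: "r > 0"
  shows "x * y \<le> C * r * (a + b) / 2"
proof -
  have "2 * r * (x * y) \<le> x\<^sup>2 + r\<^sup>2 * y\<^sup>2"
    using zero_le_power2[of "x - r * y"] by (simp add: power2_eq_square algebra_simps)
  also have "\<dots> \<le> C * r\<^sup>2 * a + r\<^sup>2 * (C * b)"
    using x y by (intro add_mono mult_left_mono) auto
  also have "\<dots> = 2 * r * (C * r * (a + b) / 2)"
    by (simp add: power2_eq_square algebra_simps)
  finally show ?thesis
    by (rule mult_left_le_imp_le) (use r in simp)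
qed

lemma ennreal_le_mult_real:
  assumes "ennreal x \<le> ennreal c * ennreal a" "0 \<le> c" "0 \<le> a"
  shows "x \<le> c * a"
  using assms by (simp add: ennreal_mult[symmetric] ennreal_le_iff)

text \<open>For fixed \<open>w\<close> the operator is constant and only \<open>f\<close> and
  \<open>g\<close> vary over the Bergman ball. The bounds from \<open>local_mass_bounds\<close>
  enter as hypotheses so that \<open>C\<close> is one constant for all \<open>w\<close> and
  \<open>r\<close>.\<close>

lemma local_average_form_diff_le:
  fixes f g :: "complex^'n \<Rightarrow> complex^'d"
  assumes \<alpha>: "\<alpha> > - 1" and C: "C > 0"
    and bound: "\<And>f w u. holomorphic_vec f unit_ball \<Longrightarrow> norm w < 1 \<Longrightarrow> norm u < 1/4 \<Longrightarrow>
      ennreal ((norm (f (phi w u) :: complex^'d))\<^sup>2) \<le> ennreal C * local_mass \<alpha> f (w :: complex^'n)"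
    and osc: "\<And>f w u. holomorphic_vec f unit_ball \<Longrightarrow> norm w < 1 \<Longrightarrow> norm u < 1/4 \<Longrightarrow>
      ennreal ((norm (f (phi w u) - f w :: complex^'d))\<^sup>2) \<le> ennreal (C * (norm u)\<^sup>2) * local_mass \<alpha> f (w :: complex^'n)"
    and w: "norm w < 1" and r: "0 < r" "r \<le> 1/4" and f: "f \<in> A2 \<alpha>" and g: "g \<in> A2 \<alpha>"
  defines "m \<equiv> measure (nu \<alpha>) (ball 0 r \<inter> unit_ball :: (complex^'n) set)"
  shows "ennreal (cmod (hinner (blinfun_apply A (f w)) (g w)
        - (\<integral>v. (local_kern \<alpha> r w v / m) *\<^sub>R hinner (blinfun_apply A (f v)) (g v) \<partial>nu \<alpha>)))
      \<le> ennreal (norm A) * (ennreal (C * r) * (local_mass \<alpha> f w + local_mass \<alpha> g w))" (is "ennreal ?L \<le> _")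
proof (cases "A = 0 \<or> local_mass \<alpha> f w = top \<or> local_mass \<alpha> g w = top")
  \<comment> \<open>For \<open>A = 0\<close> the left side is 0. Otherwise an infinite mass makes
    the right side infinite, because \<open>C * r\<close> is positive.\<close>
  case True
  then show ?thesis
    using C r by (auto simp: blinfun.zero_left hinner_def ennreal_mult_top ennreal_top_mult ennreal_mult_eq_top_iff top_unique)
next
  case False
  obtain a where a: "local_mass \<alpha> f w = ennreal a" "a \<ge> 0"
    using False by (cases "local_mass \<alpha> f w") auto
  obtain b where b: "local_mass \<alpha> g w = ennreal b" "b \<ge> 0"
    using False by (cases "local_mass \<alpha> g w") auto
  note hf = A2D(1)[OF f] and hg = A2D(1)[OF g]
  have "?L \<le> norm A * (C * r * (a + b))"
    unfolding m_def
  proof (rule local_average_diff_le[OF \<alpha> w r(1)])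
    show "(\<lambda>v. hinner (blinfun_apply A (f v)) (g v)) \<in> borel_measurable (nu \<alpha>)"
      by (intro measurable_hinner measurable_blinfun_apply borel_measurable_const A2D(4)[OF f] A2D(4)[OF g])
    fix u :: "complex^'n" assume u: "norm u < r" "norm u < 1"
    then have u4: "norm u < 1/4"
      using r by simp
    have ur: "(norm u)\<^sup>2 \<le> r\<^sup>2"
      using u by (intro power_mono) auto
    have osc': "(norm (h (phi w u) - h w))\<^sup>2 \<le> C * r\<^sup>2 * c" if "holomorphic_vec h unit_ball" "local_mass \<alpha> h w = ennreal c" "c \<ge> 0"
      for h :: "complex^'n \<Rightarrow> complex^'d" and c
    proof -
      have "(norm (h (phi w u) - h w))\<^sup>2 \<le> C * (norm u)\<^sup>2 * c"
        using osc[OF that(1) w u4] C that(2,3) by (intro ennreal_le_mult_real) auto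
      also have "\<dots> \<le> C * r\<^sup>2 * c"
        using ur C that(3) by (intro mult_right_mono mult_left_mono) auto
      finally show ?thesis .
    qed
    have f1: "(norm (f (phi w u)))\<^sup>2 \<le> C * a"
      using bound[OF hf w u4] a C by (intro ennreal_le_mult_real) auto
    have g1: "(norm (g w))\<^sup>2 \<le> C * b"
      using bound[OF hg w, of 0] b C by (intro ennreal_le_mult_real) auto
    \<comment> \<open>Changing one argument at a time leaves two products, each with one oscillation
      and one size: the size of \<open>g\<close> at the centre and that of \<open>f\<close> at the
      moving point.\<close>
    have "cmod (hinner (blinfun_apply A (f w)) (g w) - hinner (blinfun_apply A (f (phi w u))) (g (phi w u)))
      = cmod (hinner (blinfun_apply A (f w - f (phi w u))) (g w) + hinner (blinfun_apply A (f (phi w u))) (g w - g (phi w u)))"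
      by (simp add: hinner_def blinfun.diff_right sum.distrib[symmetric] sum_subtractf[symmetric] algebra_simps)
    also have "\<dots> \<le> norm (blinfun_apply A (f w - f (phi w u))) * norm (g w) + norm (blinfun_apply A (f (phi w u))) * norm (g w - g (phi w u))"
      by (intro order_trans[OF norm_triangle_ineq] add_mono norm_hinner_le)
    also have "\<dots> \<le> norm A * norm (f w - f (phi w u)) * norm (g w) + norm A * norm (f (phi w u)) * norm (g w - g (phi w u))"
      by (intro add_mono mult_right_mono norm_blinfun) auto
    also have "\<dots> = norm A * (norm (f (phi w u) - f w) * norm (g w) + norm (g (phi w u) - g w) * norm (f (phi w u)))"
      by (simp add: norm_minus_commute algebra_simps)
    also have "\<dots> \<le> norm A * (C * r * (a + b) / 2 + C * r * (b + a) / 2)"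
      by (intro mult_left_mono add_mono norm_mult_le_weighted osc' hf hg a b f1 g1 r(1)) simp
    also have "\<dots> = norm A * (C * r * (a + b))"
      by (simp add: field_simps)
    finally show "cmod (hinner (blinfun_apply A (f w)) (g w) - hinner (blinfun_apply A (f (phi w u))) (g (phi w u)))
      \<le> norm A * (C * r * (a + b))" .
  qed
  then have "ennreal ?L \<le> ennreal (norm A * (C * r * (a + b)))"
    by (rule ennreal_leI)
  also have "\<dots> = ennreal (norm A) * (ennreal (C * r) * (local_mass \<alpha> f w + local_mass \<alpha> g w))"
    using a b C r by (simp add: ennreal_mult ennreal_plus)
  finally show ?thesis .
qed

text \<open>\<open>B\<close> is the product of the constant of the local bounds and the constant of
  the Carleson estimate, both independent of \<open>r\<close>; the factor \<open>r\<close> comes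
  from the oscillation.\<close>

lemma form_bound_avg_symbol_diff:
  fixes b :: "complex^'n \<Rightarrow> 'd::finite endo"
  assumes \<alpha>: "\<alpha> > - 1" and b: "carleson \<alpha> b M" and bb: "form_bound \<alpha> b K"
  obtains B where "\<And>r. 0 < r \<Longrightarrow> r \<le> 1/4 \<Longrightarrow> form_bound \<alpha> (\<lambda>w. b w - avg_symbol \<alpha> r b w) (B * r)" "B \<ge> 0"
proof -
  obtain C where C: "C > 0" and bound: "\<And>f w u. holomorphic_vec f unit_ball \<Longrightarrow> norm w < 1 \<Longrightarrow> norm u < 1/4 \<Longrightarrow>
      ennreal ((norm (f (phi w u) :: complex^'d))\<^sup>2) \<le> ennreal C * local_mass \<alpha> f (w :: complex^'n)"
    and osc: "\<And>f w u. holomorphic_vec f unit_ball \<Longrightarrow> norm w < 1 \<Longrightarrow> norm u < 1/4 \<Longrightarrow>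
      ennreal ((norm (f (phi w u) - f w :: complex^'d))\<^sup>2) \<le> ennreal (C * (norm u)\<^sup>2) * local_mass \<alpha> f (w :: complex^'n)"
    by (rule local_mass_bounds[OF \<alpha>, where 'n='n and 'd='d], rule that)
  define c where "c = cmp_const TYPE('n) \<alpha> * M"
  have M: "M \<ge> 0" and bm: "b \<in> borel_measurable (nu \<alpha>)"
    using b by (simp_all add: carleson_def)
  have c: "c \<ge> 0"
    using M by (simp add: c_def cmp_const_def)
  have clin: "b \<in> unit_ball \<rightarrow> clin_ops"
    using bb by (simp add: form_bound_def)
  have "form_bound \<alpha> (\<lambda>w. b w - avg_symbol \<alpha> r b w) (C * c * r)" if r: "0 < r" "r \<le> 1/4" for r
  proof -
    let ?a = "avg_symbol \<alpha> r b"
    have r2: "r \<le> 1/2"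
      using r by simp
    have aL: "?a \<in> Linf clin_ops"
      by (rule avg_symbol_Linf[OF \<alpha> clin b r(1) r2])
    \<comment> \<open>\<open>L\<close> depends on \<open>r\<close> and stays out of the final
      constant; it secures the integrability of the terms with the averaged symbol.\<close>
    obtain L where ab: "form_bound \<alpha> ?a L"
      using form_bound_Linf[OF \<alpha> aL] .
    note bd = bb[unfolded form_bound_def] and ad = ab[unfolded form_bound_def]
    have diff: "hinner (blinfun_apply (b w - ?a w) (f w)) (g w)
      = hinner (blinfun_apply (b w) (f w)) (g w) - hinner (blinfun_apply (?a w) (f w)) (g w)"
      for f g :: "complex^'n \<Rightarrow> complex^'d" and w
      by (simp add: blinfun.diff_left hinner_diff_left)
    have est: "cmod (\<integral>w. hinner (blinfun_apply (b w - ?a w) (f w)) (g w) \<partial>nu \<alpha>)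
        \<le> C * c * r * ((A2_norm \<alpha> f)\<^sup>2 + (A2_norm \<alpha> g)\<^sup>2)"
      if f: "f \<in> A2 \<alpha>" and g: "g \<in> A2 \<alpha>" for f g :: "complex^'n \<Rightarrow> complex^'d"
    proof -
      let ?m = "measure (nu \<alpha>) (ball 0 r \<inter> unit_ball :: (complex^'n) set)"
      define H where "H w = hinner (blinfun_apply (b w) (f w)) (g w)" for w
      define I where "I w = (\<integral>v. (local_kern \<alpha> r w v / ?m) *\<^sub>R hinner (blinfun_apply (b w) (f v)) (g v) \<partial>nu \<alpha>)" for w
      have Hi: "integrable (nu \<alpha>) H"
        using bd f g unfolding H_def by blast
      have Ii: "integrable (nu \<alpha>) I"
        unfolding I_def by (rule avg_symbol_Fubini(2)[OF \<alpha> b r(1) r2 f g])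
      have ai: "integrable (nu \<alpha>) (\<lambda>w. hinner (blinfun_apply (?a w) (f w)) (g w))"
        using ad f g by blast
      note lm [measurable] = measurable_local_mass[OF \<alpha> A2D(4)[OF f]] measurable_local_mass[OF \<alpha> A2D(4)[OF g]]
      have nb: "(\<lambda>w. ennreal (norm (b w))) \<in> borel_measurable (nu \<alpha>)"
        by (rule measurable_compose[OF measurable_compose[OF bm borel_measurable_norm] measurable_ennreal])
      have "(\<integral>w. hinner (blinfun_apply (b w - ?a w) (f w)) (g w) \<partial>nu \<alpha>) = (\<integral>w. H w \<partial>nu \<alpha>) - (\<integral>w. I w \<partial>nu \<alpha>)"
        unfolding diff using Bochner_Integration.integral_diff[OF Hi[unfolded H_def] ai]
        by (simp only: H_def I_def avg_symbol_Fubini(1)[OF \<alpha> b r(1) r2 f g])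
      also have "\<dots> = (\<integral>w. H w - I w \<partial>nu \<alpha>)"
        by (simp add: Bochner_Integration.integral_diff[OF Hi Ii])
      finally have eq: "(\<integral>w. hinner (blinfun_apply (b w - ?a w) (f w)) (g w) \<partial>nu \<alpha>) = (\<integral>w. H w - I w \<partial>nu \<alpha>)" .
      have "ennreal (cmod (\<integral>w. H w - I w \<partial>nu \<alpha>)) \<le> (\<integral>\<^sup>+w. ennreal (cmod (H w - I w)) \<partial>nu \<alpha>)"
        by (rule integral_norm_bound_ennreal) (rule Bochner_Integration.integrable_diff[OF Hi Ii])
      also have "\<dots> \<le> (\<integral>\<^sup>+w. ennreal (C * r) * (ennreal (norm (b w)) * local_mass \<alpha> f w + ennreal (norm (b w)) * local_mass \<alpha> g w) \<partial>nu \<alpha>)"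
      proof (rule nn_integral_mono)
        fix w assume "w \<in> space (nu \<alpha> :: (complex^'n) measure)"
        then have w: "norm w < 1"
          by simp
        show "ennreal (cmod (H w - I w)) \<le> ennreal (C * r) * (ennreal (norm (b w)) * local_mass \<alpha> f w + ennreal (norm (b w)) * local_mass \<alpha> g w)"
          using local_average_form_diff_le[OF \<alpha> C bound osc w r f g, of "b w"]
          by (simp add: H_def I_def algebra_simps)
      qed
      also have "\<dots> = ennreal (C * r) * ((\<integral>\<^sup>+w. ennreal (norm (b w)) * local_mass \<alpha> f w \<partial>nu \<alpha>)
          + (\<integral>\<^sup>+w. ennreal (norm (b w)) * local_mass \<alpha> g w \<partial>nu \<alpha>))"
        by (subst nn_integral_cmult)
          (intro borel_measurable_add borel_measurable_times_ennreal nb lm,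
            subst nn_integral_add, intro borel_measurable_times_ennreal nb lm,
            intro borel_measurable_times_ennreal nb lm, rule refl)
      also have "\<dots> \<le> ennreal (C * r) * (ennreal (c * (A2_norm \<alpha> f)\<^sup>2) + ennreal (c * (A2_norm \<alpha> g)\<^sup>2))"
        unfolding c_def by (intro mult_left_mono add_mono carleson_local_mass[OF \<alpha> b] f g) simp
      also have "\<dots> = ennreal (C * c * r * ((A2_norm \<alpha> f)\<^sup>2 + (A2_norm \<alpha> g)\<^sup>2))"
        using C c r by (simp add: ennreal_plus[symmetric] ennreal_mult[symmetric] algebra_simps del: ennreal_plus)
      finally have "ennreal (cmod (\<integral>w. H w - I w \<partial>nu \<alpha>)) \<le> ennreal (C * c * r * ((A2_norm \<alpha> f)\<^sup>2 + (A2_norm \<alpha> g)\<^sup>2))" .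
      then show ?thesis
        unfolding eq using C c r by (simp add: ennreal_le_iff add_nonneg_nonneg)
    qed
    show ?thesis
      unfolding form_bound_def
    proof (intro conjI ballI est)
      show "(\<lambda>w. b w - ?a w) \<in> unit_ball \<rightarrow> clin_ops"
        using bd ad by (auto intro: diff_clin_ops)
      show "C * c * r \<ge> 0"
        using C c r by simp
      fix f g :: "complex^'n \<Rightarrow> complex^'d"
      assume f: "f \<in> A2 \<alpha>"
      show "integrable (nu \<alpha>) (\<lambda>w. blinfun_apply (b w - ?a w) (f w))"
        unfolding blinfun.diff_left using bd ad f by (intro Bochner_Integration.integrable_diff) blast+
      assume g: "g \<in> A2 \<alpha>"
      show "integrable (nu \<alpha>) (\<lambda>w. hinner (blinfun_apply (b w - ?a w) (f w)) (g w))"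
        unfolding diff using bd ad f g by (intro Bochner_Integration.integrable_diff) blast+
    qed
  qed
  moreover have "C * c \<ge> 0"
    using C c by simp
  ultimately show ?thesis
    using that by blast
qed

section \<open>From bounded mean oscillation to the Toeplitz algebra\<close>

text \<open>The substitution \<open>phi z\<close> turns the Carleson integral at \<open>z\<close>
  into the mean of \<open>norm (b (phi z u))\<close>, at most the oscillation around the Berezin
  transform plus the norm of the latter. The second is bounded only almost everywhere, hence the
  exceptional null set in \<open>carleson\<close>.\<close>

lemma carleson_BMO1:
  fixes b :: "complex^'n \<Rightarrow> 'd::finite endo"
  assumes \<alpha>: "\<alpha> > - 1" and b: "b \<in> BMO1 \<alpha> clin_ops" and B: "berezin \<alpha> b \<in> Linf clin_ops"
  obtains M where "carleson \<alpha> b M"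
proof -
  have bi: "integrable (nu \<alpha>) b" and fin: "bmo_norm \<alpha> b < top"
    using b by (simp_all add: BMO1_def L1_def)
  note bm = borel_measurable_integrable[OF bi]
  obtain N where N: "bmo_norm \<alpha> b = ennreal N" "N \<ge> 0"
    using fin by (cases "bmo_norm \<alpha> b") auto
  have "\<exists>C. AE z in nu \<alpha>. norm (berezin \<alpha> b z) \<le> C"
    using B by (simp add: Linf_def AE_nu_iff[OF \<alpha>])
  then obtain C where C: "AE z in nu \<alpha>. norm (berezin \<alpha> b z) \<le> C" ..
  have "carleson \<alpha> b (N + max C 0)"
    unfolding carleson_def
  proof (intro conjI bm, rule add_nonneg_nonneg[OF N(2)], simp, rule AE_mp[OF C], intro AE_I2 impI)
    fix z :: "complex^'n" assume "z \<in> space (nu \<alpha>)" and Cz: "norm (berezin \<alpha> b z) \<le> C"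
    then have z: "norm z < 1"
      by simp
    let ?B = "berezin \<alpha> b z"
    have bp: "(\<lambda>u. b (phi z u)) \<in> borel_measurable (nu \<alpha>)"
      by (rule measurable_compose[OF measurable_phi_nu[OF z] bm])
    have m: "(\<lambda>u. ennreal (norm (b (phi z u) - ?B))) \<in> borel_measurable (nu \<alpha>)"
      by (intro measurable_compose[OF _ measurable_ennreal] borel_measurable_norm borel_measurable_diff bp borel_measurable_const
          measurable_compose[OF _ borel_measurable_norm])
    have "(\<integral>\<^sup>+w. ennreal (norm (b w)) * ennreal ((cmod (kern \<alpha> z w))\<^sup>2) \<partial>nu \<alpha>) = (\<integral>\<^sup>+u. ennreal (norm (b (phi z u))) \<partial>nu \<alpha>)"
      by (rule nn_integral_nu_phi'[OF z, symmetric])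
        (rule measurable_compose[OF measurable_compose[OF bm borel_measurable_norm] measurable_ennreal])
    also have "\<dots> \<le> (\<integral>\<^sup>+u. ennreal (norm (b (phi z u) - ?B)) + ennreal (max C 0) \<partial>nu \<alpha>)"
    proof (rule nn_integral_mono)
      fix u
      have "norm (b (phi z u)) \<le> norm (b (phi z u) - ?B) + max C 0"
        using norm_triangle_ineq[of "b (phi z u) - ?B" ?B] Cz by simp
      then show "ennreal (norm (b (phi z u))) \<le> ennreal (norm (b (phi z u) - ?B)) + ennreal (max C 0)"
        by (simp add: ennreal_plus[symmetric] ennreal_leI del: ennreal_plus)
    qed
    also have "\<dots> = (\<integral>\<^sup>+u. ennreal (norm (b (phi z u) - ?B)) \<partial>nu \<alpha>) + ennreal (max C 0)"
      by (subst nn_integral_add[OF m]) (simp_all add: emeasure_nu_space[OF \<alpha>])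
    also have "(\<integral>\<^sup>+u. ennreal (norm (b (phi z u) - ?B)) \<partial>nu \<alpha>) \<le> bmo_norm \<alpha> b"
      unfolding bmo_norm_def using z by (intro SUP_upper) simp
    finally show "(\<integral>\<^sup>+w. ennreal (norm (b w)) * ennreal ((cmod (kern \<alpha> z w))\<^sup>2) \<partial>nu \<alpha>) \<le> ennreal (N + max C 0)"
      using N by (simp add: ennreal_plus add_right_mono)
  qed
  then show ?thesis
    by (rule that)
qed

theorem theorem1p10:
  fixes \<alpha> :: real
    and \<beta> :: "complex^'n \<Rightarrow> 'd::finite endo"
  assumes "\<alpha> > - 1"
    and "\<beta> \<in> BMO1 \<alpha> clin_ops"
    and "berezin \<alpha> \<beta> \<in> Linf clin_ops"
  shows "toeplitz \<alpha> \<beta> \<in> toeplitz_algebra \<alpha>"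
proof -
  note \<alpha> = assms(1)
  have clin: "\<beta> \<in> unit_ball \<rightarrow> clin_ops" and int: "integrable (nu \<alpha>) \<beta>"
    using assms(2) by (simp_all add: BMO1_def L1_def)
  obtain M where M: "carleson \<alpha> \<beta> M"
    using carleson_BMO1[OF assms] .
  obtain K where K: "form_bound \<alpha> \<beta> K"
    using form_bound_carleson[OF \<alpha> clin int M] .
  obtain B where B: "\<And>r. 0 < r \<Longrightarrow> r \<le> 1/4 \<Longrightarrow> form_bound \<alpha> (\<lambda>w. \<beta> w - avg_symbol \<alpha> r \<beta> w) (B * r)" "B \<ge> 0"
    by (rule form_bound_avg_symbol_diff[OF \<alpha> M K], rule that)
  have "\<exists>S\<in>toeplitz_sums \<alpha>. op_norm \<alpha> (\<lambda>f z. toeplitz \<alpha> \<beta> f z - S f z) < \<epsilon>" if \<epsilon>: "\<epsilon> > 0" for \<epsilon>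
  proof -
    \<comment> \<open>The minimum keeps \<open>r\<close> in the range of the local estimates, and
      \<open>B + 1\<close> in place of \<open>B\<close> avoids a division by 0. The choice gives
      \<open>B * r \<le> \<epsilon> / 4\<close>, so the factor 2 of the operator norm estimate
      leaves \<open>\<epsilon> / 2\<close>.\<close>
    define r where "r = min (1/4) (\<epsilon> / (4 * (B + 1)))"
    have "0 < \<epsilon> / (4 * (B + 1))"
      using B(2) \<epsilon> by simp
    then have r: "0 < r" "r \<le> 1/4"
      unfolding r_def by linarith+
    have "B * r \<le> (B + 1) * (\<epsilon> / (4 * (B + 1)))"
      using B(2) r by (intro mult_mono) (auto simp: r_def)
    also have "\<dots> = \<epsilon> / 4"
      using B(2) by (simp add: divide_simps)
    finally have small: "2 * (B * r) < \<epsilon>"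
      using \<epsilon> by simp
    have aL: "avg_symbol \<alpha> r \<beta> \<in> Linf clin_ops"
      using r by (intro avg_symbol_Linf[OF \<alpha> clin M]) auto
    obtain L where L: "form_bound \<alpha> (avg_symbol \<alpha> r \<beta>) L"
      using form_bound_Linf[OF \<alpha> aL] .
    show ?thesis
    proof
      show "toeplitz \<alpha> (avg_symbol \<alpha> r \<beta>) \<in> toeplitz_sums \<alpha>"
        by (intro toeplitz_sums.intros(1) toeplitz_prods.intros(1) aL)
      show "op_norm \<alpha> (\<lambda>f z. toeplitz \<alpha> \<beta> f z - toeplitz \<alpha> (avg_symbol \<alpha> r \<beta>) f z) < \<epsilon>"
        using op_norm_toeplitz_diff_le[OF \<alpha> K L B(1)[OF r]] small by (rule le_less_trans)
    qed
  qed
  then show ?thesis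
    using toeplitz_bounded_ops[OF \<alpha> K] by (simp add: toeplitz_algebra_def)
qed

end
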